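(* Over a field $\mathbb{K}$ of characteristic zero, the Koszul dual operad of the operad $\mathbf{sLeib}$ of symmetric Leibniz algebras is the operad $\mathbf{ComAdm}$ of com.-admissible algebras: $\mathbf{sLeib}^! = \mathbf{ComAdm}$ (up to isomorphism of operads).
   Context: All multiplications are bilinear and identities are required for all elements. A symmetric Leibniz algebra is a $\mathbb{K}$-vector space with a multiplication $\cdot$ satisfying $a \cdot (b \cdot c) = (a \cdot b) \cdot c + b \cdot (a \cdot c)$ and $(a \cdot b) \cdot c = a \cdot (b \cdot c) + (a \cdot c) \cdot b$. A com.-admissible algebra is a $\mathbb{K}$-vector space with a multiplication $\cdot$ such that the symmetric part $a \diamond b = a \cdot b + b \cdot a$ is a commutative associative multiplication. $\mathbf{sLeib}$ and $\mathbf{ComAdm}$ are the binary quadratic symmetric operads whose algebras are these. For a binary quadratic operad $\mathcal{P} = \mathbb{F}(V)/(R)$ with $V$ finite dimensional in arity 2 and $R \subset \mathbb{F}(V)(3)$, the Koszul dual operad is $\mathcal{P}^! = \mathbb{F}(V^\vee)/(R^\perp)$, where $\mathbb{F}$ denotes the free operad, $V^\vee = V^* \otimes \mathrm{sgn}$, and $R^\perp$ is the orthogonal complement of $R$ with respect to the standard pairing between $\mathbb{F}(V^\vee)(3)$ and $\mathbb{F}(V)(3)$. *)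

theory Defs
  imports
    "HOL-Algebra.Algebraic_Closure_Type"
    "HOL-Combinatorics.Permutations"
    "HOL-Library.Poly_Mapping"
begin

section \<open>Vector spaces\<close>

text \<open>
  The ground field is a type \<open>'k\<close> of class \<^class>\<open>field\<close>. A vector space over it is a
  \<^locale>\<open>module\<close> over \<^const>\<open>ring_of_type_algebra\<close>, the field \<open>'k\<close> seen as a ring record.
  The record type of modules extends that of rings, so it has ring fields \<open>mult\<close> and \<open>one\<close> that
  carry no meaning for modules. They are set to \<^const>\<open>undefined\<close>.
\<close>

abbreviation vector_space_rec :: "('k::field, 'a) module \<Rightarrow> bool" where
  "vector_space_rec M \<equiv> module (ring_of_type_algebra :: 'k ring) M"

definition linear_maps :: "('k::field, 'a, 'm) module_scheme \<Rightarrow> ('k, 'b, 'n) module_scheme \<Rightarrow> ('a \<Rightarrow> 'b) set" where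
  "linear_maps M N = {f \<in> carrier M \<rightarrow> carrier N.
     (\<forall>x\<in>carrier M. \<forall>y\<in>carrier M. f (x \<oplus>\<^bsub>M\<^esub> y) = f x \<oplus>\<^bsub>N\<^esub> f y) \<and>
     (\<forall>c. \<forall>x\<in>carrier M. f (c \<odot>\<^bsub>M\<^esub> x) = c \<odot>\<^bsub>N\<^esub> f x)}"

definition linear_forms :: "('k::field, 'a, 'm) module_scheme \<Rightarrow> ('a \<Rightarrow> 'k) set" where
  "linear_forms M = {f.
     (\<forall>x\<in>carrier M. \<forall>y\<in>carrier M. f (x \<oplus>\<^bsub>M\<^esub> y) = f x + f y) \<and>
     (\<forall>c. \<forall>x\<in>carrier M. f (c \<odot>\<^bsub>M\<^esub> x) = c * f x)}"

definition quotient_module :: "('k::field, 'a) module \<Rightarrow> 'a set \<Rightarrow> ('k, 'a set) module" where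
  "quotient_module M H =
    \<lparr>carrier = a_rcosets\<^bsub>M\<^esub> H, monoid.mult = undefined, one = undefined,
     zero = H, add = set_add M,
     module.smult = (\<lambda>c A. \<Union>x\<in>A. H +>\<^bsub>M\<^esub> (c \<odot>\<^bsub>M\<^esub> x))\<rparr>"


section \<open>Symmetric operads\<close>

text \<open>
  Operads are given by partial compositions: \<open>pcomp P m n i x y\<close> is \<open>x \<circ>\<^sub>i y\<close> for
  \<open>x\<close> of arity \<open>m\<close>, \<open>y\<close> of arity \<open>n\<close> and \<open>1 \<le> i \<le> m\<close>. The symmetric group on \<open>{1..n}\<close> acts
  from the left, by renaming variables: \<open>(\<sigma> x)(a\<^sub>1, \<dots>, a\<^sub>n) = x(a\<^bsub>\<sigma> 1\<^esub>, \<dots>, a\<^bsub>\<sigma> n\<^esub>)\<close>.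
  The usual right action is \<open>x\<^sup>\<sigma> = \<sigma>\<^sup>-\<^sup>1 x\<close>.
\<close>

record ('k, 'a) operad =
  ops :: "nat \<Rightarrow> ('k, 'a) module"
  act :: "nat \<Rightarrow> (nat \<Rightarrow> nat) \<Rightarrow> 'a \<Rightarrow> 'a"
  pcomp :: "nat \<Rightarrow> nat \<Rightarrow> nat \<Rightarrow> 'a \<Rightarrow> 'a \<Rightarrow> 'a"
  idop :: 'a

text \<open>
  In \<open>x \<circ>\<^sub>i y\<close>, with \<open>y\<close> of arity \<open>n\<close>, the input \<open>l\<close> of \<open>y\<close> becomes the input \<open>inner i l\<close>, and
  the input \<open>j \<noteq> i\<close> of \<open>x\<close> becomes the input \<open>outer i n j\<close>.
\<close>

definition inner :: "nat \<Rightarrow> nat \<Rightarrow> nat" where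
  "inner i l = i + l - 1"

definition outer :: "nat \<Rightarrow> nat \<Rightarrow> nat \<Rightarrow> nat" where
  "outer i n j = (if j < i then j else j + n - 1)"

locale operad =
  fixes P :: "('k::field, 'a) operad"
  assumes ops_vector_space: "vector_space_rec (ops P n)"
    and act_linear: "\<sigma> permutes {1..n} \<Longrightarrow> act P n \<sigma> \<in> linear_maps (ops P n) (ops P n)"
    and act_id: "x \<in> carrier (ops P n) \<Longrightarrow> act P n id x = x"
    and act_comp: "\<lbrakk>\<sigma> permutes {1..n}; \<tau> permutes {1..n}; x \<in> carrier (ops P n)\<rbrakk>
      \<Longrightarrow> act P n (\<sigma> \<circ> \<tau>) x = act P n \<sigma> (act P n \<tau> x)"
    and pcomp_linear_right: "\<lbrakk>i \<in> {1..m}; x \<in> carrier (ops P m)\<rbrakk>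
      \<Longrightarrow> (\<lambda>y. pcomp P m n i x y) \<in> linear_maps (ops P n) (ops P (m + n - 1))"
    and pcomp_linear_left: "\<lbrakk>i \<in> {1..m}; y \<in> carrier (ops P n)\<rbrakk>
      \<Longrightarrow> (\<lambda>x. pcomp P m n i x y) \<in> linear_maps (ops P m) (ops P (m + n - 1))"
    and idop_closed: "idop P \<in> carrier (ops P 1)"
    and idop_left: "y \<in> carrier (ops P n) \<Longrightarrow> pcomp P 1 n 1 (idop P) y = y"
    and idop_right: "\<lbrakk>i \<in> {1..m}; x \<in> carrier (ops P m)\<rbrakk> \<Longrightarrow> pcomp P m 1 i x (idop P) = x"
    and pcomp_sequential: "\<lbrakk>i \<in> {1..l}; j \<in> {1..m};
        x \<in> carrier (ops P l); y \<in> carrier (ops P m); z \<in> carrier (ops P n)\<rbrakk>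
      \<Longrightarrow> pcomp P (l + m - 1) n (i + j - 1) (pcomp P l m i x y) z =
          pcomp P l (m + n - 1) i x (pcomp P m n j y z)"
    and pcomp_parallel: "\<lbrakk>i \<in> {1..l}; k \<in> {1..l}; i < k;
        x \<in> carrier (ops P l); y \<in> carrier (ops P m); z \<in> carrier (ops P n)\<rbrakk>
      \<Longrightarrow> pcomp P (l + m - 1) n (k + m - 1) (pcomp P l m i x y) z =
          pcomp P (l + n - 1) m i (pcomp P l n k x z) y"
    \<comment> \<open>The permutation \<open>\<rho>\<close> below is determined by \<open>\<sigma>\<close>, \<open>\<tau>\<close> and \<open>i\<close>.\<close>
    and pcomp_equivariant: "\<lbrakk>i \<in> {1..m}; x \<in> carrier (ops P m); y \<in> carrier (ops P n);
        \<sigma> permutes {1..m}; \<tau> permutes {1..n}; \<rho> permutes {1..m + n - 1};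
        \<And>j. j \<in> {1..m} - {i} \<Longrightarrow> \<rho> (outer i n j) = outer (\<sigma> i) n (\<sigma> j);
        \<And>l. l \<in> {1..n} \<Longrightarrow> \<rho> (inner i l) = inner (\<sigma> i) (\<tau> l)\<rbrakk>
      \<Longrightarrow> pcomp P m n (\<sigma> i) (act P m \<sigma> x) (act P n \<tau> y) = act P (m + n - 1) \<rho> (pcomp P m n i x y)"

definition operad_iso :: "('k::field, 'a) operad \<Rightarrow> ('k, 'b) operad \<Rightarrow> (nat \<Rightarrow> 'a \<Rightarrow> 'b) \<Rightarrow> bool" where
  "operad_iso P Q f \<longleftrightarrow>
    (\<forall>n. f n \<in> linear_maps (ops P n) (ops Q n) \<and> bij_betw (f n) (carrier (ops P n)) (carrier (ops Q n))) \<and>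
    (\<forall>n \<sigma>. \<sigma> permutes {1..n} \<longrightarrow> (\<forall>x\<in>carrier (ops P n). f n (act P n \<sigma> x) = act Q n \<sigma> (f n x))) \<and>
    (\<forall>m n. \<forall>i\<in>{1..m}. \<forall>x\<in>carrier (ops P m). \<forall>y\<in>carrier (ops P n).
       f (m + n - 1) (pcomp P m n i x y) = pcomp Q m n i (f m x) (f n y)) \<and>
    f 1 (idop P) = idop Q"

definition operads_isomorphic :: "('k::field, 'a) operad \<Rightarrow> ('k, 'b) operad \<Rightarrow> bool" (infix \<open>\<cong>\<^sub>o\<^sub>p\<close> 50) where
  "P \<cong>\<^sub>o\<^sub>p Q \<longleftrightarrow> operad P \<and> operad Q \<and> (\<exists>f. operad_iso P Q f)"

inductive in_operadic_ideal :: "('k::field, 'a) operad \<Rightarrow> (nat \<Rightarrow> 'a set) \<Rightarrow> nat \<Rightarrow> 'a \<Rightarrow> bool"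
  for P :: "('k, 'a) operad" and G :: "nat \<Rightarrow> 'a set" where
  generator: "x \<in> G n \<Longrightarrow> in_operadic_ideal P G n x"
| zero: "in_operadic_ideal P G n \<zero>\<^bsub>ops P n\<^esub>"
| add: "\<lbrakk>in_operadic_ideal P G n x; in_operadic_ideal P G n y\<rbrakk>
    \<Longrightarrow> in_operadic_ideal P G n (x \<oplus>\<^bsub>ops P n\<^esub> y)"
| smult: "in_operadic_ideal P G n x \<Longrightarrow> in_operadic_ideal P G n (c \<odot>\<^bsub>ops P n\<^esub> x)"
| act: "\<lbrakk>in_operadic_ideal P G n x; \<sigma> permutes {1..n}\<rbrakk> \<Longrightarrow> in_operadic_ideal P G n (act P n \<sigma> x)"
| pcomp_left: "\<lbrakk>in_operadic_ideal P G m x; y \<in> carrier (ops P n); i \<in> {1..m}\<rbrakk>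
    \<Longrightarrow> in_operadic_ideal P G (m + n - 1) (pcomp P m n i x y)"
| pcomp_right: "\<lbrakk>x \<in> carrier (ops P m); in_operadic_ideal P G n y; i \<in> {1..m}\<rbrakk>
    \<Longrightarrow> in_operadic_ideal P G (m + n - 1) (pcomp P m n i x y)"

definition operadic_ideal :: "('k::field, 'a) operad \<Rightarrow> (nat \<Rightarrow> 'a set) \<Rightarrow> nat \<Rightarrow> 'a set" where
  "operadic_ideal P G n = {x. in_operadic_ideal P G n x}"

definition quotient_operad :: "('k::field, 'a) operad \<Rightarrow> (nat \<Rightarrow> 'a set) \<Rightarrow> ('k, 'a set) operad" where
  "quotient_operad P I =
    \<lparr>ops = (\<lambda>n. quotient_module (ops P n) (I n)),
     act = (\<lambda>n \<sigma> A. \<Union>x\<in>A. I n +>\<^bsub>ops P n\<^esub> act P n \<sigma> x),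
     pcomp = (\<lambda>m n i A B. \<Union>x\<in>A. \<Union>y\<in>B. I (m + n - 1) +>\<^bsub>ops P (m + n - 1)\<^esub> pcomp P m n i x y),
     idop = I 1 +>\<^bsub>ops P 1\<^esub> idop P\<rparr>"

definition equivariant_span :: "('k::field, 'a) operad \<Rightarrow> nat \<Rightarrow> 'a set \<Rightarrow> 'a set" where
  "equivariant_span P n A = \<Inter>{H. submodule H (ring_of_type_algebra :: 'k ring) (ops P n) \<and>
     (\<forall>\<sigma>. \<sigma> permutes {1..n} \<longrightarrow> act P n \<sigma> ` H \<subseteq> H) \<and> A \<subseteq> H}"


section \<open>Free operads on binary generators\<close>

text \<open>
  A representation \<open>V\<close> of the symmetric group on two letters is a vector space with the linear
  involution \<open>swap\<close> by which the transposition acts.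
\<close>

record ('k, 'v) s2_module = "('k, 'v) module" +
  swap :: "'v \<Rightarrow> 'v"

datatype 'v btree = Leaf nat | Node 'v "'v btree" "'v btree"

primrec leaves :: "'v btree \<Rightarrow> nat list" where
  "leaves (Leaf i) = [i]"
| "leaves (Node v s t) = leaves s @ leaves t"

primrec relabel :: "(nat \<Rightarrow> nat) \<Rightarrow> 'v btree \<Rightarrow> 'v btree" where
  "relabel \<sigma> (Leaf i) = Leaf (\<sigma> i)"
| "relabel \<sigma> (Node v s t) = Node v (relabel \<sigma> s) (relabel \<sigma> t)"

text \<open>\<open>graft i n t s\<close> replaces the leaf \<open>i\<close> of \<open>t\<close> by \<open>s\<close>, which has leaves \<open>{1..n}\<close>.\<close>

primrec graft :: "nat \<Rightarrow> nat \<Rightarrow> 'v btree \<Rightarrow> 'v btree \<Rightarrow> 'v btree" where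
  "graft i n (Leaf j) s = (if j = i then relabel (inner i) s else Leaf (outer i n j))"
| "graft i n (Node v t u) s = Node v (graft i n t s) (graft i n u s)"

definition btrees :: "'v set \<Rightarrow> nat \<Rightarrow> 'v btree set" where
  "btrees C n = {t. set_btree t \<subseteq> C \<and> distinct (leaves t) \<and> set (leaves t) = {1..n}}"

definition scale :: "'k::field \<Rightarrow> ('t \<Rightarrow>\<^sub>0 'k) \<Rightarrow> ('t \<Rightarrow>\<^sub>0 'k)" where
  "scale c p = Poly_Mapping.map ((*) c) p"

definition monomial :: "'t \<Rightarrow> ('t \<Rightarrow>\<^sub>0 'k::field)" where
  "monomial t = Poly_Mapping.single t 1"

definition lin_extend :: "('t \<Rightarrow> ('u \<Rightarrow>\<^sub>0 'k::field)) \<Rightarrow> ('t \<Rightarrow>\<^sub>0 'k) \<Rightarrow> ('u \<Rightarrow>\<^sub>0 'k)" where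
  "lin_extend f p = (\<Sum>t\<in>Poly_Mapping.keys p. scale (Poly_Mapping.lookup p t) (f t))"

definition bilin_extend ::
    "('s \<Rightarrow> 't \<Rightarrow> 'u) \<Rightarrow> ('s \<Rightarrow>\<^sub>0 'k::field) \<Rightarrow> ('t \<Rightarrow>\<^sub>0 'k) \<Rightarrow> ('u \<Rightarrow>\<^sub>0 'k)" where
  "bilin_extend f p q = lin_extend (\<lambda>s. lin_extend (\<lambda>t. monomial (f s t)) q) p"

text \<open>
  The operad of all formal linear combinations of binary trees with vertices decorated by elements
  of the bare set \<open>C\<close>.
\<close>

definition tree_operad :: "'v set \<Rightarrow> ('k::field, 'v btree \<Rightarrow>\<^sub>0 'k) operad" where
  "tree_operad C =
    \<lparr>ops = (\<lambda>n. \<lparr>carrier = {p. Poly_Mapping.keys p \<subseteq> btrees C n}, monoid.mult = undefined, one = undefined,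
                 zero = 0, add = (+), module.smult = scale\<rparr>),
     act = (\<lambda>n \<sigma>. lin_extend (\<lambda>t. monomial (relabel \<sigma> t))),
     pcomp = (\<lambda>m n i. bilin_extend (graft i n)),
     idop = monomial (Leaf 1)\<rparr>"

text \<open>
  The free operad \<open>F(V)\<close> is the quotient of the tree operad on the underlying set of \<open>V\<close> by the
  smallest operadic ideal that makes the map \<open>V \<rightarrow> F(V)(2)\<close>, \<open>v \<mapsto> Node v (Leaf 1) (Leaf 2)\<close>
  linear and equivariant.
\<close>

definition corolla_tree :: "'v \<Rightarrow> ('v btree \<Rightarrow>\<^sub>0 'k::field)" where
  "corolla_tree v = monomial (Node v (Leaf 1) (Leaf 2))"

definition vertex_relations :: "('k::field, 'v) s2_module \<Rightarrow> nat \<Rightarrow> ('v btree \<Rightarrow>\<^sub>0 'k) set" where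
  "vertex_relations V n = (if n = 2 then
      {corolla_tree (v \<oplus>\<^bsub>V\<^esub> w) - corolla_tree v - corolla_tree w | v w. v \<in> carrier V \<and> w \<in> carrier V} \<union>
      {corolla_tree (c \<odot>\<^bsub>V\<^esub> v) - scale c (corolla_tree v) | c v. v \<in> carrier V} \<union>
      {corolla_tree (swap V v) - monomial (Node v (Leaf 2) (Leaf 1)) | v. v \<in> carrier V}
    else {})"

definition vertex_ideal :: "('k::field, 'v) s2_module \<Rightarrow> nat \<Rightarrow> ('v btree \<Rightarrow>\<^sub>0 'k) set" where
  "vertex_ideal V = operadic_ideal (tree_operad (carrier V)) (vertex_relations V)"

definition free_operad :: "('k::field, 'v) s2_module \<Rightarrow> ('k, ('v btree \<Rightarrow>\<^sub>0 'k) set) operad" where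
  "free_operad V = quotient_operad (tree_operad (carrier V)) (vertex_ideal V)"

definition tree_class :: "('k::field, 'v) s2_module \<Rightarrow> nat \<Rightarrow> ('v btree \<Rightarrow>\<^sub>0 'k) \<Rightarrow> ('v btree \<Rightarrow>\<^sub>0 'k) set" where
  "tree_class V n p = vertex_ideal V n +>\<^bsub>ops (tree_operad (carrier V)) n\<^esub> p"

definition corolla :: "('k::field, 'v) s2_module \<Rightarrow> 'v \<Rightarrow> ('v btree \<Rightarrow>\<^sub>0 'k) set" where
  "corolla V v = tree_class V 2 (corolla_tree v)"


section \<open>Binary quadratic operads and Koszul duality\<close>

text \<open>
  Quadratic data \<open>(V, R)\<close> consist of a finite-dimensional representation \<open>V\<close> of the symmetric
  group on two letters and a subrepresentation \<open>R\<close> of \<open>F(V)(3)\<close>.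
\<close>

type_synonym ('k, 'v) quadratic_data = "('k, 'v) s2_module \<times> ('v btree \<Rightarrow>\<^sub>0 'k) set set"

definition quadratic_operad ::
    "('k::field, 'v) quadratic_data \<Rightarrow> ('k, ('v btree \<Rightarrow>\<^sub>0 'k) set set) operad" where
  "quadratic_operad = (\<lambda>(V, R). quotient_operad (free_operad V)
     (operadic_ideal (free_operad V) (\<lambda>n. if n = 3 then R else {})))"

text \<open>\<open>V\<^sup>* \<otimes> sgn\<close>; linear forms are extensional, so that they are determined by their values on \<open>V\<close>.\<close>

definition sign_dual :: "('k::field, 'v) s2_module \<Rightarrow> ('k, 'v \<Rightarrow> 'k) s2_module" where
  "sign_dual V =
    \<lparr>carrier = linear_forms V \<inter> extensional (carrier V), monoid.mult = undefined, one = undefined,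
     zero = (\<lambda>v\<in>carrier V. 0),
     add = (\<lambda>\<phi> \<psi>. \<lambda>v\<in>carrier V. \<phi> v + \<psi> v),
     module.smult = (\<lambda>c \<phi>. \<lambda>v\<in>carrier V. c * \<phi> v),
     swap = (\<lambda>\<phi>. \<lambda>v\<in>carrier V. - \<phi> (swap V v))\<rparr>"

text \<open>
  \<open>F(V)(3)\<close> is the direct sum of three copies of \<open>V \<otimes> V\<close>, one for each way to bracket three
  inputs up to symmetry at the vertices. For \<open>u = 0, 1, 2\<close>, \<open>ternary V u \<mu> \<nu>\<close> is the operation
  \<open>\<mu>(\<nu>(a\<^sub>1, a\<^sub>2), a\<^sub>3)\<close>, \<open>\<mu>(\<nu>(a\<^sub>2, a\<^sub>3), a\<^sub>1)\<close>, \<open>\<mu>(\<nu>(a\<^sub>3, a\<^sub>1), a\<^sub>2)\<close>, respectively.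
\<close>

definition rotation :: "nat \<Rightarrow> nat" where
  "rotation = Transposition.transpose 1 2 \<circ> Transposition.transpose 2 3"

definition ternary :: "('k::field, 'v) s2_module \<Rightarrow> nat \<Rightarrow> 'v \<Rightarrow> 'v \<Rightarrow> ('v btree \<Rightarrow>\<^sub>0 'k) set" where
  "ternary V u \<mu> \<nu> =
    act (free_operad V) 3 (rotation ^^ u) (pcomp (free_operad V) 2 2 1 (corolla V \<mu>) (corolla V \<nu>))"

text \<open>
  The standard pairing between \<open>F(V\<^sup>\<or>)(3)\<close> and \<open>F(V)(3)\<close> is the bilinear form with the values in
  the last clause. These values determine it, because the elements \<open>ternary V u \<mu> \<nu>\<close> span
  \<open>F(V)(3)\<close>. The sign in \<^const>\<open>sign_dual\<close> makes it invariant up to the signature of permutations.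
\<close>

definition is_standard_pairing :: "('k::field, 'v) s2_module \<Rightarrow>
    ((('v \<Rightarrow> 'k) btree \<Rightarrow>\<^sub>0 'k) set \<Rightarrow> ('v btree \<Rightarrow>\<^sub>0 'k) set \<Rightarrow> 'k) \<Rightarrow> bool" where
  "is_standard_pairing V B \<longleftrightarrow>
    (\<forall>x\<in>carrier (ops (free_operad (sign_dual V)) 3). (\<lambda>y. B x y) \<in> linear_forms (ops (free_operad V) 3)) \<and>
    (\<forall>y\<in>carrier (ops (free_operad V) 3). (\<lambda>x. B x y) \<in> linear_forms (ops (free_operad (sign_dual V)) 3)) \<and>
    (\<forall>\<alpha>\<in>carrier (sign_dual V). \<forall>\<beta>\<in>carrier (sign_dual V). \<forall>\<mu>\<in>carrier V. \<forall>\<nu>\<in>carrier V.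
      \<forall>u<3. \<forall>w<3. B (ternary (sign_dual V) u \<alpha> \<beta>) (ternary V w \<mu> \<nu>) = (if u = w then \<alpha> \<mu> * \<beta> \<nu> else 0))"

definition standard_pairing :: "('k::field, 'v) s2_module \<Rightarrow>
    (('v \<Rightarrow> 'k) btree \<Rightarrow>\<^sub>0 'k) set \<Rightarrow> ('v btree \<Rightarrow>\<^sub>0 'k) set \<Rightarrow> 'k" where
  "standard_pairing V = (SOME B. is_standard_pairing V B)"

definition orthogonal_relations ::
    "('k::field, 'v) s2_module \<Rightarrow> ('v btree \<Rightarrow>\<^sub>0 'k) set set \<Rightarrow> (('v \<Rightarrow> 'k) btree \<Rightarrow>\<^sub>0 'k) set set" where
  "orthogonal_relations V R =
    {x \<in> carrier (ops (free_operad (sign_dual V)) 3). \<forall>r\<in>R. standard_pairing V x r = 0}"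

definition koszul_dual_operad ::
    "('k::field, 'v) quadratic_data \<Rightarrow> ('k, (('v \<Rightarrow> 'k) btree \<Rightarrow>\<^sub>0 'k) set set) operad" where
  "koszul_dual_operad = (\<lambda>(V, R). quadratic_operad (sign_dual V, orthogonal_relations V R))"


section \<open>Symmetric Leibniz algebras and com.-admissible algebras\<close>

text \<open>
  Algebras with one bilinear multiplication \<open>\<mu>\<close> without symmetry: the generators are the regular
  representation, with basis \<open>\<mu> = (1, 0)\<close> and \<open>swap \<mu> = (0, 1)\<close>, the opposite multiplication.
\<close>

definition regular_rep :: "('k::field, 'k \<times> 'k) s2_module" where
  "regular_rep =
    \<lparr>carrier = UNIV, monoid.mult = undefined, one = undefined, zero = (0, 0),
     add = (\<lambda>(a, b) (c, d). (a + c, b + d)),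
     module.smult = (\<lambda>c (a, b). (c * a, c * b)),
     swap = (\<lambda>(a, b). (b, a))\<rparr>"

definition mul_poly :: "(('k \<times> 'k) btree \<Rightarrow>\<^sub>0 'k::field) \<Rightarrow> (('k \<times> 'k) btree \<Rightarrow>\<^sub>0 'k) \<Rightarrow> (('k \<times> 'k) btree \<Rightarrow>\<^sub>0 'k)"
    (infixl \<open>\<cdot>\<close> 70) where
  "p \<cdot> q = bilin_extend (Node (1, 0)) p q"

definition sym_poly :: "(('k \<times> 'k) btree \<Rightarrow>\<^sub>0 'k::field) \<Rightarrow> (('k \<times> 'k) btree \<Rightarrow>\<^sub>0 'k) \<Rightarrow> (('k \<times> 'k) btree \<Rightarrow>\<^sub>0 'k)"
    (infixl \<open>\<diamondop>\<close> 70) where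
  "p \<diamondop> q = p \<cdot> q + q \<cdot> p"

text \<open>
  An identity \<open>f = g\<close> that is multilinear in \<open>a\<close>, \<open>b\<close>, \<open>c\<close> is represented by \<open>f - g\<close>. The identity for
  all elements amounts to all permutations of its variables, whence the subrepresentation
  generated by \<open>f - g\<close>.
\<close>

definition identities :: "(('k \<times> 'k) btree \<Rightarrow>\<^sub>0 'k::field) set \<Rightarrow> (('k \<times> 'k) btree \<Rightarrow>\<^sub>0 'k) set set" where
  "identities E = equivariant_span (free_operad regular_rep) 3 (tree_class regular_rep 3 ` E)"

definition sLeib :: "('k::field, 'k \<times> 'k) quadratic_data" where
  "sLeib = (regular_rep,
     (let a = monomial (Leaf 1); b = monomial (Leaf 2); c = monomial (Leaf 3) in
      identities {a \<cdot> (b \<cdot> c) - ((a \<cdot> b) \<cdot> c + b \<cdot> (a \<cdot> c)),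
                  (a \<cdot> b) \<cdot> c - (a \<cdot> (b \<cdot> c) + (a \<cdot> c) \<cdot> b)}))"

text \<open>Commutativity of \<open>\<diamondop>\<close> holds by definition, so only its associativity is a relation.\<close>

definition ComAdm :: "('k::field, 'k \<times> 'k) quadratic_data" where
  "ComAdm = (regular_rep,
     (let a = monomial (Leaf 1); b = monomial (Leaf 2); c = monomial (Leaf 3) in
      identities {(a \<diamondop> b) \<diamondop> c - a \<diamondop> (b \<diamondop> c)}))"

end

theory Submission
  imports Defs
begin

text \<open>
  The symmetric Leibniz relations say that an operation \<open>\<mu>(\<nu>(a, b), c)\<close> changes sign when
  \<open>\<mu>\<close> or \<open>\<nu>\<close> is replaced by its opposite, together with the Jacobi identity. Their annihilator is
  therefore spanned by the differences of the three operations \<open>\<psi>(\<psi>(a\<^sub>i, a\<^sub>j), a\<^sub>k)\<close>, where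
  \<open>\<psi>\<close> is the form with value \<open>1\<close> on the multiplication and \<open>-1\<close> on its opposite. In the sign dual
  \<open>\<psi>\<close> is symmetric. The isomorphism from the sign dual to the regular representation that sends
  \<open>\<psi>\<close> to \<open>\<diamondop>\<close> sends this annihilator to the span of the associativity relations of \<open>\<diamondop>\<close>.

  The pairing exists because coordinate functionals on trees with three leaves, obtained by moving
  each tree to a normal form, vanish on the ideal that defines the free operad: an element of this
  ideal has no component of arity one, is killed by linear forms in arity two, and compositions of
  two binary trees have coordinates that are products of such forms.
\<close>

section \<open>Linear extension\<close>

text \<open>The sign rule at the root comes from adding identities: the left and the right Leibniz
  rule for (a, b, c) share two products, and their sum leaves b(ac) + (ac)b = 0. The sign rule at
  the inner vertex and the cyclic sum appear only after the root rule is substituted back. The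
  annihilator is found without counting dimensions. One inclusion is tested on the two generating
  identities. For the other, the six permutations of both identities become twelve linear equations
  for the pairing values of an orthogonal element, and the element is rebuilt from these values by a
  dual basis. The pairing enters through a choice operator, so nothing can be computed with it until
  some form with the prescribed values is exhibited. Quotient operads consist of cosets, and the
  free operad is itself a quotient. Isomorphisms are therefore carried through both levels as direct
  images: trees go to trees, relations to relations, cosets to cosets.\<close>

definition lin_form :: "('t \<Rightarrow> 'k::field) \<Rightarrow> ('t \<Rightarrow>\<^sub>0 'k) \<Rightarrow> 'k" where
  "lin_form f p = (\<Sum>t\<in>Poly_Mapping.keys p. Poly_Mapping.lookup p t * f t)"

lemma lin_form_superset:
  assumes "finite S" "Poly_Mapping.keys p \<subseteq> S"
  shows "lin_form f p = (\<Sum>t\<in>S. Poly_Mapping.lookup p t * f t)"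
  unfolding lin_form_def using assms
  by (intro sum.mono_neutral_left) (auto simp: in_keys_iff)

lemma lookup_scale [simp]: "Poly_Mapping.lookup (scale c p) t = c * Poly_Mapping.lookup p t"
  unfolding scale_def by (simp add: map.rep_eq when_def)

lemma keys_scale: "Poly_Mapping.keys (scale c p) \<subseteq> Poly_Mapping.keys p"
  by (auto simp: in_keys_iff)

lemma scale_simps [simp]:
  "scale 0 p = 0" "scale 1 p = p" "scale c 0 = 0" "scale c (scale d p) = scale (c * d) p"
  by (auto intro!: poly_mapping_eqI simp: mult.assoc)

lemma scale_minus_one: "scale (- 1) p = - p"
  by (auto intro!: poly_mapping_eqI)

lemma scale_add_right: "scale c (p + q) = scale c p + scale c q"
  by (auto intro!: poly_mapping_eqI simp: lookup_add algebra_simps)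

lemma scale_add_left: "scale (c + d) p = scale c p + scale d p"
  by (auto intro!: poly_mapping_eqI simp: lookup_add algebra_simps)

lemma lin_form_0 [simp]: "lin_form f 0 = 0" "lin_form (\<lambda>t. 0) p = 0"
  by (simp_all add: lin_form_def)

lemma lin_form_add: "lin_form f (p + q) = lin_form f p + lin_form f q"
proof -
  let ?S = "Poly_Mapping.keys p \<union> Poly_Mapping.keys q"
  have "Poly_Mapping.keys (p + q) \<subseteq> ?S"
    by (rule Poly_Mapping.keys_add)
  then show ?thesis
    by (simp add: lin_form_superset[of ?S] lookup_add algebra_simps sum.distrib)
qed

lemma lin_form_scale: "lin_form f (scale c p) = c * lin_form f p"
  using lin_form_superset[OF finite_keys keys_scale, of f c p]
  by (simp add: lin_form_def sum_distrib_left mult.assoc)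

lemma lin_form_uminus: "lin_form f (- p) = - lin_form f p"
  by (metis lin_form_scale mult_minus1 scale_minus_one)

lemma lin_form_diff: "lin_form f (p - q) = lin_form f p - lin_form f q"
  by (metis diff_conv_add_uminus lin_form_add lin_form_uminus)

lemma lin_form_monomial [simp]: "lin_form f (monomial t) = f t"
  by (simp add: lin_form_def monomial_def)

lemma lin_form_sum: "lin_form f (\<Sum>i\<in>A. g i) = (\<Sum>i\<in>A. lin_form f (g i))"
  by (induction A rule: infinite_finite_induct) (auto simp: lin_form_add)

lemma lin_form_cong:
  "(\<And>t. t \<in> Poly_Mapping.keys p \<Longrightarrow> f t = g t) \<Longrightarrow> lin_form f p = lin_form g p"
  by (simp add: lin_form_def)

lemma lin_form_mult_left: "lin_form (\<lambda>t. c * f t) p = c * lin_form f p"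
  by (simp add: lin_form_def sum_distrib_left mult.left_commute)

lemma lin_form_add_fun: "lin_form (\<lambda>t. f t + g t) p = lin_form f p + lin_form g p"
  by (simp add: lin_form_def sum.distrib distrib_left)

text \<open>Exchange of two finite sums. The parallel axiom of the tree operad and the
  well-definedness of the pairing both rest on it.\<close>

lemma lin_form_swap:
  "lin_form (\<lambda>s. lin_form (h s) q) p = lin_form (\<lambda>t. lin_form (\<lambda>s. h s t) p) q"
  unfolding lin_form_def sum_distrib_left
  by (subst sum.swap) (simp add: mult.left_commute)

lemma lookup_sum_poly: "Poly_Mapping.lookup (\<Sum>i\<in>A. g i) u = (\<Sum>i\<in>A. Poly_Mapping.lookup (g i) u)"
  by (induction A rule: infinite_finite_induct) (auto simp: lookup_add)

text \<open>Coefficients turn laws of \<open>lin_extend\<close> into laws of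
  \<open>lin_form\<close>; most of the lemmas below are obtained in this way.\<close>

lemma lookup_lin_extend:
  "Poly_Mapping.lookup (lin_extend f p) u = lin_form (\<lambda>t. Poly_Mapping.lookup (f t) u) p"
  by (simp add: lin_extend_def lin_form_def lookup_sum_poly)

lemma lin_form_lin_extend: "lin_form f (lin_extend g p) = lin_form (\<lambda>t. lin_form f (g t)) p"
  by (simp add: lin_extend_def lin_form_sum lin_form_scale lin_form_def[of _ p])

lemma lin_extend_add: "lin_extend f (p + q) = lin_extend f p + lin_extend f q"
  by (auto intro!: poly_mapping_eqI simp: lookup_lin_extend lin_form_add lookup_add)

lemma lin_extend_scale: "lin_extend f (scale c p) = scale c (lin_extend f p)"
  by (auto intro!: poly_mapping_eqI simp: lookup_lin_extend lin_form_scale)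

lemma lin_extend_diff: "lin_extend f (p - q) = lin_extend f p - lin_extend f q"
  by (auto intro!: poly_mapping_eqI simp: lookup_lin_extend lin_form_diff lookup_minus)

lemma lin_extend_0 [simp]: "lin_extend f 0 = 0" "lin_extend (\<lambda>t. 0) p = 0"
  by (auto intro!: poly_mapping_eqI simp: lookup_lin_extend)

lemma lin_extend_monomial [simp]: "lin_extend f (monomial t) = f t"
  by (auto intro!: poly_mapping_eqI simp: lookup_lin_extend)

lemma lin_extend_monomial_id [simp]: "lin_extend monomial p = p"
  by (auto intro!: poly_mapping_eqI
      simp: lookup_lin_extend lin_form_def monomial_def lookup_single when_def in_keys_iff
      if_distrib[of "(*) _"] sum.delta cong: if_cong)

lemma lin_extend_cong:
  "(\<And>t. t \<in> Poly_Mapping.keys p \<Longrightarrow> f t = g t) \<Longrightarrow> lin_extend f p = lin_extend g p"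
  by (simp add: lin_extend_def)

lemma lin_extend_lin_extend:
  "lin_extend f (lin_extend g p) = lin_extend (\<lambda>t. lin_extend f (g t)) p"
  by (auto intro!: poly_mapping_eqI simp: lookup_lin_extend lin_form_lin_extend)

lemma lin_extend_add_fun: "lin_extend (\<lambda>t. f t + g t) p = lin_extend f p + lin_extend g p"
  by (auto intro!: poly_mapping_eqI simp: lookup_lin_extend lin_form_add_fun lookup_add)

lemma lin_extend_scale_fun: "lin_extend (\<lambda>t. scale c (f t)) p = scale c (lin_extend f p)"
  by (auto intro!: poly_mapping_eqI simp: lookup_lin_extend lin_form_mult_left)

lemma lin_extend_swap:
  "lin_extend (\<lambda>s. lin_extend (h s) q) p = lin_extend (\<lambda>t. lin_extend (\<lambda>s. h s t) p) q"
  by (auto intro!: poly_mapping_eqI simp: lookup_lin_extend intro: lin_form_swap)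

lemma keys_monomial [simp]: "Poly_Mapping.keys (monomial t :: _ \<Rightarrow>\<^sub>0 'k::field) = {t}"
  by (simp add: monomial_def)

lemma keys_lin_extend:
  assumes "\<And>t. t \<in> Poly_Mapping.keys p \<Longrightarrow> Poly_Mapping.keys (f t) \<subseteq> S"
  shows "Poly_Mapping.keys (lin_extend f p) \<subseteq> S"
proof
  fix u assume "u \<in> Poly_Mapping.keys (lin_extend f p)"
  then have "(\<Sum>t\<in>Poly_Mapping.keys p. Poly_Mapping.lookup p t * Poly_Mapping.lookup (f t) u) \<noteq> 0"
    by (simp add: in_keys_iff lookup_lin_extend lin_form_def)
  then obtain t where "t \<in> Poly_Mapping.keys p" "Poly_Mapping.lookup (f t) u \<noteq> 0"
    by (metis (no_types, lifting) mult_zero_right sum.neutral)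
  then show "u \<in> S"
    using assms[of t] by (auto simp: in_keys_iff)
qed

lemma bilin_extend_monomial [simp]:
  "bilin_extend f (monomial s) (monomial t) = monomial (f s t)"
  by (simp add: bilin_extend_def)

lemma bilin_extend_add_left: "bilin_extend f (p + p') q = bilin_extend f p q + bilin_extend f p' q"
  by (simp add: bilin_extend_def lin_extend_add)

lemma bilin_extend_add_right: "bilin_extend f p (q + q') = bilin_extend f p q + bilin_extend f p q'"
  by (simp add: bilin_extend_def lin_extend_add lin_extend_add_fun)

lemma bilin_extend_scale_left: "bilin_extend f (scale c p) q = scale c (bilin_extend f p q)"
  by (simp add: bilin_extend_def lin_extend_scale)

lemma bilin_extend_scale_right: "bilin_extend f p (scale c q) = scale c (bilin_extend f p q)"
  by (simp add: bilin_extend_def lin_extend_scale lin_extend_scale_fun)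

lemma bilin_extend_0 [simp]: "bilin_extend f 0 q = 0" "bilin_extend f p 0 = 0"
  by (simp_all add: bilin_extend_def)


section \<open>The tree operad\<close>

lemma inner_simps [simp]: "inner i (Suc 0) = i" "inner (Suc 0) = (\<lambda>l. l)"
  by (simp_all add: inner_def fun_eq_iff)

lemma leaves_nonempty [simp]: "leaves t \<noteq> []"
  by (induction t) auto

lemma leaves_relabel: "leaves (relabel \<sigma> t) = map \<sigma> (leaves t)"
  by (induction t) auto

lemma set_btree_relabel [simp]: "set_btree (relabel \<sigma> t) = set_btree t"
  by (induction t) auto

lemma relabel_relabel: "relabel \<sigma> (relabel \<tau> t) = relabel (\<sigma> \<circ> \<tau>) t"
  by (induction t) auto

lemma relabel_cong: "(\<And>j. j \<in> set (leaves t) \<Longrightarrow> \<sigma> j = \<tau> j) \<Longrightarrow> relabel \<sigma> t = relabel \<tau> t"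
  by (induction t) auto

lemma relabel_id [simp]: "relabel id t = t" "relabel (\<lambda>x. x) t = t"
  by (induction t) auto

lemma relabel_btrees:
  assumes "\<sigma> permutes {1..n}" "t \<in> btrees C n"
  shows "relabel \<sigma> t \<in> btrees C n"
  using assms by (auto simp: btrees_def leaves_relabel distinct_map permutes_image
      intro: inj_on_subset[OF permutes_inj])

section \<open>Grafting of labelled trees\<close>

lemma leaves_graft:
  "leaves (graft i n t s) =
   concat (map (\<lambda>j. if j = i then map (inner i) (leaves s) else [outer i n j]) (leaves t))"
  by (induction t) (auto simp: leaves_relabel)

text \<open>Each occurrence of the leaf \<open>i\<close> is traded for a copy of \<open>s\<close>.
  The occurrences stand on the left-hand side to avoid truncated subtraction.\<close>

lemma length_leaves_graft:
  "length (leaves (graft i n t s)) + count_list (leaves t) i =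
   length (leaves t) + count_list (leaves t) i * length (leaves s)"
  by (induction t) (auto simp: leaves_relabel algebra_simps)

lemma set_btree_graft: "set_btree (graft i n t s) \<subseteq> set_btree t \<union> set_btree s"
  by (induction t) auto

lemma image_leaves_graft:
  assumes "i \<in> {1..m}" "1 \<le> n"
  shows "inner i ` {1..n} \<union> outer i n ` ({1..m} - {i}) = {1..m + n - 1}"
proof (intro equalityI subsetI)
  fix x assume x: "x \<in> {1..m + n - 1}"
  consider "x < i" | "i \<le> x" "x < i + n" | "i + n \<le> x"
    by linarith
  then show "x \<in> inner i ` {1..n} \<union> outer i n ` ({1..m} - {i})"
  proof cases
    case 1
    then show ?thesis using x assms
      by (intro UnI2 image_eqI[of _ _ x]) (auto simp: outer_def)
  next
    case 2
    then show ?thesis using x assms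
      by (intro UnI1 image_eqI[of _ _ "x + 1 - i"]) (auto simp: inner_def)
  next
    case 3
    then show ?thesis using x assms
      by (intro UnI2 image_eqI[of _ _ "x + 1 - n"]) (auto simp: outer_def)
  qed
qed (use assms in \<open>auto simp: inner_def outer_def\<close>)

lemma btrees_arity_pos: "t \<in> btrees C n \<Longrightarrow> 1 \<le> n"
  using leaves_nonempty[of t] by (auto simp: btrees_def Suc_le_eq intro!: gr0I)

lemma length_leaves_btrees: "t \<in> btrees C n \<Longrightarrow> length (leaves t) = n"
  by (auto simp: btrees_def dest!: distinct_card)

lemma count_list_distinct: "distinct xs \<Longrightarrow> count_list xs x = (if x \<in> set xs then 1 else 0)"
  by (induction xs) auto

lemma graft_btrees:
  assumes "i \<in> {1..m}" "t \<in> btrees C m" "s \<in> btrees C n"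
  shows "graft i n t s \<in> btrees C (m + n - 1)"
proof -
  have n: "1 \<le> n"
    using assms(3) by (rule btrees_arity_pos)
  have t: "set (leaves t) = {1..m}" "distinct (leaves t)"
    and s: "set (leaves s) = {1..n}"
    using assms by (auto simp: btrees_def)
  have "set (leaves (graft i n t s)) = inner i ` {1..n} \<union> outer i n ` ({1..m} - {i})"
    using assms(1) by (auto simp: leaves_graft t s split: if_splits)
  then have set: "set (leaves (graft i n t s)) = {1..m + n - 1}"
    using image_leaves_graft[OF assms(1) n] by simp
  have "count_list (leaves t) i = 1"
    using t assms(1) by (simp add: count_list_distinct)
  then have "length (leaves (graft i n t s)) = m + n - 1"
    using length_leaves_graft[of i n t s] assms(2,3) by (simp add: length_leaves_btrees)
  \<comment> \<open>A list that is no longer than its set of entries is large has no repetitions, so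
    the length count replaces a case analysis on the origin of two equal labels.\<close>
  then have "distinct (leaves (graft i n t s))"
    by (intro card_distinct) (simp add: set)
  then show ?thesis
    using set set_btree_graft[of i n t s] assms by (auto simp: btrees_def)
qed

lemma graft_Leaf_right: "graft i 1 t (Leaf 1) = t"
  by (induction t) (auto simp: outer_def)

lemma graft_relabel_inner:
  assumes "set (leaves s) \<subseteq> {1..m}" "j \<in> {1..m}" "1 \<le> i"
  shows "graft (i + j - 1) n (relabel (inner i) s) u = relabel (inner i) (graft j n s u)"
  using assms by (induction s) (auto simp: relabel_relabel inner_def outer_def intro!: relabel_cong)

lemma graft_sequential:
  assumes "i \<in> {1..l}" "j \<in> {1..m}" "set (leaves t) \<subseteq> {1..l}" "set (leaves s) \<subseteq> {1..m}" "1 \<le> n"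
  shows "graft (i + j - 1) n (graft i m t s) u = graft i (m + n - 1) t (graft j n s u)"
  using assms(3)
proof (induction t)
  case (Leaf a)
  then show ?case
    using assms graft_relabel_inner[of s m j i n u] by (auto simp: outer_def)
qed auto

lemma graft_relabel_inner_above:
  assumes "set (leaves s) \<subseteq> {1..m}" "i < k"
  shows "graft (k + m - 1) n (relabel (inner i) s) u = relabel (inner i) s"
  using assms by (induction s) (auto simp: inner_def outer_def)

lemma graft_relabel_inner_below:
  assumes "set (leaves s) \<subseteq> {1..n}" "i < k"
  shows "graft i m (relabel (inner k) s) u = relabel (inner (k + m - 1)) s"
  using assms by (induction s) (auto simp: inner_def outer_def)

text \<open>The labels of \<open>s\<close> fill a block that starts at \<open>i\<close>. Since
  \<open>i < k\<close>, grafting at the later leaf does not touch this block, whereas grafting at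
  the earlier leaf shifts the block of \<open>u\<close> by \<open>m - 1\<close>. The two preceding
  lemmas are these two observations.\<close>

lemma graft_parallel:
  assumes "1 \<le> i" "i < k" "set (leaves s) \<subseteq> {1..m}" "set (leaves u) \<subseteq> {1..n}" "1 \<le> m" "1 \<le> n"
  shows "graft (k + m - 1) n (graft i m t s) u = graft i m (graft k n t u) s"
proof (induction t)
  case (Leaf a)
  consider "a = i" | "a = k" | "a \<noteq> i" "a \<noteq> k" by blast
  then show ?case
  proof cases
    case 1
    then show ?thesis
      using assms graft_relabel_inner_above[of s m i k n u] by (simp add: outer_def)
  next
    case 2
    then show ?thesis
      using assms graft_relabel_inner_below[of u n i k m s] by (simp add: outer_def)
  next
    case 3
    then show ?thesis
      using assms by (auto simp: outer_def)
  qed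
qed auto

lemma graft_equivariant:
  assumes "\<sigma> permutes {1..m}"
    and "\<And>j. j \<in> {1..m} - {i} \<Longrightarrow> \<rho> (outer i n j) = outer (\<sigma> i) n (\<sigma> j)"
    and "\<And>l. l \<in> {1..n} \<Longrightarrow> \<rho> (inner i l) = inner (\<sigma> i) (\<tau> l)"
    and "set (leaves t) \<subseteq> {1..m}" "set (leaves s) \<subseteq> {1..n}"
  shows "graft (\<sigma> i) n (relabel \<sigma> t) (relabel \<tau> s) = relabel \<rho> (graft i n t s)"
  using assms(4)
proof (induction t)
  case (Leaf a)
  show ?case
  proof (cases "a = i")
    case True
    then show ?thesis
      using assms(3,5) by (auto simp: relabel_relabel intro!: relabel_cong)
  next
    case False
    moreover have "\<sigma> a \<noteq> \<sigma> i"
      using False permutes_inj[OF assms(1)] by (auto dest: injD)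
    ultimately show ?thesis
      using Leaf assms(2) by auto
  qed
qed auto

section \<open>Operad axioms for formal sums of trees\<close>

lemma tree_operad_simps [simp]:
  "carrier (ops (tree_operad C) n) = {p. Poly_Mapping.keys p \<subseteq> btrees C n}"
  "\<zero>\<^bsub>ops (tree_operad C) n\<^esub> = 0"
  "p \<oplus>\<^bsub>ops (tree_operad C) n\<^esub> q = p + q"
  "c \<odot>\<^bsub>ops (tree_operad C) n\<^esub> p = scale c p"
  "act (tree_operad C) n \<sigma> p = lin_extend (\<lambda>t. monomial (relabel \<sigma> t)) p"
  "pcomp (tree_operad C) m n i p q = bilin_extend (graft i n) p q"
  "idop (tree_operad C) = monomial (Leaf 1)"
  by (simp_all add: tree_operad_def)

lemma ring_of_type_simps [simp]:
  "carrier (ring_of_type_algebra :: 'k::field ring) = UNIV"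
  "a \<oplus>\<^bsub>(ring_of_type_algebra :: 'k ring)\<^esub> b = a + b"
  "a \<otimes>\<^bsub>(ring_of_type_algebra :: 'k ring)\<^esub> b = a * b"
  "\<zero>\<^bsub>(ring_of_type_algebra :: 'k ring)\<^esub> = 0"
  "\<one>\<^bsub>(ring_of_type_algebra :: 'k ring)\<^esub> = 1"
  by (simp_all add: ring_of_type_algebra_def)

lemma vector_space_recI:
  fixes M :: "('k::field, 'a) module"
  assumes "\<And>x y. \<lbrakk>x \<in> carrier M; y \<in> carrier M\<rbrakk> \<Longrightarrow> x \<oplus>\<^bsub>M\<^esub> y \<in> carrier M"
    and "\<zero>\<^bsub>M\<^esub> \<in> carrier M"
    and "\<And>c x. x \<in> carrier M \<Longrightarrow> c \<odot>\<^bsub>M\<^esub> x \<in> carrier M"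
    and "\<And>x y z. \<lbrakk>x \<in> carrier M; y \<in> carrier M; z \<in> carrier M\<rbrakk>
      \<Longrightarrow> (x \<oplus>\<^bsub>M\<^esub> y) \<oplus>\<^bsub>M\<^esub> z = x \<oplus>\<^bsub>M\<^esub> (y \<oplus>\<^bsub>M\<^esub> z)"
    and "\<And>x y. \<lbrakk>x \<in> carrier M; y \<in> carrier M\<rbrakk> \<Longrightarrow> x \<oplus>\<^bsub>M\<^esub> y = y \<oplus>\<^bsub>M\<^esub> x"
    and "\<And>x. x \<in> carrier M \<Longrightarrow> \<zero>\<^bsub>M\<^esub> \<oplus>\<^bsub>M\<^esub> x = x"
    and "\<And>x. x \<in> carrier M \<Longrightarrow> \<exists>y\<in>carrier M. y \<oplus>\<^bsub>M\<^esub> x = \<zero>\<^bsub>M\<^esub>"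
    and "\<And>c d x. x \<in> carrier M \<Longrightarrow> (c + d) \<odot>\<^bsub>M\<^esub> x = c \<odot>\<^bsub>M\<^esub> x \<oplus>\<^bsub>M\<^esub> d \<odot>\<^bsub>M\<^esub> x"
    and "\<And>c x y. \<lbrakk>x \<in> carrier M; y \<in> carrier M\<rbrakk>
      \<Longrightarrow> c \<odot>\<^bsub>M\<^esub> (x \<oplus>\<^bsub>M\<^esub> y) = c \<odot>\<^bsub>M\<^esub> x \<oplus>\<^bsub>M\<^esub> c \<odot>\<^bsub>M\<^esub> y"
    and "\<And>c d x. x \<in> carrier M \<Longrightarrow> (c * d) \<odot>\<^bsub>M\<^esub> x = c \<odot>\<^bsub>M\<^esub> (d \<odot>\<^bsub>M\<^esub> x)"
    and "\<And>x. x \<in> carrier M \<Longrightarrow> 1 \<odot>\<^bsub>M\<^esub> x = x"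
  shows "vector_space_rec M"
proof (rule moduleI)
  show "cring (ring_of_type_algebra :: 'k ring)"
    by (rule cring_from_type_algebra)
  show "abelian_group M"
    using assms by (intro abelian_groupI) auto
qed (use assms in simp_all)

lemma bilin_extend_closed:
  assumes "i \<in> {1..m}" "Poly_Mapping.keys p \<subseteq> btrees C m" "Poly_Mapping.keys q \<subseteq> btrees C n"
  shows "Poly_Mapping.keys (bilin_extend (graft i n) p q) \<subseteq> btrees C (m + n - 1)"
  unfolding bilin_extend_def using assms
  by (intro keys_lin_extend)
    (auto simp del: One_nat_def intro!: graft_btrees[OF assms(1)])

lemma relabel_closed:
  assumes "\<sigma> permutes {1..n}" "Poly_Mapping.keys p \<subseteq> btrees C n"
  shows "Poly_Mapping.keys (lin_extend (\<lambda>t. monomial (relabel \<sigma> t) :: _ \<Rightarrow>\<^sub>0 'k::field) p) \<subseteq> btrees C n"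
  using assms by (intro keys_lin_extend) (auto intro!: relabel_btrees)

lemma set_leaves_btrees: "t \<in> btrees C n \<Longrightarrow> set (leaves t) \<subseteq> {1..n}"
  by (auto simp: btrees_def)

lemma keys_btreesD:
  assumes "Poly_Mapping.keys p \<subseteq> btrees C n" "t \<in> Poly_Mapping.keys p"
  shows "set (leaves t) \<subseteq> {1..n}" "1 \<le> n"
  using assms set_leaves_btrees btrees_arity_pos by blast+

text \<open>A node has at least two leaves, one in each subtree.\<close>

lemma btrees_1: "t \<in> btrees C 1 \<Longrightarrow> t = Leaf 1"
proof (cases t)
  case (Node v s u)
  assume "t \<in> btrees C 1"
  then have "length (leaves s) + length (leaves u) = 1"
    using length_leaves_btrees[of t C 1] Node by simp
  moreover have "length (leaves s) \<ge> 1" "length (leaves u) \<ge> 1"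
    using leaves_nonempty[of s] leaves_nonempty[of u] by (simp_all add: Suc_le_eq)
  ultimately show ?thesis by simp
qed (auto simp: btrees_def)

lemma tree_operad: "operad (tree_operad C :: ('k::field, 'v btree \<Rightarrow>\<^sub>0 'k) operad)"
proof (rule operad.intro)
  let ?T = "tree_operad C :: ('k, 'v btree \<Rightarrow>\<^sub>0 'k) operad"
  fix n
  show "vector_space_rec (ops ?T n)"
  proof (rule vector_space_recI)
    fix x assume "x \<in> carrier (ops ?T n)"
    then show "\<exists>y\<in>carrier (ops ?T n). y \<oplus>\<^bsub>ops ?T n\<^esub> x = \<zero>\<^bsub>ops ?T n\<^esub>"
      by (intro bexI[of _ "- x"]) auto
  next
    fix x y assume "x \<in> carrier (ops ?T n)" "y \<in> carrier (ops ?T n)"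
    then show "x \<oplus>\<^bsub>ops ?T n\<^esub> y \<in> carrier (ops ?T n)"
      using Poly_Mapping.keys_add[of x y] by auto
  next
    fix c x assume "x \<in> carrier (ops ?T n)"
    then show "c \<odot>\<^bsub>ops ?T n\<^esub> x \<in> carrier (ops ?T n)"
      using keys_scale[of c x] by auto
  qed (auto simp: scale_add_left scale_add_right algebra_simps)
next
  show "idop (tree_operad C) \<in> carrier (ops (tree_operad C) 1)"
    by (auto simp: btrees_def)
next
  fix y :: "'v btree \<Rightarrow>\<^sub>0 'k" and n
  have "graft 1 n (Leaf 1) = (\<lambda>t. t)"
    by (rule ext) simp
  then show "pcomp (tree_operad C) 1 n 1 (idop (tree_operad C)) y = y"
    by (simp add: bilin_extend_def)
next
  fix i j l m n :: nat and x y z :: "'v btree \<Rightarrow>\<^sub>0 'k"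
  assume a: "i \<in> {1..l}" "j \<in> {1..m}" "x \<in> carrier (ops (tree_operad C) l)"
    "y \<in> carrier (ops (tree_operad C) m)" "z \<in> carrier (ops (tree_operad C) n)"
  have "graft (i + j - 1) n (graft i m t s) u = graft i (m + n - 1) t (graft j n s u)"
    if "t \<in> Poly_Mapping.keys x" "s \<in> Poly_Mapping.keys y" "u \<in> Poly_Mapping.keys z" for t s u
    using a that by (intro graft_sequential[of i l j m])
      (simp_all add: keys_btreesD[of x C l] keys_btreesD[of y C m] keys_btreesD[of z C n] del: One_nat_def)
  then show "pcomp (tree_operad C) (l + m - 1) n (i + j - 1) (pcomp (tree_operad C) l m i x y) z =
      pcomp (tree_operad C) l (m + n - 1) i x (pcomp (tree_operad C) m n j y z)"
    by (auto simp: bilin_extend_def lin_extend_lin_extend simp del: One_nat_def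
        intro!: lin_extend_cong arg_cong[where f = monomial])
next
  fix i k l m n :: nat and x y z :: "'v btree \<Rightarrow>\<^sub>0 'k"
  assume a: "i \<in> {1..l}" "k \<in> {1..l}" "i < k" "x \<in> carrier (ops (tree_operad C) l)"
    "y \<in> carrier (ops (tree_operad C) m)" "z \<in> carrier (ops (tree_operad C) n)"
  have *: "graft (k + m - 1) n (graft i m t s) u = graft i m (graft k n t u) s"
    if "s \<in> Poly_Mapping.keys y" "u \<in> Poly_Mapping.keys z" for t s u
    using a that by (intro graft_parallel)
      (simp_all add: keys_btreesD[of y C m] keys_btreesD[of z C n] del: One_nat_def)
  \<comment> \<open>The two sides of the parallel axiom run through \<open>y\<close> and
    \<open>z\<close> in opposite orders, so the sums are exchanged before trees are
    compared.\<close>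
  have "lin_extend (\<lambda>s. lin_extend (\<lambda>u. monomial (graft (k + m - 1) n (graft i m t s) u)) z) y =
        lin_extend (\<lambda>u. lin_extend (\<lambda>s. monomial (graft i m (graft k n t u) s)) y) z" for t
    by (subst lin_extend_swap) (intro lin_extend_cong arg_cong[where f = monomial] *)
  then show "pcomp (tree_operad C) (l + m - 1) n (k + m - 1) (pcomp (tree_operad C) l m i x y) z =
      pcomp (tree_operad C) (l + n - 1) m i (pcomp (tree_operad C) l n k x z) y"
    by (simp add: bilin_extend_def lin_extend_lin_extend)
next
  fix i m n \<sigma> \<tau> \<rho> and x y :: "'v btree \<Rightarrow>\<^sub>0 'k"
  assume a: "i \<in> {1..m}" "x \<in> carrier (ops (tree_operad C) m)" "y \<in> carrier (ops (tree_operad C) n)"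
    "\<sigma> permutes {1..m}"
    and b: "\<And>j. j \<in> {1..m} - {i} \<Longrightarrow> \<rho> (outer i n j) = outer (\<sigma> i) n (\<sigma> j)"
    "\<And>l. l \<in> {1..n} \<Longrightarrow> \<rho> (inner i l) = inner (\<sigma> i) (\<tau> l)"
  have "graft (\<sigma> i) n (relabel \<sigma> t) (relabel \<tau> s) = relabel \<rho> (graft i n t s)"
    if "t \<in> Poly_Mapping.keys x" "s \<in> Poly_Mapping.keys y" for t s
    using a(4) b keys_btreesD(1)[of x C m t] keys_btreesD(1)[of y C n s] a(2,3) that
    by (intro graft_equivariant[of _ m]) (auto simp del: One_nat_def)
  then show "pcomp (tree_operad C) m n (\<sigma> i) (act (tree_operad C) m \<sigma> x) (act (tree_operad C) n \<tau> y) =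
      act (tree_operad C) (m + n - 1) \<rho> (pcomp (tree_operad C) m n i x y)"
    by (auto simp: bilin_extend_def lin_extend_lin_extend
        intro!: lin_extend_cong arg_cong[where f = monomial])
qed (auto simp: linear_maps_def lin_extend_add lin_extend_scale lin_extend_lin_extend
    bilin_extend_add_left bilin_extend_add_right bilin_extend_scale_left bilin_extend_scale_right
    relabel_relabel comp_def bilin_extend_def[of _ _ "monomial _"] graft_Leaf_right
    simp del: One_nat_def
    dest: subsetD[OF relabel_closed] subsetD[OF bilin_extend_closed, rotated -1])

section \<open>Quotient operads\<close>

definition operad_hom :: "('k::field, 'a) operad \<Rightarrow> ('k, 'b) operad \<Rightarrow> (nat \<Rightarrow> 'a \<Rightarrow> 'b) \<Rightarrow> bool" where
  "operad_hom P Q f \<longleftrightarrow>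
    (\<forall>n. f n \<in> linear_maps (ops P n) (ops Q n)) \<and>
    (\<forall>n \<sigma>. \<sigma> permutes {1..n} \<longrightarrow> (\<forall>x\<in>carrier (ops P n). f n (act P n \<sigma> x) = act Q n \<sigma> (f n x))) \<and>
    (\<forall>m n. \<forall>i\<in>{1..m}. \<forall>x\<in>carrier (ops P m). \<forall>y\<in>carrier (ops P n).
       f (m + n - 1) (pcomp P m n i x y) = pcomp Q m n i (f m x) (f n y)) \<and>
    f 1 (idop P) = idop Q"

lemma operad_iso_iff:
  "operad_iso P Q f \<longleftrightarrow>
   operad_hom P Q f \<and> (\<forall>n. bij_betw (f n) (carrier (ops P n)) (carrier (ops Q n)))"
  by (auto simp: operad_iso_def operad_hom_def)

lemma linear_mapsD:
  assumes "f \<in> linear_maps M N"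
  shows "x \<in> carrier M \<Longrightarrow> f x \<in> carrier N"
    and "\<lbrakk>x \<in> carrier M; y \<in> carrier M\<rbrakk> \<Longrightarrow> f (x \<oplus>\<^bsub>M\<^esub> y) = f x \<oplus>\<^bsub>N\<^esub> f y"
    and "x \<in> carrier M \<Longrightarrow> f (c \<odot>\<^bsub>M\<^esub> x) = c \<odot>\<^bsub>N\<^esub> f x"
  using assms by (auto simp: linear_maps_def)

lemma operad_homD:
  assumes "operad_hom P Q f"
  shows "f n \<in> linear_maps (ops P n) (ops Q n)"
    and "x \<in> carrier (ops P n) \<Longrightarrow> f n x \<in> carrier (ops Q n)"
    and "\<lbrakk>x \<in> carrier (ops P n); y \<in> carrier (ops P n)\<rbrakk>
      \<Longrightarrow> f n (x \<oplus>\<^bsub>ops P n\<^esub> y) = f n x \<oplus>\<^bsub>ops Q n\<^esub> f n y"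
    and "x \<in> carrier (ops P n) \<Longrightarrow> f n (c \<odot>\<^bsub>ops P n\<^esub> x) = c \<odot>\<^bsub>ops Q n\<^esub> f n x"
    and "\<lbrakk>\<sigma> permutes {1..n}; x \<in> carrier (ops P n)\<rbrakk> \<Longrightarrow> f n (act P n \<sigma> x) = act Q n \<sigma> (f n x)"
    and "\<lbrakk>i \<in> {1..m}; x \<in> carrier (ops P m); y \<in> carrier (ops P n)\<rbrakk>
      \<Longrightarrow> f (m + n - 1) (pcomp P m n i x y) = pcomp Q m n i (f m x) (f n y)"
    and "f 1 (idop P) = idop Q"
  using assms by (auto simp: operad_hom_def linear_maps_def)

lemma linear_maps_zero:
  fixes M :: "('k::field, 'a) module" and N :: "('k, 'b) module"
  assumes "vector_space_rec M" "vector_space_rec N" "f \<in> linear_maps M N"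
  shows "f \<zero>\<^bsub>M\<^esub> = \<zero>\<^bsub>N\<^esub>"
proof -
  interpret M: module "ring_of_type_algebra :: 'k ring" M by fact
  interpret N: module "ring_of_type_algebra :: 'k ring" N by fact
  have "f \<zero>\<^bsub>M\<^esub> = f (0 \<odot>\<^bsub>M\<^esub> \<zero>\<^bsub>M\<^esub>)"
    using M.smult_l_null[of "\<zero>\<^bsub>M\<^esub>"] by simp
  also have "\<dots> = 0 \<odot>\<^bsub>N\<^esub> f \<zero>\<^bsub>M\<^esub>"
    using linear_mapsD(3)[OF assms(3), of "\<zero>\<^bsub>M\<^esub>" 0] by simp
  also have "\<dots> = \<zero>\<^bsub>N\<^esub>"
    using N.smult_l_null[of "f \<zero>\<^bsub>M\<^esub>"] linear_mapsD(1)[OF assms(3)] by simp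
  finally show ?thesis .
qed

context operad
begin

lemma vs_closed [simp]:
  "\<zero>\<^bsub>ops P n\<^esub> \<in> carrier (ops P n)"
  "\<lbrakk>x \<in> carrier (ops P n); y \<in> carrier (ops P n)\<rbrakk> \<Longrightarrow> x \<oplus>\<^bsub>ops P n\<^esub> y \<in> carrier (ops P n)"
  "x \<in> carrier (ops P n) \<Longrightarrow> c \<odot>\<^bsub>ops P n\<^esub> x \<in> carrier (ops P n)"
  "x \<in> carrier (ops P n) \<Longrightarrow> \<ominus>\<^bsub>ops P n\<^esub> x \<in> carrier (ops P n)"
proof -
  interpret module "ring_of_type_algebra :: 'k ring" "ops P n"
    by (rule ops_vector_space)
  show "\<zero>\<^bsub>ops P n\<^esub> \<in> carrier (ops P n)"
    "\<lbrakk>x \<in> carrier (ops P n); y \<in> carrier (ops P n)\<rbrakk> \<Longrightarrow> x \<oplus>\<^bsub>ops P n\<^esub> y \<in> carrier (ops P n)"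
    "x \<in> carrier (ops P n) \<Longrightarrow> c \<odot>\<^bsub>ops P n\<^esub> x \<in> carrier (ops P n)"
    "x \<in> carrier (ops P n) \<Longrightarrow> \<ominus>\<^bsub>ops P n\<^esub> x \<in> carrier (ops P n)"
    by simp_all
qed

lemma abelian_group_ops: "abelian_group (ops P n)"
  using ops_vector_space by (rule module.axioms)

lemma act_closed [simp]:
  "\<lbrakk>\<sigma> permutes {1..n}; x \<in> carrier (ops P n)\<rbrakk> \<Longrightarrow> act P n \<sigma> x \<in> carrier (ops P n)"
  using linear_mapsD(1)[OF act_linear] .

lemma pcomp_closed [simp]:
  "\<lbrakk>i \<in> {1..m}; x \<in> carrier (ops P m); y \<in> carrier (ops P n)\<rbrakk>
    \<Longrightarrow> pcomp P m n i x y \<in> carrier (ops P (m + n - 1))"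
  using linear_mapsD(1)[OF pcomp_linear_right] .

lemma minus_conv: "x \<in> carrier (ops P n) \<Longrightarrow> \<ominus>\<^bsub>ops P n\<^esub> x = (- 1) \<odot>\<^bsub>ops P n\<^esub> x"
proof -
  assume x: "x \<in> carrier (ops P n)"
  interpret module "ring_of_type_algebra :: 'k ring" "ops P n"
    by (rule ops_vector_space)
  have "(- 1) \<odot>\<^bsub>ops P n\<^esub> x \<oplus>\<^bsub>ops P n\<^esub> x = (- 1 + 1) \<odot>\<^bsub>ops P n\<^esub> x"
    using smult_l_distr[of "- 1" 1 x] smult_one[of x] x by simp
  also have "\<dots> = \<zero>\<^bsub>ops P n\<^esub>"
    using smult_l_null[of x] x by simp
  finally show ?thesis
    using x by (intro M.minus_equality) auto
qed

end

text \<open>Every axiom is a closure property or an equation between operations on elements, hence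
  passes to a surjective image. That zero is preserved is a separate assumption, because linearity
  yields it only once the target is known to be a vector space.\<close>

lemma operad_surjective_image:
  fixes P :: "('k::field, 'a) operad" and Q :: "('k, 'b) operad"
  assumes "operad P" and hom: "operad_hom P Q f"
    and surj: "\<And>n. f n ` carrier (ops P n) = carrier (ops Q n)"
    and zero: "\<And>n. f n \<zero>\<^bsub>ops P n\<^esub> = \<zero>\<^bsub>ops Q n\<^esub>"
  shows "operad Q"
proof -
  interpret P: operad P by fact
  note hD = operad_homD[OF hom]
  have ex: "\<exists>x\<in>carrier (ops P n). y = f n x" if "y \<in> carrier (ops Q n)" for n y
    using that surj[of n] by auto
  note add = hD(3)[symmetric] and smult = hD(4)[symmetric]
    and act = hD(5)[symmetric] and pcomp = hD(6)[symmetric]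
  show ?thesis
  proof (rule operad.intro)
    fix n
    interpret M: module "ring_of_type_algebra :: 'k ring" "ops P n"
      by (rule P.ops_vector_space)
    show "vector_space_rec (ops Q n)"
    proof (rule vector_space_recI)
      fix y assume "y \<in> carrier (ops Q n)"
      then obtain x where x: "x \<in> carrier (ops P n)" "y = f n x"
        using ex by blast
      then show "\<exists>z\<in>carrier (ops Q n). z \<oplus>\<^bsub>ops Q n\<^esub> y = \<zero>\<^bsub>ops Q n\<^esub>"
        by (intro bexI[of _ "f n (\<ominus>\<^bsub>ops P n\<^esub> x)"]) (auto simp: hD(2) add zero M.M.l_neg)
      show "\<zero>\<^bsub>ops Q n\<^esub> \<oplus>\<^bsub>ops Q n\<^esub> y = y"
        using x add[of "\<zero>\<^bsub>ops P n\<^esub>" n x] by (simp add: zero)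
    next
      show "\<zero>\<^bsub>ops Q n\<^esub> \<in> carrier (ops Q n)"
        using hD(2)[of "\<zero>\<^bsub>ops P n\<^esub>" n] by (simp add: zero)
    next
      fix c d x assume "x \<in> carrier (ops Q n)"
      then show "(c + d) \<odot>\<^bsub>ops Q n\<^esub> x = c \<odot>\<^bsub>ops Q n\<^esub> x \<oplus>\<^bsub>ops Q n\<^esub> d \<odot>\<^bsub>ops Q n\<^esub> x"
        using M.smult_l_distr[of c d] by (auto dest!: ex simp: smult add)
    next
      fix c d x assume "x \<in> carrier (ops Q n)"
      then show "(c * d) \<odot>\<^bsub>ops Q n\<^esub> x = c \<odot>\<^bsub>ops Q n\<^esub> (d \<odot>\<^bsub>ops Q n\<^esub> x)"
        using M.smult_assoc1[of c d] by (auto dest!: ex simp: smult)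
    next
      fix x assume "x \<in> carrier (ops Q n)"
      then show "1 \<odot>\<^bsub>ops Q n\<^esub> x = x"
        using M.smult_one by (auto dest!: ex simp: smult)
    next
      fix c x y assume "x \<in> carrier (ops Q n)" "y \<in> carrier (ops Q n)"
      then show "c \<odot>\<^bsub>ops Q n\<^esub> (x \<oplus>\<^bsub>ops Q n\<^esub> y) = c \<odot>\<^bsub>ops Q n\<^esub> x \<oplus>\<^bsub>ops Q n\<^esub> c \<odot>\<^bsub>ops Q n\<^esub> y"
        using M.smult_r_distr[of c] by (auto dest!: ex simp: smult add)
    next
      fix x y assume "x \<in> carrier (ops Q n)" "y \<in> carrier (ops Q n)"
      then show "x \<oplus>\<^bsub>ops Q n\<^esub> y = y \<oplus>\<^bsub>ops Q n\<^esub> x"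
        using M.M.a_comm by (auto dest!: ex simp: add)
    next
      fix x y z assume "x \<in> carrier (ops Q n)" "y \<in> carrier (ops Q n)" "z \<in> carrier (ops Q n)"
      then show "(x \<oplus>\<^bsub>ops Q n\<^esub> y) \<oplus>\<^bsub>ops Q n\<^esub> z = x \<oplus>\<^bsub>ops Q n\<^esub> (y \<oplus>\<^bsub>ops Q n\<^esub> z)"
        using M.M.a_assoc by (auto dest!: ex simp: add)
    qed (auto dest!: ex simp: add smult hD(2))
  next
    fix \<sigma> and n :: nat assume "\<sigma> permutes {1..n}"
    then show "act Q n \<sigma> \<in> linear_maps (ops Q n) (ops Q n)"
      using linear_mapsD(2,3)[OF P.act_linear]
      by (auto simp: linear_maps_def dest!: ex simp del: One_nat_def)
        (auto simp: act add smult hD(2) simp del: One_nat_def)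
  next
    fix n x assume "x \<in> carrier (ops Q n)"
    then show "act Q n id x = x"
      using P.act_id by (auto dest!: ex simp: act permutes_id)
  next
    fix n :: nat and x and \<sigma> \<tau> :: "nat \<Rightarrow> nat"
    assume "\<sigma> permutes {1..n}" "\<tau> permutes {1..n}" "x \<in> carrier (ops Q n)"
    then show "act Q n (\<sigma> \<circ> \<tau>) x = act Q n \<sigma> (act Q n \<tau> x)"
      using P.act_comp by (auto dest!: ex simp: act permutes_compose simp del: One_nat_def)
  next
    fix i m n :: nat and x assume "i \<in> {1..m}" "x \<in> carrier (ops Q m)"
    then show "pcomp Q m n i x \<in> linear_maps (ops Q n) (ops Q (m + n - 1))"
      using linear_mapsD(2,3)[OF P.pcomp_linear_right]
      by (auto simp: linear_maps_def dest!: ex simp del: One_nat_def atLeastAtMost_iff)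
        (auto simp: pcomp add smult hD(2) simp del: One_nat_def atLeastAtMost_iff)
  next
    fix i m n :: nat and y assume "i \<in> {1..m}" "y \<in> carrier (ops Q n)"
    then show "(\<lambda>x. pcomp Q m n i x y) \<in> linear_maps (ops Q m) (ops Q (m + n - 1))"
      using linear_mapsD(2,3)[OF P.pcomp_linear_left]
      by (auto simp: linear_maps_def dest!: ex simp del: One_nat_def atLeastAtMost_iff)
        (auto simp: pcomp add smult hD(2) simp del: One_nat_def atLeastAtMost_iff)
  next
    show "idop Q \<in> carrier (ops Q 1)"
      using hD(2)[OF P.idop_closed] by (simp add: hD(7) del: One_nat_def)
  next
    fix n y assume "y \<in> carrier (ops Q n)"
    then show "pcomp Q 1 n 1 (idop Q) y = y"
      using P.idop_left P.idop_closed pcomp[of 1 1 "idop P" _ n] by (auto dest!: ex simp flip: hD(7) simp del: One_nat_def)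
  next
    fix i m :: nat and x assume "i \<in> {1..m}" "x \<in> carrier (ops Q m)"
    then show "pcomp Q m 1 i x (idop Q) = x"
      using P.idop_right P.idop_closed pcomp[of i m _ "idop P" 1] by (auto dest!: ex simp flip: hD(7) simp del: One_nat_def)
  next
    fix i j l m n :: nat and x y z
    assume ij: "i \<in> {1..l}" "j \<in> {1..m}" and "x \<in> carrier (ops Q l)" "y \<in> carrier (ops Q m)"
      "z \<in> carrier (ops Q n)"
    then obtain x' y' z' where x': "x' \<in> carrier (ops P l)" "y' \<in> carrier (ops P m)"
      "z' \<in> carrier (ops P n)" "x = f l x'" "y = f m y'" "z = f n z'"
      using ex by meson
    \<comment> \<open>Pulling a nested composition back to \<open>P\<close> requires the shifted
      index to be in range, and the two sides carry equal arities in different syntactic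
      forms.\<close>
    have "i + j - 1 \<in> {1..l + m - 1}" "l + m - 1 + n - 1 = l + (m + n - 1) - 1"
      using ij by auto
    then show "pcomp Q (l + m - 1) n (i + j - 1) (pcomp Q l m i x y) z =
        pcomp Q l (m + n - 1) i x (pcomp Q m n j y z)"
      using P.pcomp_sequential[OF ij x'(1-3)] ij x' pcomp[of "i + j - 1" "l + m - 1" _ _ n]
        pcomp[of i l _ _ "m + n - 1"]
      by (simp add: pcomp del: One_nat_def atLeastAtMost_iff)
  next
    fix i k l m n :: nat and x y z
    assume ij: "i \<in> {1..l}" "k \<in> {1..l}" "i < k" and "x \<in> carrier (ops Q l)" "y \<in> carrier (ops Q m)"
      "z \<in> carrier (ops Q n)"
    then obtain x' y' z' where x': "x' \<in> carrier (ops P l)" "y' \<in> carrier (ops P m)"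
      "z' \<in> carrier (ops P n)" "x = f l x'" "y = f m y'" "z = f n z'"
      using ex by meson
    have "k + m - 1 \<in> {1..l + m - 1}" "i \<in> {1..l + n - 1}" "l + m - 1 + n - 1 = l + n - 1 + m - 1"
      using ij by auto
    then show "pcomp Q (l + m - 1) n (k + m - 1) (pcomp Q l m i x y) z =
        pcomp Q (l + n - 1) m i (pcomp Q l n k x z) y"
      using P.pcomp_parallel[OF ij x'(1-3)] ij x' pcomp[of "k + m - 1" "l + m - 1" _ _ n]
        pcomp[of i "l + n - 1" _ _ m]
      by (simp add: pcomp del: One_nat_def atLeastAtMost_iff)
  next
    fix i m n :: nat and x y \<sigma> \<tau> \<rho>
    assume a: "i \<in> {1..m}" "\<sigma> permutes {1..m}" "\<tau> permutes {1..n}" "\<rho> permutes {1..m + n - 1}"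
      "\<And>j. j \<in> {1..m} - {i} \<Longrightarrow> \<rho> (outer i n j) = outer (\<sigma> i) n (\<sigma> j)"
      "\<And>l. l \<in> {1..n} \<Longrightarrow> \<rho> (inner i l) = inner (\<sigma> i) (\<tau> l)"
      and "x \<in> carrier (ops Q m)" "y \<in> carrier (ops Q n)"
    then obtain x' y' where x': "x' \<in> carrier (ops P m)" "y' \<in> carrier (ops P n)"
      "x = f m x'" "y = f n y'"
      using ex by meson
    have "\<sigma> i \<in> {1..m}"
      using a permutes_in_image by metis
    then show "pcomp Q m n (\<sigma> i) (act Q m \<sigma> x) (act Q n \<tau> y) = act Q (m + n - 1) \<rho> (pcomp Q m n i x y)"
      using P.pcomp_equivariant[OF a(1) x'(1,2) a(2-6)] a x'
      by (simp add: pcomp act del: One_nat_def atLeastAtMost_iff)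
  qed
qed

lemma operad_hom_comp:
  assumes "operad_hom P Q f" "operad_hom Q R g"
  shows "operad_hom P R (\<lambda>n x. g n (f n x))"
  using assms unfolding operad_hom_def linear_maps_def by (auto simp: Pi_iff)

text \<open>The universal property of a surjection \<open>p\<close>, with the factor
  \<open>F\<close> already given. It yields maps out of quotients and, when \<open>p\<close> is an
  isomorphism, its inverse.\<close>

lemma operad_hom_factor:
  assumes "operad P" and p: "operad_hom P P' p" and g: "operad_hom P Q g"
    and surj: "\<And>n. p n ` carrier (ops P n) = carrier (ops P' n)"
    and F: "\<And>n x. x \<in> carrier (ops P n) \<Longrightarrow> F n (p n x) = g n x"
  shows "operad_hom P' Q F"
proof -
  interpret P: operad P by fact
  have ex: "\<exists>x\<in>carrier (ops P n). y = p n x" if "y \<in> carrier (ops P' n)" for n y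
    using that surj[of n] by auto
  note pD = operad_homD[OF p] and gD = operad_homD[OF g]
  show ?thesis
    unfolding operad_hom_def linear_maps_def
  proof (intro conjI allI ballI impI CollectI)
    fix n show "F n \<in> carrier (ops P' n) \<rightarrow> carrier (ops Q n)"
      using gD(2) by (auto dest!: ex simp: F)
  next
    fix n x y assume "x \<in> carrier (ops P' n)" "y \<in> carrier (ops P' n)"
    then show "F n (x \<oplus>\<^bsub>ops P' n\<^esub> y) = F n x \<oplus>\<^bsub>ops Q n\<^esub> F n y"
      by (auto dest!: ex simp: F gD(3) simp flip: pD(3))
  next
    fix n c x assume "x \<in> carrier (ops P' n)"
    then show "F n (c \<odot>\<^bsub>ops P' n\<^esub> x) = c \<odot>\<^bsub>ops Q n\<^esub> F n x"
      by (auto dest!: ex simp: F gD(4) simp flip: pD(4))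
  next
    fix n \<sigma> x assume "\<sigma> permutes {1..n}" "x \<in> carrier (ops P' n)"
    then show "F n (act P' n \<sigma> x) = act Q n \<sigma> (F n x)"
      by (auto dest!: ex simp: F gD(5) simp flip: pD(5) simp del: One_nat_def)
  next
    fix m n :: nat and i x y assume "i \<in> {1..m}" "x \<in> carrier (ops P' m)" "y \<in> carrier (ops P' n)"
    then show "F (m + n - 1) (pcomp P' m n i x y) = pcomp Q m n i (F m x) (F n y)"
      by (auto dest!: ex simp: F gD(6) simp flip: pD(6) simp del: One_nat_def atLeastAtMost_iff)
  next
    show "F 1 (idop P') = idop Q"
      using F[OF P.idop_closed] gD(7) pD(7) by simp
  qed
qed

section \<open>Ideals and their quotients\<close>

locale operad_ideal = operad P for P :: "('k::field, 'a) operad" +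
  fixes I :: "nat \<Rightarrow> 'a set"
  assumes ideal_closed: "I n \<subseteq> carrier (ops P n)"
    and ideal_zero: "\<zero>\<^bsub>ops P n\<^esub> \<in> I n"
    and ideal_add: "\<lbrakk>x \<in> I n; y \<in> I n\<rbrakk> \<Longrightarrow> x \<oplus>\<^bsub>ops P n\<^esub> y \<in> I n"
    and ideal_smult: "x \<in> I n \<Longrightarrow> c \<odot>\<^bsub>ops P n\<^esub> x \<in> I n"
    and ideal_act: "\<lbrakk>\<sigma> permutes {1..n}; x \<in> I n\<rbrakk> \<Longrightarrow> act P n \<sigma> x \<in> I n"
    and ideal_pcomp_left: "\<lbrakk>i \<in> {1..m}; x \<in> I m; y \<in> carrier (ops P n)\<rbrakk>
      \<Longrightarrow> pcomp P m n i x y \<in> I (m + n - 1)"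
    and ideal_pcomp_right: "\<lbrakk>i \<in> {1..m}; x \<in> carrier (ops P m); y \<in> I n\<rbrakk>
      \<Longrightarrow> pcomp P m n i x y \<in> I (m + n - 1)"
begin

definition proj :: "nat \<Rightarrow> 'a \<Rightarrow> 'a set" where
  "proj n x = I n +>\<^bsub>ops P n\<^esub> x"

lemma ideal_carrier [simp]: "x \<in> I n \<Longrightarrow> x \<in> carrier (ops P n)"
  using ideal_closed by blast

lemma subgroup_ideal: "subgroup (I n) (add_monoid (ops P n))"
proof -
  interpret module "ring_of_type_algebra :: 'k ring" "ops P n"
    by (rule ops_vector_space)
  show ?thesis
    using ideal_closed ideal_zero ideal_add ideal_smult
    by (intro submodule.axioms(1)[where R = "ring_of_type_algebra :: 'k ring"] submoduleI)
      (auto simp: minus_conv)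
qed

lemma abelian_subgroup_ideal: "abelian_subgroup (I n) (ops P n)"
  by (intro abelian_subgroupI3 additive_subgroupI subgroup_ideal abelian_group_ops)

lemma proj_absorb:
  assumes "k \<in> I n" "x \<in> carrier (ops P n)"
  shows "proj n (k \<oplus>\<^bsub>ops P n\<^esub> x) = proj n x"
proof -
  interpret abelian_group "ops P n"
    by (rule abelian_group_ops)
  show ?thesis
    unfolding proj_def using assms subgroup_ideal
    by (simp add: a_coset_add_assoc[symmetric] ideal_closed a_coset_join2)
qed

lemma in_projE:
  assumes "z \<in> proj n x" "x \<in> carrier (ops P n)"
  obtains h where "h \<in> I n" "z = h \<oplus>\<^bsub>ops P n\<^esub> x" "z \<in> carrier (ops P n)" "h \<in> carrier (ops P n)"
  using assms by (auto simp: proj_def a_r_coset_def')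

lemma proj_self: "x \<in> carrier (ops P n) \<Longrightarrow> x \<in> proj n x"
proof -
  assume x: "x \<in> carrier (ops P n)"
  interpret abelian_group "ops P n"
    by (rule abelian_group_ops)
  have "\<zero>\<^bsub>ops P n\<^esub> \<oplus>\<^bsub>ops P n\<^esub> x \<in> proj n x"
    unfolding proj_def by (rule a_rcosI[OF ideal_zero ideal_closed x])
  then show ?thesis
    using x by simp
qed

lemma proj_eq_iff:
  assumes "x \<in> carrier (ops P n)" "y \<in> carrier (ops P n)"
  shows "proj n x = proj n y \<longleftrightarrow> x \<ominus>\<^bsub>ops P n\<^esub> y \<in> I n"
proof -
  interpret abelian_group "ops P n"
    by (rule abelian_group_ops)
  show ?thesis
  proof
    assume "proj n x = proj n y"
    then have "x \<in> proj n y"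
      using proj_self assms by blast
    then obtain h where "h \<in> I n" "x = h \<oplus>\<^bsub>ops P n\<^esub> y" "h \<in> carrier (ops P n)"
      using assms by (blast elim: in_projE)
    then show "x \<ominus>\<^bsub>ops P n\<^esub> y \<in> I n"
      using assms by (simp add: minus_eq a_assoc r_neg)
  next
    assume "x \<ominus>\<^bsub>ops P n\<^esub> y \<in> I n"
    from proj_absorb[OF this assms(2)] show "proj n x = proj n y"
      using assms by (simp add: minus_eq a_assoc l_neg)
  qed
qed

lemma proj_zero: "proj n \<zero>\<^bsub>ops P n\<^esub> = I n"
proof -
  interpret abelian_group "ops P n"
    by (rule abelian_group_ops)
  show ?thesis
    by (simp add: proj_def ideal_closed)
qed

text \<open>The operations of a quotient operad are unions over all representatives. Once the value
  does not depend on the representative, the union collapses to a single coset.\<close>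

lemma Union_proj:
  assumes x: "x \<in> carrier (ops P n)"
    and g: "\<And>z. z \<in> proj n x \<Longrightarrow> G z = G x"
  shows "(\<Union>z\<in>proj n x. G z) = G x"
  using proj_self[OF x] g by blast

lemma quotient_operad_simps:
  "carrier (ops (quotient_operad P I) n) = proj n ` carrier (ops P n)"
  "\<zero>\<^bsub>ops (quotient_operad P I) n\<^esub> = I n"
  "A \<oplus>\<^bsub>ops (quotient_operad P I) n\<^esub> B = A <+>\<^bsub>ops P n\<^esub> B"
  "c \<odot>\<^bsub>ops (quotient_operad P I) n\<^esub> A = (\<Union>x\<in>A. proj n (c \<odot>\<^bsub>ops P n\<^esub> x))"
  "act (quotient_operad P I) n \<sigma> A = (\<Union>x\<in>A. proj n (act P n \<sigma> x))"
  "pcomp (quotient_operad P I) m n i A B = (\<Union>x\<in>A. \<Union>y\<in>B. proj (m + n - 1) (pcomp P m n i x y))"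
  "idop (quotient_operad P I) = proj 1 (idop P)"
  by (auto simp: quotient_operad_def quotient_module_def proj_def A_RCOSETS_def')

lemma proj_surj: "proj n ` carrier (ops P n) = carrier (ops (quotient_operad P I) n)"
  by (simp add: quotient_operad_simps)

lemma proj_hom: "operad_hom P (quotient_operad P I) proj"
  unfolding operad_hom_def linear_maps_def
proof (intro conjI allI ballI impI CollectI)
  fix n show "proj n \<in> carrier (ops P n) \<rightarrow> carrier (ops (quotient_operad P I) n)"
    by (auto simp: quotient_operad_simps)
next
  fix n x y assume "x \<in> carrier (ops P n)" "y \<in> carrier (ops P n)"
  then show "proj n (x \<oplus>\<^bsub>ops P n\<^esub> y) = proj n x \<oplus>\<^bsub>ops (quotient_operad P I) n\<^esub> proj n y"
    using abelian_subgroup.a_rcos_sum[OF abelian_subgroup_ideal]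
    by (simp add: quotient_operad_simps proj_def)
next
  fix n c x assume x: "x \<in> carrier (ops P n)"
  interpret module "ring_of_type_algebra :: 'k ring" "ops P n"
    by (rule ops_vector_space)
  have "proj n (c \<odot>\<^bsub>ops P n\<^esub> z) = proj n (c \<odot>\<^bsub>ops P n\<^esub> x)" if z: "z \<in> proj n x" for z
  proof -
    obtain h where "h \<in> I n" "z = h \<oplus>\<^bsub>ops P n\<^esub> x"
      using z x by (blast elim: in_projE)
    then show ?thesis
      using x smult_r_distr[of c h x] by (simp add: ideal_smult proj_absorb)
  qed
  then show "proj n (c \<odot>\<^bsub>ops P n\<^esub> x) = c \<odot>\<^bsub>ops (quotient_operad P I) n\<^esub> proj n x"
    unfolding quotient_operad_simps by (intro Union_proj[symmetric] x)
next
  fix n \<sigma> x assume s: "\<sigma> permutes {1..n}" and x: "x \<in> carrier (ops P n)"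
  have "proj n (act P n \<sigma> z) = proj n (act P n \<sigma> x)" if z: "z \<in> proj n x" for z
  proof -
    obtain h where "h \<in> I n" "z = h \<oplus>\<^bsub>ops P n\<^esub> x"
      using z x by (blast elim: in_projE)
    then show ?thesis
      using x s linear_mapsD(2)[OF act_linear[OF s], of h x] by (simp add: ideal_act proj_absorb del: One_nat_def)
  qed
  then show "proj n (act P n \<sigma> x) = act (quotient_operad P I) n \<sigma> (proj n x)"
    unfolding quotient_operad_simps by (intro Union_proj[symmetric] x)
next
  fix m n :: nat and i x y
  assume i: "i \<in> {1..m}" and x: "x \<in> carrier (ops P m)" and y: "y \<in> carrier (ops P n)"
  have 1: "proj (m + n - 1) (pcomp P m n i z y') = proj (m + n - 1) (pcomp P m n i x y')"
    if z: "z \<in> proj m x" and y': "y' \<in> carrier (ops P n)" for z y'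
  proof -
    obtain h where "h \<in> I m" "z = h \<oplus>\<^bsub>ops P m\<^esub> x"
      using z x by (blast elim: in_projE)
    then show ?thesis
      using x y' i linear_mapsD(2)[OF pcomp_linear_left[OF i y'], of h x]
      by (simp add: ideal_pcomp_left proj_absorb del: One_nat_def atLeastAtMost_iff)
  qed
  have 2: "proj (m + n - 1) (pcomp P m n i x z) = proj (m + n - 1) (pcomp P m n i x y)"
    if z: "z \<in> proj n y" for z
  proof -
    obtain h where "h \<in> I n" "z = h \<oplus>\<^bsub>ops P n\<^esub> y"
      using z y by (blast elim: in_projE)
    then show ?thesis
      using x y i linear_mapsD(2)[OF pcomp_linear_right[OF i x], of h _ y]
      by (simp add: ideal_pcomp_right proj_absorb del: One_nat_def atLeastAtMost_iff)
  qed
  have 3: "z \<in> carrier (ops P n)" if z: "z \<in> proj n y" for z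
    using z y by (blast elim: in_projE)
  have "(\<Union>z\<in>proj m x. \<Union>w\<in>proj n y. proj (m + n - 1) (pcomp P m n i z w)) =
        (\<Union>w\<in>proj n y. proj (m + n - 1) (pcomp P m n i x w))"
    by (intro Union_proj x SUP_cong refl 1 3)
  also have "\<dots> = proj (m + n - 1) (pcomp P m n i x y)"
    by (intro Union_proj y 2)
  finally show "proj (m + n - 1) (pcomp P m n i x y) =
      pcomp (quotient_operad P I) m n i (proj m x) (proj n y)"
    unfolding quotient_operad_simps ..
qed (simp add: quotient_operad_simps)

lemma quotient_operad: "operad (quotient_operad P I)"
  by (rule operad_surjective_image[OF operad_axioms proj_hom proj_surj])
    (simp add: proj_zero quotient_operad_simps)

end

lemma (in operad) operad_ideal_operadic_ideal:
  assumes "\<And>n. G n \<subseteq> carrier (ops P n)"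
  shows "operad_ideal P (operadic_ideal P G)"
proof
  fix n
  have "x \<in> carrier (ops P n)" if "in_operadic_ideal P G n x" for x
    using that
    by induction (use assms in \<open>auto simp del: One_nat_def atLeastAtMost_iff\<close>)
  then show "operadic_ideal P G n \<subseteq> carrier (ops P n)"
    by (auto simp: operadic_ideal_def)
qed (auto simp: operadic_ideal_def simp del: One_nat_def atLeastAtMost_iff intro: in_operadic_ideal.intros)

section \<open>Generated ideals under homomorphisms and isomorphisms\<close>

lemma operad_hom_operadic_ideal:
  assumes "operad P" "operad Q" "operad_hom P Q f" "\<And>n. G n \<subseteq> carrier (ops P n)"
    and "in_operadic_ideal P G n x"
  shows "x \<in> carrier (ops P n) \<and> in_operadic_ideal Q (\<lambda>n. f n ` G n) n (f n x)"
proof -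
  interpret P: operad P by fact
  interpret Q: operad Q by fact
  show ?thesis
    using assms(5)
  proof induction
    case (zero n)
    then show ?case
      using linear_maps_zero[OF P.ops_vector_space Q.ops_vector_space operad_homD(1)[OF assms(3)], of n]
      by (simp add: in_operadic_ideal.zero)
  qed (use assms(4) in \<open>auto simp: operad_homD[OF assms(3)] simp del: One_nat_def atLeastAtMost_iff
      intro: in_operadic_ideal.intros\<close>)
qed

lemma operad_iso_inv:
  assumes "operad P" "operad_iso P Q f"
  shows "operad_iso Q P (\<lambda>n. inv_into (carrier (ops P n)) (f n))"
proof -
  have bij: "bij_betw (f n) (carrier (ops P n)) (carrier (ops Q n))" for n
    using assms by (simp add: operad_iso_iff)
  have hom: "operad_hom P Q f"
    using assms by (simp add: operad_iso_iff)
  interpret P: operad P by fact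
  have "operad_hom P P (\<lambda>n x. x)"
    by (auto simp: operad_hom_def linear_maps_def)
  then have "operad_hom Q P (\<lambda>n. inv_into (carrier (ops P n)) (f n))"
    by (rule operad_hom_factor[OF assms(1) hom])
      (use bij in \<open>auto simp: bij_betw_def\<close>)
  then show ?thesis
    using bij by (simp add: operad_iso_iff bij_betw_inv_into)
qed

text \<open>A homomorphism turns each closure step of the generated ideal into the same step on the
  other side. The inverse isomorphism sends the image generators back to \<open>G\<close>, which
  gives the reverse inclusion.\<close>

lemma operad_iso_operadic_ideal:
  assumes "operad P" "operad Q" and iso: "operad_iso P Q f" and G: "\<And>n. G n \<subseteq> carrier (ops P n)"
  shows "f n ` operadic_ideal P G n = operadic_ideal Q (\<lambda>n. f n ` G n) n"
proof
  have hom: "operad_hom P Q f" and bij: "\<And>n. bij_betw (f n) (carrier (ops P n)) (carrier (ops Q n))"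
    using iso by (auto simp: operad_iso_iff)
  show "f n ` operadic_ideal P G n \<subseteq> operadic_ideal Q (\<lambda>n. f n ` G n) n"
    using operad_hom_operadic_ideal[OF assms(1,2) hom G] by (auto simp: operadic_ideal_def)
  define g where "g n = inv_into (carrier (ops P n)) (f n)" for n
  have g: "operad_hom Q P g"
    using operad_iso_inv[OF assms(1) iso] unfolding operad_iso_iff g_def[abs_def] by blast
  have "g n ` f n ` G n = G n" for n
    unfolding g_def using G[of n] bij[of n] by (simp add: bij_betw_def inv_into_image_cancel)
  moreover have "f n ` G n \<subseteq> carrier (ops Q n)" for n
    using G[of n] bij[of n] by (auto simp: bij_betw_def)
  ultimately have "y \<in> carrier (ops Q n) \<and> in_operadic_ideal P G n (g n y)"
    if "in_operadic_ideal Q (\<lambda>n. f n ` G n) n y" for y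
    using operad_hom_operadic_ideal[OF assms(2,1) g _ that] by simp
  moreover have "f n (g n y) = y" if "y \<in> carrier (ops Q n)" for y
    unfolding g_def using that bij[of n] by (simp add: bij_betw_def f_inv_into_f)
  ultimately show "operadic_ideal Q (\<lambda>n. f n ` G n) n \<subseteq> f n ` operadic_ideal P G n"
    unfolding operadic_ideal_def by (metis (mono_tags, lifting) image_eqI mem_Collect_eq subsetI)
qed

lemma operad_iso_quotient:
  assumes "operad P" "operad Q" and iso: "operad_iso P Q f" and G: "\<And>n. G n \<subseteq> carrier (ops P n)"
  defines "I \<equiv> operadic_ideal P G" and "J \<equiv> operadic_ideal Q (\<lambda>n. f n ` G n)"
  shows "operad_iso (quotient_operad P I) (quotient_operad Q J) (\<lambda>n. image (f n))"
    and "x \<in> carrier (ops P n) \<Longrightarrow> f n ` (I n +>\<^bsub>ops P n\<^esub> x) = J n +>\<^bsub>ops Q n\<^esub> f n x"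
proof -
  have hom: "operad_hom P Q f" and bij: "\<And>n. bij_betw (f n) (carrier (ops P n)) (carrier (ops Q n))"
    using iso by (auto simp: operad_iso_iff)
  have IJ: "f n ` I n = J n" for n
    unfolding I_def J_def by (rule operad_iso_operadic_ideal[OF assms(1-4)])
  interpret P: operad_ideal P I
    unfolding I_def by (rule operad.operad_ideal_operadic_ideal[OF assms(1) G])
  interpret Q: operad_ideal Q J
    unfolding J_def
    using G bij by (intro operad.operad_ideal_operadic_ideal[OF assms(2)]) (force simp: bij_betw_def)
  have proj: "f n ` P.proj n x = Q.proj n (f n x)" if "x \<in> carrier (ops P n)" for n x
    unfolding P.proj_def Q.proj_def a_r_coset_def' IJ[symmetric]
    using that by (simp add: image_UN operad_homD(3)[OF hom])
  then show "x \<in> carrier (ops P n) \<Longrightarrow> f n ` (I n +>\<^bsub>ops P n\<^esub> x) = J n +>\<^bsub>ops Q n\<^esub> f n x"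
    by (simp add: P.proj_def Q.proj_def)
  have "operad_hom (quotient_operad P I) (quotient_operad Q J) (\<lambda>n. image (f n))"
    by (rule operad_hom_factor[OF assms(1) P.proj_hom operad_hom_comp[OF hom Q.proj_hom] P.proj_surj proj])
  moreover have "bij_betw (image (f n)) (carrier (ops (quotient_operad P I) n)) (carrier (ops (quotient_operad Q J) n))" for n
    unfolding bij_betw_def
  proof
    have "P.proj n x \<subseteq> carrier (ops P n)" if "x \<in> carrier (ops P n)" for x
      using that by (auto elim: P.in_projE)
    \<comment> \<open>Cosets are subsets of the carrier, and the direct image under an injective map
      is injective on subsets.\<close>
    then show "inj_on (image (f n)) (carrier (ops (quotient_operad P I) n))"
      using bij[of n] unfolding P.quotient_operad_simps bij_betw_def
      by (intro inj_on_subset[OF inj_on_image_Pow[of "f n" "carrier (ops P n)"]]) auto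
    have "image (f n) ` carrier (ops (quotient_operad P I) n) = Q.proj n ` f n ` carrier (ops P n)"
      by (auto simp: P.quotient_operad_simps proj image_image)
    then show "image (f n) ` carrier (ops (quotient_operad P I) n) = carrier (ops (quotient_operad Q J) n)"
      using bij[of n] by (simp add: Q.quotient_operad_simps bij_betw_def)
  qed
  ultimately show "operad_iso (quotient_operad P I) (quotient_operad Q J) (\<lambda>n. image (f n))"
    by (simp add: operad_iso_iff)
qed

section \<open>The free operad in arity three\<close>

lemma rotation_simps [simp]:
  "rotation (Suc 0) = 2" "rotation 1 = 2" "rotation 2 = 3" "rotation 3 = Suc 0"
  by (simp_all add: rotation_def transpose_def)

lemma rotation_permutes: "rotation permutes {1..3}"
  unfolding rotation_def by (intro permutes_compose permutes_swap_id) auto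

lemma rotation_pow_permutes: "(rotation ^^ u) permutes {1..3}"
proof (induction u)
  case 0
  show ?case
    unfolding funpow.simps by (rule permutes_id)
next
  case (Suc u)
  show ?case
    unfolding funpow.simps by (rule permutes_compose[OF Suc rotation_permutes])
qed

lemma rotation_pow_2 [simp]: "(rotation ^^ 2) x = rotation (rotation x)"
  by (simp add: numeral_2_eq_2)

lemma less_3_cases: "(u :: nat) < 3 \<longleftrightarrow> u = 0 \<or> u = 1 \<or> u = 2"
  by auto

lemma permutes_3_cases:
  assumes "\<sigma> permutes {1..3::nat}"
  obtains "\<sigma> 1 = 1" "\<sigma> 2 = 2" "\<sigma> 3 = 3" | "\<sigma> 1 = 2" "\<sigma> 2 = 3" "\<sigma> 3 = 1"
    | "\<sigma> 1 = 3" "\<sigma> 2 = 1" "\<sigma> 3 = 2" | "\<sigma> 1 = 2" "\<sigma> 2 = 1" "\<sigma> 3 = 3"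
    | "\<sigma> 1 = 1" "\<sigma> 2 = 3" "\<sigma> 3 = 2" | "\<sigma> 1 = 3" "\<sigma> 2 = 2" "\<sigma> 3 = 1"
proof -
  have "\<sigma> j \<in> {1..3}" if "j \<in> {1..3}" for j
    using permutes_in_image[OF assms] that by blast
  moreover have "x \<in> {1, 2, 3}" if "x \<in> {1..3}" for x :: nat
    using that by auto
  ultimately have "\<sigma> 1 \<in> {1, 2, 3}" "\<sigma> 2 \<in> {1, 2, 3}" "\<sigma> 3 \<in> {1, 2, 3}"
    by simp_all
  moreover have "\<sigma> 1 \<noteq> \<sigma> 2" "\<sigma> 2 \<noteq> \<sigma> 3" "\<sigma> 1 \<noteq> \<sigma> 3"
    using permutes_inj[OF assms] by (simp_all add: inj_eq)
  moreover have "(a = 1 \<and> b = 2 \<and> c = 3) \<or> (a = 2 \<and> b = 3 \<and> c = 1) \<or> (a = 3 \<and> b = 1 \<and> c = 2) \<or>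
    (a = 2 \<and> b = 1 \<and> c = 3) \<or> (a = 1 \<and> b = 3 \<and> c = 2) \<or> (a = 3 \<and> b = 2 \<and> c = 1)"
    if "a \<in> {1, 2, 3}" "b \<in> {1, 2, 3}" "c \<in> {1, 2, 3}" "a \<noteq> b" "b \<noteq> c" "a \<noteq> c" for a b c :: nat
    using that by auto
  note this[of "\<sigma> 1" "\<sigma> 2" "\<sigma> 3"]
  ultimately show ?thesis
    using that by blast
qed

lemma btree_one_leaf: "length (leaves t) = 1 \<Longrightarrow> \<exists>a. t = Leaf a"
proof (cases t)
  case (Node v s u)
  assume "length (leaves t) = 1"
  moreover have "length (leaves s) \<ge> 1" "length (leaves u) \<ge> 1"
    using leaves_nonempty[of s] leaves_nonempty[of u] by (simp_all add: Suc_le_eq)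
  ultimately show ?thesis using Node by simp
qed auto

lemma btree_node_cases:
  assumes "length (leaves t) = Suc (Suc n)"
  obtains v s u k l where "t = Node v s u" "length (leaves s) = Suc k" "length (leaves u) = Suc l" "k + l = n"
proof (cases t)
  case (Node v s u)
  moreover have "length (leaves s) \<noteq> 0" "length (leaves u) \<noteq> 0"
    by simp_all
  then obtain k l where "length (leaves s) = Suc k" "length (leaves u) = Suc l"
    by (meson not0_implies_Suc)
  ultimately show ?thesis
    using assms that by simp
qed (use assms in simp)

lemma btrees_2_cases:
  assumes "t \<in> btrees C 2"
  obtains v where "v \<in> C" "t = Node v (Leaf 1) (Leaf 2) \<or> t = Node v (Leaf 2) (Leaf 1)"
proof -
  have len: "length (leaves t) = Suc (Suc 0)"
    using length_leaves_btrees[OF assms] by simp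
  obtain v s u k l where "t = Node v s u" "length (leaves s) = Suc k" "length (leaves u) = Suc l" "k + l = 0"
    using btree_node_cases[OF len] .
  then obtain a b where ab: "t = Node v (Leaf a) (Leaf b)"
    using btree_one_leaf[of s] btree_one_leaf[of u] by auto
  have "set (leaves t) = {1..2}" "v \<in> C"
    using assms unfolding btrees_def by (simp_all add: ab)
  moreover have "{1..2::nat} = {1, 2}"
    by auto
  ultimately have "{a, b} = {1, 2}"
    by (simp add: ab)
  then have "a = 1 \<and> b = 2 \<or> a = 2 \<and> b = 1"
    by (simp only: doubleton_eq_iff)
  then show ?thesis
    using that[OF \<open>v \<in> C\<close>] ab by blast
qed

text \<open>One child of the root is a leaf. Its label \<open>c\<close> determines \<open>u\<close>,
  and the other two labels are a cyclic pair up to order. Together with the side on which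
  \<open>c\<close> stands this leaves four planar shapes for each \<open>u\<close>.\<close>

lemma btrees_3_cases:
  assumes "t \<in> btrees C 3"
  obtains u v w a b c where "u < 3" "v \<in> C" "w \<in> C" "a = (rotation ^^ u) 1" "b = (rotation ^^ u) 2"
    "c = (rotation ^^ u) 3"
    "t \<in> {Node v (Node w (Leaf a) (Leaf b)) (Leaf c), Node v (Node w (Leaf b) (Leaf a)) (Leaf c),
          Node v (Leaf c) (Node w (Leaf a) (Leaf b)), Node v (Leaf c) (Node w (Leaf b) (Leaf a))}"
proof -
  have len: "length (leaves t) = Suc (Suc 1)"
    using length_leaves_btrees[OF assms] by simp
  obtain v s u k l where t: "t = Node v s u" "length (leaves s) = Suc k" "length (leaves u) = Suc l" "k + l = 1"
    using btree_node_cases[OF len] .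
  have ex: "\<exists>w a b. s = Node w (Leaf a) (Leaf b)" if "length (leaves s) = 2" for s :: "'a btree"
    using btree_node_cases[of s 0] that btree_one_leaf by (metis One_nat_def add_is_0 numeral_2_eq_2)
  obtain w a b c where s: "t = Node v (Node w (Leaf a) (Leaf b)) (Leaf c) \<or>
      t = Node v (Leaf c) (Node w (Leaf a) (Leaf b))"
  proof (cases "k = 0")
    case True
    with t have "length (leaves s) = 1" "length (leaves u) = 2" by auto
    then show ?thesis
      using t(1) ex btree_one_leaf that by metis
  next
    case False
    with t have "length (leaves s) = 2" "length (leaves u) = 1" by auto
    then show ?thesis
      using t(1) ex btree_one_leaf that by metis
  qed
  have "{a, b, c} = {1..3}" "distinct [a, b, c]" and vw: "v \<in> C" "w \<in> C"
    using assms s by (auto simp: btrees_def)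
  moreover have "a \<in> {a, b, c}" "b \<in> {a, b, c}" "c \<in> {a, b, c}"
    by auto
  ultimately have "a \<in> {1..3}" "b \<in> {1..3}" "c \<in> {1..3}" "distinct [a, b, c]"
    by metis+
  then have "a \<in> {1, 2, 3}" "b \<in> {1, 2, 3}" "c \<in> {1, 2, 3}" "distinct [a, b, c]"
    by auto
  then have "(a, b, c) \<in> {(1, 2, 3), (2, 3, 1), (3, 1, 2), (2, 1, 3), (3, 2, 1), (1, 3, 2)}"
    by auto
  then consider "(a, b, c) = (1, 2, 3) \<or> (b, a, c) = (1, 2, 3)" | "(a, b, c) = (2, 3, 1) \<or> (b, a, c) = (2, 3, 1)"
    | "(a, b, c) = (3, 1, 2) \<or> (b, a, c) = (3, 1, 2)"
    by auto
  then show ?thesis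
  proof cases
    case 1
    then show ?thesis using that[of 0 v w] vw s by auto
  next
    case 2
    then show ?thesis using that[of 1 v w] vw s by auto
  next
    case 3
    then show ?thesis using that[of 2 v w] vw s by auto
  qed
qed

section \<open>Classes of trees in the free operad on a representation\<close>

locale s2_rep =
  fixes V :: "('k::field, 'v) s2_module"
  assumes add_closed: "\<lbrakk>v \<in> carrier V; w \<in> carrier V\<rbrakk> \<Longrightarrow> v \<oplus>\<^bsub>V\<^esub> w \<in> carrier V"
    and smult_closed: "v \<in> carrier V \<Longrightarrow> c \<odot>\<^bsub>V\<^esub> v \<in> carrier V"
    and swap_closed: "v \<in> carrier V \<Longrightarrow> swap V v \<in> carrier V"
    and swap_add: "\<lbrakk>v \<in> carrier V; w \<in> carrier V\<rbrakk> \<Longrightarrow> swap V (v \<oplus>\<^bsub>V\<^esub> w) = swap V v \<oplus>\<^bsub>V\<^esub> swap V w"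
    and swap_smult: "v \<in> carrier V \<Longrightarrow> swap V (c \<odot>\<^bsub>V\<^esub> v) = c \<odot>\<^bsub>V\<^esub> swap V v"
    and swap_swap: "v \<in> carrier V \<Longrightarrow> swap V (swap V v) = v"

lemma btrees_2I [simp]:
  "Node v (Leaf (Suc 0)) (Leaf 2) \<in> btrees C 2 \<longleftrightarrow> v \<in> C"
  "Node v (Leaf 2) (Leaf (Suc 0)) \<in> btrees C 2 \<longleftrightarrow> v \<in> C"
  "Node v (Leaf 1) (Leaf 2) \<in> btrees C 2 \<longleftrightarrow> v \<in> C"
  "Node v (Leaf 2) (Leaf 1) \<in> btrees C 2 \<longleftrightarrow> v \<in> C"
  by (auto simp: btrees_def)

lemma vertex_relations_closed:
  fixes V :: "('k::field, 'v) s2_module"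
  assumes "s2_rep V"
  shows "vertex_relations V n \<subseteq> carrier (ops (tree_operad (carrier V)) n)"
proof -
  interpret s2_rep V by fact
  have "Poly_Mapping.keys (p - q) \<subseteq> A"
    if "Poly_Mapping.keys p \<subseteq> A" "Poly_Mapping.keys q \<subseteq> A" for p q :: "'v btree \<Rightarrow>\<^sub>0 'k" and A
    using that Poly_Mapping.keys_diff[of p q] by blast
  note diff = this
  have "Poly_Mapping.keys (scale c p) \<subseteq> A" if "Poly_Mapping.keys p \<subseteq> A" for c and p :: "'v btree \<Rightarrow>\<^sub>0 'k" and A
    by (rule order_trans[OF keys_scale that])
  note scale = this
  have corolla: "Poly_Mapping.keys (corolla_tree v :: 'v btree \<Rightarrow>\<^sub>0 'k) \<subseteq> btrees (carrier V) 2" if "v \<in> carrier V" for v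
    using that by (simp add: corolla_tree_def)
  show ?thesis
  proof
    fix p assume p: "p \<in> vertex_relations V n"
    then have "n = 2"
      unfolding vertex_relations_def by (cases "n = 2") simp_all
    moreover from p \<open>n = 2\<close> consider
      v w where "v \<in> carrier V" "w \<in> carrier V" "p = corolla_tree (v \<oplus>\<^bsub>V\<^esub> w) - corolla_tree v - corolla_tree w"
      | c v where "v \<in> carrier V" "p = corolla_tree (c \<odot>\<^bsub>V\<^esub> v) - scale c (corolla_tree v)"
      | v where "v \<in> carrier V" "p = corolla_tree (swap V v) - monomial (Node v (Leaf 2) (Leaf 1))"
      unfolding vertex_relations_def by auto
    then have "Poly_Mapping.keys p \<subseteq> btrees (carrier V) 2"
      by cases (simp_all only:, (intro diff corolla scale add_closed smult_closed swap_closed | simp)+)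
    ultimately show "p \<in> carrier (ops (tree_operad (carrier V)) n)"
      by simp
  qed
qed

sublocale s2_rep \<subseteq> tree: operad_ideal "tree_operad (carrier V)" "vertex_ideal V"
  unfolding vertex_ideal_def
  by (intro operad.operad_ideal_operadic_ideal tree_operad vertex_relations_closed s2_rep_axioms)

sublocale s2_rep \<subseteq> free: operad "free_operad V"
  unfolding free_operad_def by (rule tree.quotient_operad)

context s2_rep
begin

lemma proj_eq_tree_class: "tree.proj = tree_class V"
  by (simp add: fun_eq_iff tree.proj_def tree_class_def)

lemma class_hom: "operad_hom (tree_operad (carrier V)) (free_operad V) (tree_class V)"
  using tree.proj_hom by (simp only: proj_eq_tree_class free_operad_def)

lemma carrier_free: "carrier (ops (free_operad V) n) = tree_class V n ` {p. Poly_Mapping.keys p \<subseteq> btrees (carrier V) n}"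
  using tree.proj_surj[of n] by (simp add: proj_eq_tree_class free_operad_def)

lemma zero_free: "\<zero>\<^bsub>ops (free_operad V) n\<^esub> = vertex_ideal V n"
  by (simp add: free_operad_def tree.quotient_operad_simps)

lemma class_zero: "tree_class V n 0 = \<zero>\<^bsub>ops (free_operad V) n\<^esub>"
  using tree.proj_zero[of n] by (simp add: proj_eq_tree_class zero_free)

lemma class_closed:
  "Poly_Mapping.keys p \<subseteq> btrees (carrier V) n \<Longrightarrow> tree_class V n p \<in> carrier (ops (free_operad V) n)"
  by (auto simp: carrier_free)

lemma class_add:
  "\<lbrakk>Poly_Mapping.keys p \<subseteq> btrees (carrier V) n; Poly_Mapping.keys q \<subseteq> btrees (carrier V) n\<rbrakk>
   \<Longrightarrow> tree_class V n (p + q) = tree_class V n p \<oplus>\<^bsub>ops (free_operad V) n\<^esub> tree_class V n q"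
  using operad_homD(3)[OF class_hom, of p n q] by simp

lemma class_scale:
  "Poly_Mapping.keys p \<subseteq> btrees (carrier V) n
   \<Longrightarrow> tree_class V n (scale c p) = c \<odot>\<^bsub>ops (free_operad V) n\<^esub> tree_class V n p"
  using operad_homD(4)[OF class_hom, of p n c] by simp

lemma class_act:
  "\<lbrakk>\<sigma> permutes {1..n}; Poly_Mapping.keys p \<subseteq> btrees (carrier V) n\<rbrakk>
   \<Longrightarrow> act (free_operad V) n \<sigma> (tree_class V n p) =
       tree_class V n (lin_extend (\<lambda>t. monomial (relabel \<sigma> t)) p)"
  using operad_homD(5)[OF class_hom, of \<sigma> n p] by simp

lemma class_pcomp:
  "\<lbrakk>i \<in> {1..m}; Poly_Mapping.keys p \<subseteq> btrees (carrier V) m; Poly_Mapping.keys q \<subseteq> btrees (carrier V) n\<rbrakk>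
   \<Longrightarrow> pcomp (free_operad V) m n i (tree_class V m p) (tree_class V n q) =
       tree_class V (m + n - 1) (bilin_extend (graft i n) p q)"
  using operad_homD(6)[OF class_hom, of i m p q n] by simp

lemma class_eqI:
  assumes "Poly_Mapping.keys p \<subseteq> btrees (carrier V) n" "Poly_Mapping.keys q \<subseteq> btrees (carrier V) n"
    and "p - q \<in> vertex_relations V n"
  shows "tree_class V n p = tree_class V n q"
proof -
  have "p \<ominus>\<^bsub>ops (tree_operad (carrier V)) n\<^esub> q = p - q"
    using tree.minus_conv[of q n] assms(2)
    by (simp add: a_minus_def scale_minus_one)
  moreover have "p - q \<in> vertex_ideal V n"
    using assms(3) by (auto simp: vertex_ideal_def operadic_ideal_def intro: in_operadic_ideal.generator)
  ultimately show ?thesis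
    using assms tree.proj_eq_iff[of p n q] by (simp add: proj_eq_tree_class)
qed

lemma class_eqD:
  assumes "tree_class V n p = tree_class V n q"
    and "Poly_Mapping.keys p \<subseteq> btrees (carrier V) n" "Poly_Mapping.keys q \<subseteq> btrees (carrier V) n"
  shows "p - q \<in> vertex_ideal V n"
proof -
  have "p \<ominus>\<^bsub>ops (tree_operad (carrier V)) n\<^esub> q = p - q"
    using tree.minus_conv[of q n] assms(3)
    by (simp add: a_minus_def scale_minus_one)
  then show ?thesis
    using assms tree.proj_eq_iff[of p n q] by (simp add: proj_eq_tree_class)
qed

lemma corolla_closed: "v \<in> carrier V \<Longrightarrow> corolla V v \<in> carrier (ops (free_operad V) 2)"
  unfolding corolla_def corolla_tree_def by (intro class_closed) simp

lemma corolla_add: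
  assumes "v \<in> carrier V" "w \<in> carrier V"
  shows "corolla V (v \<oplus>\<^bsub>V\<^esub> w) = corolla V v \<oplus>\<^bsub>ops (free_operad V) 2\<^esub> corolla V w"
proof -
  have k: "Poly_Mapping.keys (corolla_tree v + corolla_tree w :: _ \<Rightarrow>\<^sub>0 'k) \<subseteq> btrees (carrier V) 2"
    using assms by (intro order_trans[OF Poly_Mapping.keys_add]) (simp add: corolla_tree_def)
  have "corolla_tree (v \<oplus>\<^bsub>V\<^esub> w) - (corolla_tree v + corolla_tree w) \<in> vertex_relations V 2"
    unfolding vertex_relations_def using assms by (auto simp: diff_diff_eq)
  then have "corolla V (v \<oplus>\<^bsub>V\<^esub> w) = tree_class V 2 (corolla_tree v + corolla_tree w)"
    unfolding corolla_def using assms k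
    by (intro class_eqI) (auto simp: corolla_tree_def add_closed)
  then show ?thesis
    using assms by (simp add: class_add corolla_def corolla_tree_def)
qed

lemma corolla_smult:
  assumes "v \<in> carrier V"
  shows "corolla V (c \<odot>\<^bsub>V\<^esub> v) = c \<odot>\<^bsub>ops (free_operad V) 2\<^esub> corolla V v"
proof -
  have k: "Poly_Mapping.keys (scale c (corolla_tree v)) \<subseteq> btrees (carrier V) 2"
    using assms by (intro order_trans[OF keys_scale]) (simp add: corolla_tree_def)
  have "corolla_tree (c \<odot>\<^bsub>V\<^esub> v) - scale c (corolla_tree v) \<in> vertex_relations V 2"
    unfolding vertex_relations_def using assms by auto
  then have "corolla V (c \<odot>\<^bsub>V\<^esub> v) = tree_class V 2 (scale c (corolla_tree v))"
    unfolding corolla_def using assms k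
    by (intro class_eqI) (auto simp: corolla_tree_def smult_closed)
  then show ?thesis
    using assms by (simp add: class_scale corolla_def corolla_tree_def)
qed

lemma corolla_swap:
  assumes "v \<in> carrier V"
  shows "corolla V (swap V v) = tree_class V 2 (monomial (Node v (Leaf 2) (Leaf 1)))"
  unfolding corolla_def using assms
  by (intro class_eqI) (auto simp: corolla_tree_def swap_closed vertex_relations_def)

text \<open>In the free operad an exchange of the two inputs of a vertex is absorbed by
  \<open>swap\<close> of its decoration. Each of the four shapes is a rotated composition at the
  first input of two binary trees, where an exchanged vertex is the tree with leaves 2 and
  1.\<close>

lemma class_ternary:
  assumes "v \<in> carrier V" "w \<in> carrier V" and a: "a = (rotation ^^ u) 1" "b = (rotation ^^ u) 2" "c = (rotation ^^ u) 3"
  shows "tree_class V 3 (monomial (Node v (Node w (Leaf a) (Leaf b)) (Leaf c))) = ternary V u v w"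
    "tree_class V 3 (monomial (Node v (Node w (Leaf b) (Leaf a)) (Leaf c))) = ternary V u v (swap V w)"
    "tree_class V 3 (monomial (Node v (Leaf c) (Node w (Leaf a) (Leaf b)))) = ternary V u (swap V v) w"
    "tree_class V 3 (monomial (Node v (Leaf c) (Node w (Leaf b) (Leaf a)))) = ternary V u (swap V v) (swap V w)"
proof -
  have r: "(rotation ^^ u) permutes {1..3}"
    by (rule rotation_pow_permutes)
  have apc: "act (free_operad V) 3 (rotation ^^ u) (pcomp (free_operad V) 2 2 1
      (tree_class V 2 (monomial s)) (tree_class V 2 (monomial t))) =
      tree_class V 3 (monomial (relabel (rotation ^^ u) (graft 1 2 s t)))"
    if "s \<in> btrees (carrier V) 2" "t \<in> btrees (carrier V) 2" for s t
    using class_pcomp[of 1 2 "monomial s" "monomial t" 2] that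
      class_act[OF r, of "monomial (graft 1 2 s t)"] graft_btrees[OF _ that, of 1] by simp
  show "tree_class V 3 (monomial (Node v (Node w (Leaf a) (Leaf b)) (Leaf c))) = ternary V u v w"
    "tree_class V 3 (monomial (Node v (Node w (Leaf b) (Leaf a)) (Leaf c))) = ternary V u v (swap V w)"
    "tree_class V 3 (monomial (Node v (Leaf c) (Node w (Leaf a) (Leaf b)))) = ternary V u (swap V v) w"
    "tree_class V 3 (monomial (Node v (Leaf c) (Node w (Leaf b) (Leaf a)))) = ternary V u (swap V v) (swap V w)"
    using assms by (simp_all add: ternary_def corolla_swap)
      (simp_all add: corolla_def corolla_tree_def apc outer_def inner_def flip: One_nat_def)
qed

lemma ternary_closed:
  "\<lbrakk>v \<in> carrier V; w \<in> carrier V\<rbrakk> \<Longrightarrow> ternary V u v w \<in> carrier (ops (free_operad V) 3)"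
  unfolding ternary_def
  using free.pcomp_closed[of 1 2 "corolla V v" "corolla V w" 2] free.act_closed[OF rotation_pow_permutes]
  by (simp add: corolla_closed)

lemma ternary_linear_left:
  assumes "w \<in> carrier V"
  shows "\<lbrakk>v \<in> carrier V; v' \<in> carrier V\<rbrakk>
      \<Longrightarrow> ternary V u (v \<oplus>\<^bsub>V\<^esub> v') w = ternary V u v w \<oplus>\<^bsub>ops (free_operad V) 3\<^esub> ternary V u v' w"
    and "v \<in> carrier V \<Longrightarrow> ternary V u (c \<odot>\<^bsub>V\<^esub> v) w = c \<odot>\<^bsub>ops (free_operad V) 3\<^esub> ternary V u v w"
  using linear_mapsD(2,3)[OF free.pcomp_linear_left[of 1 2 "corolla V w" 2]]
    linear_mapsD(2,3)[OF free.act_linear[OF rotation_pow_permutes, of u]]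
    free.pcomp_closed[of 1 2 _ "corolla V w" 2] assms
  by (simp_all add: ternary_def corolla_add corolla_smult corolla_closed)

lemma ternary_linear_right:
  assumes "v \<in> carrier V"
  shows "\<lbrakk>w \<in> carrier V; w' \<in> carrier V\<rbrakk>
      \<Longrightarrow> ternary V u v (w \<oplus>\<^bsub>V\<^esub> w') = ternary V u v w \<oplus>\<^bsub>ops (free_operad V) 3\<^esub> ternary V u v w'"
    and "w \<in> carrier V \<Longrightarrow> ternary V u v (c \<odot>\<^bsub>V\<^esub> w) = c \<odot>\<^bsub>ops (free_operad V) 3\<^esub> ternary V u v w"
  using linear_mapsD(2,3)[OF free.pcomp_linear_right[of 1 2 "corolla V v" 2]]
    linear_mapsD(2,3)[OF free.act_linear[OF rotation_pow_permutes, of u]]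
    free.pcomp_closed[of 1 2 "corolla V v" _ 2] assms
  by (simp_all add: ternary_def corolla_add corolla_smult corolla_closed)

text \<open>Spanning in the form of an induction rule: each tree with three leaves has the class of
  a single \<open>ternary\<close> element, and a polynomial is the sum of its scaled
  monomials.\<close>

lemma ternary_spanning:
  assumes x: "x \<in> carrier (ops (free_operad V) 3)"
    and zero: "Q \<zero>\<^bsub>ops (free_operad V) 3\<^esub>"
    and add: "\<And>x y. \<lbrakk>x \<in> carrier (ops (free_operad V) 3); y \<in> carrier (ops (free_operad V) 3); Q x; Q y\<rbrakk>
      \<Longrightarrow> Q (x \<oplus>\<^bsub>ops (free_operad V) 3\<^esub> y)"
    and smult: "\<And>c x. \<lbrakk>x \<in> carrier (ops (free_operad V) 3); Q x\<rbrakk> \<Longrightarrow> Q (c \<odot>\<^bsub>ops (free_operad V) 3\<^esub> x)"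
    and ternary: "\<And>u v w. \<lbrakk>u < 3; v \<in> carrier V; w \<in> carrier V\<rbrakk> \<Longrightarrow> Q (ternary V u v w)"
  shows "Q x"
proof -
  obtain p where p: "Poly_Mapping.keys p \<subseteq> btrees (carrier V) 3" "x = tree_class V 3 p"
    using x by (auto simp: carrier_free)
  have mon: "Q (tree_class V 3 (monomial t))" if "t \<in> btrees (carrier V) 3" for t
    using that
  proof (cases rule: btrees_3_cases)
    case (1 u v w a b c)
    then show ?thesis
      using class_ternary[OF 1(2-6)] by (auto simp: ternary swap_closed)
  qed
  define S where "S = Poly_Mapping.keys p"
  define h where "h = Poly_Mapping.lookup p"
  have "finite S" "S \<subseteq> btrees (carrier V) 3"
    using p by (auto simp: S_def)
  then have "Poly_Mapping.keys (\<Sum>t\<in>S. scale (h t) (monomial t)) \<subseteq> btrees (carrier V) 3 \<and>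
    Q (tree_class V 3 (\<Sum>t\<in>S. scale (h t) (monomial t)))"
  proof (induction S)
    case empty
    then show ?case using zero by (simp add: class_zero)
  next
    case (insert t S)
    let ?r = "\<Sum>t\<in>S. scale (h t) (monomial t)"
    have t: "Poly_Mapping.keys (scale (h t) (monomial t)) \<subseteq> btrees (carrier V) 3"
      using insert.prems by (intro order_trans[OF keys_scale]) simp
    have "Q (tree_class V 3 (scale (h t) (monomial t)))"
      using insert.prems by (simp add: class_scale smult mon class_closed)
    moreover have "Poly_Mapping.keys (scale (h t) (monomial t) + ?r) \<subseteq> btrees (carrier V) 3"
      using insert t by (intro order_trans[OF Poly_Mapping.keys_add]) simp
    ultimately show ?case
      using insert t by (simp add: class_add add class_closed)
  qed
  moreover have "(\<Sum>t\<in>S. scale (h t) (monomial t)) = p"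
    using lin_extend_monomial_id[of p] by (simp add: lin_extend_def S_def h_def)
  ultimately show ?thesis
    using p by simp
qed

text \<open>When the inner operation is symmetric, a permutation of the inputs only permutes the
  three bracketings. The conclusion lists the six possible permutations \<open>q\<close>, so that
  later arguments can go through them explicitly.\<close>

lemma act_ternary:
  assumes "\<sigma> permutes {1..3}" "v \<in> carrier V" "w \<in> carrier V" "swap V w = w"
  obtains q :: "nat \<Rightarrow> nat" where "(q 0, q 1, q 2) \<in> {(0, 1, 2), (1, 2, 0), (2, 0, 1), (0, 2, 1), (1, 0, 2), (2, 1, 0)}"
    "\<And>u. u < 3 \<Longrightarrow> act (free_operad V) 3 \<sigma> (ternary V u v w) = ternary V (q u) v w"
proof
  \<comment> \<open>The bracketing \<open>u\<close> has at the root the label that is congruent to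
    \<open>u\<close> modulo 3, with label 3 for \<open>u = 0\<close>. The image under \<sigma> of
    this label is the new label at the root.\<close>
  define q where "q u = \<sigma> (if u = 0 then 3 else u) mod 3" for u
  show "(q 0, q 1, q 2) \<in> {(0, 1, 2), (1, 2, 0), (2, 0, 1), (0, 2, 1), (1, 0, 2), (2, 1, 0)}"
    by (rule permutes_3_cases[OF assms(1)]) (simp_all add: q_def)
  have c: "tree_class V 3 (monomial (Node v (Node w (Leaf a) (Leaf b)) (Leaf c))) = ternary V u v w \<and>
    tree_class V 3 (monomial (Node v (Node w (Leaf b) (Leaf a)) (Leaf c))) = ternary V u v w"
    if "a = (rotation ^^ u) 1" "b = (rotation ^^ u) 2" "c = (rotation ^^ u) 3" for a b c u
    using class_ternary(1,2)[OF assms(2,3) that] assms(4) by simp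
  have c0: "tree_class V 3 (monomial (Node v (Node w (Leaf 1) (Leaf 2)) (Leaf 3))) = ternary V 0 v w"
    "tree_class V 3 (monomial (Node v (Node w (Leaf 2) (Leaf 1)) (Leaf 3))) = ternary V 0 v w"
    "tree_class V 3 (monomial (Node v (Node w (Leaf 2) (Leaf 3)) (Leaf 1))) = ternary V 1 v w"
    "tree_class V 3 (monomial (Node v (Node w (Leaf 3) (Leaf 2)) (Leaf 1))) = ternary V 1 v w"
    "tree_class V 3 (monomial (Node v (Node w (Leaf 3) (Leaf 1)) (Leaf 2))) = ternary V 2 v w"
    "tree_class V 3 (monomial (Node v (Node w (Leaf 1) (Leaf 3)) (Leaf 2))) = ternary V 2 v w"
    using c[of 1 0 2 3] c[of 2 1 3 1] c[of 3 2 1 2] by simp_all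
  fix u :: nat assume "u < 3"
  have "act (free_operad V) 3 \<sigma> (tree_class V 3 (monomial (Node v (Node w (Leaf a) (Leaf b)) (Leaf c)))) =
    tree_class V 3 (monomial (Node v (Node w (Leaf (\<sigma> a)) (Leaf (\<sigma> b))) (Leaf (\<sigma> c))))"
    if "{a, b, c} = {1..3}" "distinct [a, b, c]" for a b c
    using class_act[OF assms(1), of "monomial (Node v (Node w (Leaf a) (Leaf b)) (Leaf c))"] that assms(2,3)
    by (auto simp: btrees_def)
  note act = this[of 1 2 3] this[of 2 3 1] this[of 3 1 2]
  have "{1..3} = {1, 2, 3::nat}" by auto
  then have act': "act (free_operad V) 3 \<sigma> (ternary V 0 v w) = tree_class V 3 (monomial (Node v (Node w (Leaf (\<sigma> 1)) (Leaf (\<sigma> 2))) (Leaf (\<sigma> 3))))"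
    "act (free_operad V) 3 \<sigma> (ternary V 1 v w) = tree_class V 3 (monomial (Node v (Node w (Leaf (\<sigma> 2)) (Leaf (\<sigma> 3))) (Leaf (\<sigma> 1))))"
    "act (free_operad V) 3 \<sigma> (ternary V 2 v w) = tree_class V 3 (monomial (Node v (Node w (Leaf (\<sigma> 3)) (Leaf (\<sigma> 1))) (Leaf (\<sigma> 2))))"
    using act c0 by (auto simp: insert_commute)
  show "act (free_operad V) 3 \<sigma> (ternary V u v w) = ternary V (q u) v w"
    using \<open>u < 3\<close>[unfolded less_3_cases]
    by (elim disjE; cases rule: permutes_3_cases[OF assms(1)]) (simp_all add: act' q_def c0 del: One_nat_def)
qed

end

section \<open>The standard pairing\<close>

fun binary_form :: "('k::field, 'v) s2_module \<Rightarrow> ('v \<Rightarrow> 'k) \<Rightarrow> 'v btree \<Rightarrow> 'k" where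
  "binary_form V \<alpha> (Node v (Leaf a) (Leaf b)) = \<alpha> (if a = 1 then v else swap V v)"
| "binary_form V \<alpha> _ = 0"

text \<open>
  The triple \<open>(u, v, w)\<close> for which the tree is the operation \<open>ternary V u v w\<close>. The residue of the
  label of the leaf at the root vertex is \<open>u\<close>, and the cyclic order of the other two labels
  decides about the swap of \<open>w\<close>.
\<close>

fun normal_form :: "('k::field, 'v) s2_module \<Rightarrow> 'v btree \<Rightarrow> nat \<times> 'v \<times> 'v" where
  "normal_form V (Node v (Node w (Leaf a) (Leaf b)) (Leaf c)) =
    (c mod 3, v, if b mod 3 = Suc a mod 3 then w else swap V w)"
| "normal_form V (Node v (Leaf c) (Node w (Leaf a) (Leaf b))) =
    (c mod 3, swap V v, if b mod 3 = Suc a mod 3 then w else swap V w)"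
| "normal_form V _ = undefined"

text \<open>For linear forms \<alpha> and \<beta> this is the functional \<alpha> \<otimes> \<beta>
  on the summand \<open>u\<close> of the three copies of V \<otimes> V, lifted to trees before it is
  known to respect classes.\<close>

definition ternary_form ::
    "('k::field, 'v) s2_module \<Rightarrow> nat \<Rightarrow> ('v \<Rightarrow> 'k) \<Rightarrow> ('v \<Rightarrow> 'k) \<Rightarrow> 'v btree \<Rightarrow> 'k" where
  "ternary_form V u \<alpha> \<beta> t = (case normal_form V t of (u', v, w) \<Rightarrow> if u' = u then \<alpha> v * \<beta> w else 0)"

lemma linear_formsD:
  assumes "\<alpha> \<in> linear_forms M"
  shows "\<lbrakk>x \<in> carrier M; y \<in> carrier M\<rbrakk> \<Longrightarrow> \<alpha> (x \<oplus>\<^bsub>M\<^esub> y) = \<alpha> x + \<alpha> y"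
    and "x \<in> carrier M \<Longrightarrow> \<alpha> (c \<odot>\<^bsub>M\<^esub> x) = c * \<alpha> x"
  using assms by (auto simp: linear_forms_def)

lemma lin_form_bilin_extend:
  "lin_form f (bilin_extend g p q) = lin_form (\<lambda>s. lin_form (\<lambda>t. f (g s t)) q) p"
  by (simp add: bilin_extend_def lin_form_lin_extend)

lemma tree_operad_arity_0: "Poly_Mapping.keys p \<subseteq> btrees C 0 \<Longrightarrow> p = 0"
  using btrees_arity_pos[of _ C 0] by fastforce

lemma tree_operad_arity_1:
  assumes "Poly_Mapping.keys p \<subseteq> btrees C 1"
  shows "p = scale (Poly_Mapping.lookup p (Leaf 1)) (monomial (Leaf 1))"
proof (rule poly_mapping_eqI)
  fix t
  show "Poly_Mapping.lookup p t = Poly_Mapping.lookup (scale (Poly_Mapping.lookup p (Leaf 1)) (monomial (Leaf 1))) t"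
    using assms btrees_1[of t C]
    by (cases "t = Leaf 1") (auto simp: monomial_def lookup_single in_keys_iff when_def subset_iff)
qed

context s2_rep
begin

lemma linear_forms_swap: "\<alpha> \<in> linear_forms V \<Longrightarrow> (\<lambda>v. \<alpha> (swap V v)) \<in> linear_forms V"
  by (auto simp: linear_forms_def swap_add swap_smult swap_closed)

lemma binary_form_relabel:
  assumes "\<sigma> permutes {1..2}" "\<alpha> \<in> linear_forms V"
  obtains \<alpha>' where "\<alpha>' \<in> linear_forms V"
    "\<forall>t\<in>btrees (carrier V) 2. binary_form V \<alpha> (relabel \<sigma> t) = binary_form V \<alpha>' t"
proof -
  have "\<sigma> 1 \<in> {1..2}" "\<sigma> 2 \<in> {1..2}" "\<sigma> 1 \<noteq> \<sigma> 2"
    using permutes_in_image[OF assms(1)] permutes_inj[OF assms(1)] by (auto simp: inj_eq)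
  then consider "\<sigma> 1 = 1" "\<sigma> 2 = 2" | "\<sigma> 1 = 2" "\<sigma> 2 = 1"
    by force
  then show ?thesis
  proof cases
    case 1
    show ?thesis
      by (rule that[OF assms(2)]) (use 1 in \<open>auto elim!: btrees_2_cases\<close>)
  next
    case 2
    show ?thesis
      by (rule that[OF linear_forms_swap[OF assms(2)]])
        (use 2 in \<open>auto elim!: btrees_2_cases simp: swap_swap\<close>)
  qed
qed

text \<open>The condition on \<sigma> 1 and \<sigma> 2 recognises the even permutations. They
  preserve the cyclic order of the labels and only move the summand; an odd permutation also
  reverses the inner pair. For \<open>u\<close> outside the range, all forms involved vanish on
  trees.\<close>

lemma ternary_form_relabel:
  assumes "\<sigma> permutes {1..3}"
  obtains u' where
    "\<forall>t\<in>btrees (carrier V) 3. ternary_form V u \<alpha> \<beta> (relabel \<sigma> t) =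
      ternary_form V u' \<alpha> (if \<sigma> 2 mod 3 = Suc (\<sigma> 1) mod 3 then \<beta> else (\<lambda>v. \<beta> (swap V v))) t"
    "u' < 3 \<or> 3 \<le> u"
proof (cases "u < 3")
  case True
  define \<beta>' where "\<beta>' = (if \<sigma> 2 mod 3 = Suc (\<sigma> 1) mod 3 then \<beta> else (\<lambda>v. \<beta> (swap V v)))"
  \<comment> \<open>After relabelling, a tree contributes to the summand \<open>u\<close> exactly
    when its leaf at the root was \<open>j\<close>.\<close>
  have "\<exists>j\<in>{1, 2, 3}. \<sigma> j mod 3 = u"
    by (rule permutes_3_cases[OF assms]; use True in \<open>simp add: less_3_cases; linarith\<close>)
  then obtain j where j: "j \<in> {1, 2, 3}" "\<sigma> j mod 3 = u"
    by blast
  have "ternary_form V u \<alpha> \<beta> (relabel \<sigma> t) = ternary_form V (j mod 3) \<alpha> \<beta>' t"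
    if "t \<in> btrees (carrier V) 3" for t
    using that
  proof (cases rule: btrees_3_cases)
    case (1 r v w a b c)
    from 1(1) have r: "r = 0 \<or> r = 1 \<or> r = 2"
      by (simp add: less_3_cases)
    from r j(1) show ?thesis
      using 1(7) unfolding 1(4-6) j(2)[symmetric] \<beta>'_def
      by (elim disjE insertE emptyE; cases rule: permutes_3_cases[OF assms])
        (simp_all add: ternary_form_def swap_swap 1(2,3) swap_closed)
  qed
  then show ?thesis
    using that[of "j mod 3"] by (simp add: \<beta>'_def)
next
  case False
  have "ternary_form V u \<alpha> \<beta> (relabel \<sigma> t) = 0 \<and> ternary_form V u \<alpha> \<beta>' t = 0"
    if "t \<in> btrees (carrier V) 3" for t \<beta>'
    using that
  proof (cases rule: btrees_3_cases)
    case (1 r v w a b c)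
    have "x mod 3 \<noteq> u" for x
      using False mod_less_divisor[of 3 x] by linarith
    then show ?thesis
      using 1(7) by (auto simp: ternary_form_def)
  qed
  then show ?thesis
    using that[of u] False by simp
qed

text \<open>Grafting at input 1 leaves the label 3 at the root and grafting at input 2 leaves the
  label 1, which accounts for the shift in \<open>Suc u = i\<close>. At input 2 the inner operation
  is the second argument of the root, which costs a swap there. The product form is what makes
  coordinates of compositions factor.\<close>

lemma ternary_form_graft:
  assumes "t \<in> btrees (carrier V) 2" "s \<in> btrees (carrier V) 2" "i \<in> {1..2}"
  shows "ternary_form V u \<alpha> \<beta> (graft i 2 t s) =
    (if Suc u = i then 1 else 0) * (binary_form V (if i = 1 then \<alpha> else (\<lambda>v. \<alpha> (swap V v))) t * binary_form V \<beta> s)"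
proof -
  have "i = 1 \<or> i = 2"
    using assms(3) by auto
  with assms(1,2) show ?thesis
    by (elim btrees_2_cases disjE)
      (simp_all add: ternary_form_def outer_def inner_def swap_swap swap_closed)
qed

text \<open>The arities up to three are treated together so that the induction closes. Elements of
  arity at most one must be zero, as they could otherwise be composed with arbitrary elements into
  arity three; the binary forms are needed for compositions of two binary elements.\<close>

lemma linear_forms_vanish:
  assumes "in_operadic_ideal (tree_operad (carrier V)) (vertex_relations V) n p"
  shows "Poly_Mapping.keys p \<subseteq> btrees (carrier V) n \<and> (n \<le> 1 \<longrightarrow> p = 0) \<and>
    (n = 2 \<longrightarrow> (\<forall>\<alpha>\<in>linear_forms V. lin_form (binary_form V \<alpha>) p = 0)) \<and>
    (n = 3 \<longrightarrow> (\<forall>u. \<forall>\<alpha>\<in>linear_forms V. \<forall>\<beta>\<in>linear_forms V. lin_form (ternary_form V u \<alpha> \<beta>) p = 0))"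
  using assms
proof induction
  case (generator x n)
  then have "n = 2"
    by (simp add: vertex_relations_def split: if_splits)
  moreover from this have "Poly_Mapping.keys x \<subseteq> btrees (carrier V) 2"
    using subsetD[OF vertex_relations_closed[OF s2_rep_axioms] generator] by simp
  moreover have "lin_form (binary_form V \<alpha>) x = 0" if "\<alpha> \<in> linear_forms V" for \<alpha>
    using generator \<open>n = 2\<close> linear_formsD[OF that]
    by (auto simp: vertex_relations_def corolla_tree_def lin_form_diff lin_form_scale)
  ultimately show ?case
    by simp
next
  case (zero n)
  then show ?case by simp
next
  case (add n x y)
  then show ?case
    using Poly_Mapping.keys_add[of x y] by (auto simp: lin_form_add)
next
  case (smult n x c)
  then show ?case
    using keys_scale[of c x] by (auto simp: lin_form_scale)
next
  case (act n x \<sigma>)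
  have 2: "lin_form (\<lambda>t. binary_form V \<alpha> (relabel \<sigma> t)) x = 0"
    if "n = 2" and \<alpha>: "\<alpha> \<in> linear_forms V" for \<alpha>
  proof -
    have \<sigma>: "\<sigma> permutes {1..2}"
      using act.hyps that by simp
    obtain \<alpha>' where a: "\<alpha>' \<in> linear_forms V"
      "\<forall>t\<in>btrees (carrier V) 2. binary_form V \<alpha> (relabel \<sigma> t) = binary_form V \<alpha>' t"
      using binary_form_relabel[OF \<sigma> \<alpha>] .
    then have "lin_form (\<lambda>t. binary_form V \<alpha> (relabel \<sigma> t)) x = lin_form (binary_form V \<alpha>') x"
      using act.IH that by (intro lin_form_cong) blast
    then show ?thesis
      using act.IH that a by simp
  qed
  have 3: "lin_form (\<lambda>t. ternary_form V u \<alpha> \<beta> (relabel \<sigma> t)) x = 0"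
    if "n = 3" "\<alpha> \<in> linear_forms V" "\<beta> \<in> linear_forms V" for u \<alpha> \<beta>
  proof -
    have \<sigma>: "\<sigma> permutes {1..3}"
      using act.hyps that by simp
    define \<beta>' where "\<beta>' = (if \<sigma> 2 mod 3 = Suc (\<sigma> 1) mod 3 then \<beta> else (\<lambda>v. \<beta> (swap V v)))"
    have \<beta>': "\<beta>' \<in> linear_forms V"
      using that linear_forms_swap by (simp add: \<beta>'_def)
    obtain u' where a: "\<forall>t\<in>btrees (carrier V) 3.
        ternary_form V u \<alpha> \<beta> (relabel \<sigma> t) = ternary_form V u' \<alpha> \<beta>' t"
      using ternary_form_relabel[OF \<sigma>, of u \<alpha> \<beta>] unfolding \<beta>'_def .
    then have "lin_form (\<lambda>t. ternary_form V u \<alpha> \<beta> (relabel \<sigma> t)) x = lin_form (ternary_form V u' \<alpha> \<beta>') x"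
      using act.IH that by (intro lin_form_cong) blast
    then show ?thesis
      using act.IH that \<beta>' by simp
  qed
  show ?case
    using 2 3 act.IH relabel_closed[OF act.hyps(2), of x "carrier V"] by (auto simp: lin_form_lin_extend)
next
  case (pcomp_left m x y n i)
  have closed: "Poly_Mapping.keys (bilin_extend (graft i n) x y) \<subseteq> btrees (carrier V) (m + n - 1)"
    using pcomp_left by (intro bilin_extend_closed) simp_all
  \<comment> \<open>If the composition has arity at most three, then one factor has arity at most
    one or both factors are binary. Arity zero contains no trees, and arity one contains only
    multiples of the identity.\<close>
  consider "m \<le> 1" | "n = 0" | "n = 1" | "m = 2" "n = 2" | "m + n - 1 > 3"
    by linarith
  then show ?case
  proof cases
    case 1
    then show ?thesis using pcomp_left.IH by simp
  next
    case 2
    then have "y = 0"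
      using pcomp_left.hyps tree_operad_arity_0 by simp
    then show ?thesis by simp
  next
    case 3
    then obtain c where y: "y = scale c (monomial (Leaf 1))"
      using pcomp_left.hyps tree_operad_arity_1[of y "carrier V"] by auto
    have "pcomp (tree_operad (carrier V)) m n i x y = scale c x"
      unfolding y using pcomp_left tree.idop_right[of i m x] 3 by (simp add: bilin_extend_scale_right)
    then show ?thesis
      using pcomp_left.IH closed 3 by (simp add: lin_form_scale)
  next
    case 4
    have "lin_form (ternary_form V u \<alpha> \<beta>) (bilin_extend (graft i 2) x y) = 0"
      if "\<alpha> \<in> linear_forms V" "\<beta> \<in> linear_forms V" for u \<alpha> \<beta>
    proof -
      define \<alpha>' where "\<alpha>' = (if i = 1 then \<alpha> else (\<lambda>v. \<alpha> (swap V v)))"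
      have \<alpha>': "\<alpha>' \<in> linear_forms V"
        using that linear_forms_swap by (simp add: \<alpha>'_def)
      define K :: 'k where "K = (if Suc u = i then 1 else 0)"
      have "lin_form (ternary_form V u \<alpha> \<beta>) (bilin_extend (graft i 2) x y) =
        lin_form (\<lambda>s. lin_form (\<lambda>t. K * (binary_form V \<alpha>' s * binary_form V \<beta> t)) y) x"
        unfolding lin_form_bilin_extend K_def \<alpha>'_def using pcomp_left 4
        by (intro lin_form_cong ternary_form_graft) auto
      \<comment> \<open>The coordinate of the composition is a product of binary coordinates, and
        the factor of the ideal element \<open>x\<close> is zero by induction.\<close>
      also have "\<dots> = K * (lin_form (binary_form V \<beta>) y * lin_form (binary_form V \<alpha>') x)"
        by (simp only: lin_form_mult_left mult.commute[of _ "lin_form (binary_form V \<beta>) y"])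
      finally show ?thesis
        using pcomp_left.IH 4 \<alpha>' by simp
    qed
    then show ?thesis
      using closed 4 by simp
  next
    case 5
    then show ?thesis
      using closed by simp
  qed
next
  case (pcomp_right x m n y i)
  have closed: "Poly_Mapping.keys (bilin_extend (graft i n) x y) \<subseteq> btrees (carrier V) (m + n - 1)"
    using pcomp_right by (intro bilin_extend_closed) simp_all
  consider "n \<le> 1" | "m = 0" | "m = 1" | "m = 2" "n = 2" | "m + n - 1 > 3"
    by linarith
  then show ?case
  proof cases
    case 1
    then show ?thesis using pcomp_right.IH by simp
  next
    case 2
    then show ?thesis using pcomp_right.hyps by simp
  next
    case 3
    then obtain c where x: "x = scale c (monomial (Leaf 1))"
      using pcomp_right.hyps tree_operad_arity_1[of x "carrier V"] by auto
    have "pcomp (tree_operad (carrier V)) m n i x y = scale c y"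
      unfolding x using pcomp_right tree.idop_left[of y n] 3 by (simp add: bilin_extend_scale_left)
    moreover have "m + n - 1 = n"
      using 3 by simp
    ultimately show ?thesis
      using pcomp_right.IH order_trans[OF keys_scale[of c y]] by (simp only: lin_form_scale) simp
  next
    case 4
    have "lin_form (ternary_form V u \<alpha> \<beta>) (bilin_extend (graft i 2) x y) = 0"
      if "\<alpha> \<in> linear_forms V" "\<beta> \<in> linear_forms V" for u \<alpha> \<beta>
    proof -
      define \<alpha>' where "\<alpha>' = (if i = 1 then \<alpha> else (\<lambda>v. \<alpha> (swap V v)))"
      define K :: 'k where "K = (if Suc u = i then 1 else 0)"
      have "lin_form (ternary_form V u \<alpha> \<beta>) (bilin_extend (graft i 2) x y) =
        lin_form (\<lambda>s. lin_form (\<lambda>t. K * (binary_form V \<alpha>' s * binary_form V \<beta> t)) y) x"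
        unfolding lin_form_bilin_extend K_def \<alpha>'_def using pcomp_right 4
        by (intro lin_form_cong ternary_form_graft) auto
      \<comment> \<open>In this case the factor of the grafted element \<open>y\<close> is the one
        that vanishes.\<close>
      also have "\<dots> = K * (lin_form (binary_form V \<beta>) y * lin_form (binary_form V \<alpha>') x)"
        by (simp only: lin_form_mult_left mult.commute[of _ "lin_form (binary_form V \<beta>) y"])
      finally show ?thesis
        using pcomp_right.IH 4 that by simp
    qed
    then show ?thesis
      using closed 4 by simp
  next
    case 5
    then show ?thesis
      using closed by simp
  qed
qed

lemma ternary_form_class_cong:
  assumes "tree_class V 3 p = tree_class V 3 q"
    and "Poly_Mapping.keys p \<subseteq> btrees (carrier V) 3" "Poly_Mapping.keys q \<subseteq> btrees (carrier V) 3"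
    and "\<alpha> \<in> linear_forms V" "\<beta> \<in> linear_forms V"
  shows "lin_form (ternary_form V u \<alpha> \<beta>) p = lin_form (ternary_form V u \<alpha> \<beta>) q"
  using linear_forms_vanish[of 3 "p - q"] class_eqD[OF assms(1-3)] assms(4,5)
  by (auto simp: vertex_ideal_def operadic_ideal_def lin_form_diff)

lemma normal_form_closed:
  assumes "t \<in> btrees (carrier V) 3"
  obtains u v w where "normal_form V t = (u, v, w)" "u < 3" "v \<in> carrier V" "w \<in> carrier V"
  using assms
proof (cases rule: btrees_3_cases)
  case (1 u v w a b c)
  \<comment> \<open>The conditional witness picks whichever of \<open>v\<close> and
    \<open>swap V v\<close> the normal form has as its root decoration, so that one instantiation
    serves all four shapes.\<close>
  then show ?thesis
    using that[of "c mod 3" "if normal_form V t = (c mod 3, v, snd (snd (normal_form V t))) then v else swap V v" "snd (snd (normal_form V t))"]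
    by (auto simp: swap_closed)
qed

section \<open>Construction of the pairing\<close>

lemma normal_form_ternary_tree:
  assumes "u < 3"
  shows "normal_form V (Node v (Node w (Leaf ((rotation ^^ u) 1)) (Leaf ((rotation ^^ u) 2)))
    (Leaf ((rotation ^^ u) 3))) = (u, v, w)"
  using assms[unfolded less_3_cases] by (elim disjE) simp_all

lemma ternary_tree_closed:
  assumes "v \<in> carrier V" "w \<in> carrier V"
  shows "Node v (Node w (Leaf ((rotation ^^ u) 1)) (Leaf ((rotation ^^ u) 2)))
    (Leaf ((rotation ^^ u) 3)) \<in> btrees (carrier V) 3"
proof -
  have "{1..3} = {1, 2, 3::nat}"
    by auto
  then have "Node v (Node w (Leaf 1) (Leaf 2)) (Leaf 3) \<in> btrees (carrier V) 3"
    using assms by (auto simp: btrees_def)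
  from relabel_btrees[OF rotation_pow_permutes this, of u] show ?thesis
    by simp
qed

lemma s2_rep_sign_dual: "s2_rep (sign_dual V)"
  by unfold_locales
    (auto simp: sign_dual_def linear_forms_def fun_eq_iff restrict_def extensional_def
      add_closed smult_closed swap_closed swap_add swap_smult swap_swap algebra_simps)

lemma sign_dual_simps:
  "\<alpha> \<in> carrier (sign_dual V) \<Longrightarrow> \<alpha> \<in> linear_forms V"
  "v \<in> carrier V \<Longrightarrow> (\<alpha> \<oplus>\<^bsub>sign_dual V\<^esub> \<beta>) v = \<alpha> v + \<beta> v"
  "v \<in> carrier V \<Longrightarrow> (c \<odot>\<^bsub>sign_dual V\<^esub> \<alpha>) v = c * \<alpha> v"
  by (auto simp: sign_dual_def)

lemma evaluation_linear_form: "v \<in> carrier V \<Longrightarrow> (\<lambda>\<alpha>. \<alpha> v) \<in> linear_forms (sign_dual V)"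
  by (auto simp: linear_forms_def sign_dual_simps)

text \<open>As the pairing is a choice, one form with the required values has to be exhibited. On
  trees it compares normal forms. With either tree fixed it is a \<open>ternary_form\<close> in the
  other one, on the dual side with evaluations as linear forms, and hence depends only on classes in
  each variable.\<close>

lemma standard_pairing: "is_standard_pairing V (standard_pairing V)"
proof -
  interpret dual: s2_rep "sign_dual V"
    by (rule s2_rep_sign_dual)
  let ?W = "sign_dual V"
  define pair where "pair s t = (case normal_form ?W s of (u, \<alpha>, \<beta>) \<Rightarrow> ternary_form V u \<alpha> \<beta> t)" for s t
  define pairing where "pairing p q = lin_form (\<lambda>s. lin_form (pair s) q) p" for p q
  have pair_left: "pair s t = (case normal_form V t of (u, v, w) \<Rightarrow> ternary_form ?W u (\<lambda>\<alpha>. \<alpha> v) (\<lambda>\<beta>. \<beta> w) s)" for s t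
    by (auto simp: pair_def ternary_form_def split: prod.splits)
  have right: "lin_form (pair s) q = lin_form (pair s) q'"
    if s: "s \<in> btrees (carrier ?W) 3" and "tree_class V 3 q = tree_class V 3 q'"
      "Poly_Mapping.keys q \<subseteq> btrees (carrier V) 3" "Poly_Mapping.keys q' \<subseteq> btrees (carrier V) 3" for s q q'
  proof -
    obtain u \<alpha> \<beta> where "normal_form ?W s = (u, \<alpha>, \<beta>)" "\<alpha> \<in> carrier ?W" "\<beta> \<in> carrier ?W"
      using dual.normal_form_closed[OF s] .
    moreover from this have "pair s = ternary_form V u \<alpha> \<beta>"
      by (simp add: pair_def fun_eq_iff)
    ultimately show ?thesis
      using ternary_form_class_cong[OF that(2-4)] sign_dual_simps(1) by simp
  qed
  have left: "lin_form (\<lambda>s. pair s t) p = lin_form (\<lambda>s. pair s t) p'"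
    if t: "t \<in> btrees (carrier V) 3" and "tree_class ?W 3 p = tree_class ?W 3 p'"
      "Poly_Mapping.keys p \<subseteq> btrees (carrier ?W) 3" "Poly_Mapping.keys p' \<subseteq> btrees (carrier ?W) 3" for t p p'
  proof -
    obtain u v w where "normal_form V t = (u, v, w)" "v \<in> carrier V" "w \<in> carrier V"
      using normal_form_closed[OF t] .
    moreover from this have "(\<lambda>s. pair s t) = ternary_form ?W u (\<lambda>\<alpha>. \<alpha> v) (\<lambda>\<beta>. \<beta> w)"
      by (simp add: pair_left fun_eq_iff)
    ultimately show ?thesis
      using dual.ternary_form_class_cong[OF that(2-4)] evaluation_linear_form by simp
  qed
  \<comment> \<open>One argument is changed at a time. The two sums are exchanged in between,
    because each change compares the sums termwise over the support of the other argument.\<close>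
  have well_defined: "pairing p q = pairing p' q'"
    if "tree_class ?W 3 p = tree_class ?W 3 p'" "tree_class V 3 q = tree_class V 3 q'"
      "Poly_Mapping.keys p \<subseteq> btrees (carrier ?W) 3" "Poly_Mapping.keys p' \<subseteq> btrees (carrier ?W) 3"
      "Poly_Mapping.keys q \<subseteq> btrees (carrier V) 3" "Poly_Mapping.keys q' \<subseteq> btrees (carrier V) 3" for p p' q q'
  proof -
    have "pairing p q = pairing p q'"
      unfolding pairing_def using that by (intro lin_form_cong right) auto
    also have "\<dots> = lin_form (\<lambda>t. lin_form (\<lambda>s. pair s t) p) q'"
      unfolding pairing_def by (rule lin_form_swap)
    also have "\<dots> = lin_form (\<lambda>t. lin_form (\<lambda>s. pair s t) p') q'"
      using that by (intro lin_form_cong left) auto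
    also have "\<dots> = pairing p' q'"
      unfolding pairing_def by (rule lin_form_swap[symmetric])
    finally show ?thesis .
  qed
  define repW where "repW x = (SOME p. Poly_Mapping.keys p \<subseteq> btrees (carrier ?W) 3 \<and> tree_class ?W 3 p = x)" for x
  define repV where "repV y = (SOME q. Poly_Mapping.keys q \<subseteq> btrees (carrier V) 3 \<and> tree_class V 3 q = y)" for y
  have repW: "Poly_Mapping.keys (repW (tree_class ?W 3 p)) \<subseteq> btrees (carrier ?W) 3 \<and>
      tree_class ?W 3 (repW (tree_class ?W 3 p)) = tree_class ?W 3 p"
    if "Poly_Mapping.keys p \<subseteq> btrees (carrier ?W) 3" for p
    unfolding repW_def by (rule someI[of _ p]) (simp add: that)
  have repV: "Poly_Mapping.keys (repV (tree_class V 3 q)) \<subseteq> btrees (carrier V) 3 \<and>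
      tree_class V 3 (repV (tree_class V 3 q)) = tree_class V 3 q"
    if "Poly_Mapping.keys q \<subseteq> btrees (carrier V) 3" for q
    unfolding repV_def by (rule someI[of _ q]) (simp add: that)
  define B where "B x y = pairing (repW x) (repV y)" for x y
  have B: "B (tree_class ?W 3 p) (tree_class V 3 q) = pairing p q"
    if "Poly_Mapping.keys p \<subseteq> btrees (carrier ?W) 3" "Poly_Mapping.keys q \<subseteq> btrees (carrier V) 3" for p q
    unfolding B_def using repW[OF that(1)] repV[OF that(2)] that by (intro well_defined) auto
  have addV: "Poly_Mapping.keys (q + q') \<subseteq> btrees (carrier V) 3"
    if "Poly_Mapping.keys q \<subseteq> btrees (carrier V) 3" "Poly_Mapping.keys q' \<subseteq> btrees (carrier V) 3"
    for q q' :: "'v btree \<Rightarrow>\<^sub>0 'k"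
    using that Poly_Mapping.keys_add[of q q'] by blast
  have addW: "Poly_Mapping.keys (p + p') \<subseteq> btrees (carrier ?W) 3"
    if "Poly_Mapping.keys p \<subseteq> btrees (carrier ?W) 3" "Poly_Mapping.keys p' \<subseteq> btrees (carrier ?W) 3"
    for p p' :: "('v \<Rightarrow> 'k) btree \<Rightarrow>\<^sub>0 'k"
    using that Poly_Mapping.keys_add[of p p'] by blast
  have scaleV: "Poly_Mapping.keys (scale c q) \<subseteq> btrees (carrier V) 3"
    if "Poly_Mapping.keys q \<subseteq> btrees (carrier V) 3" for c and q :: "'v btree \<Rightarrow>\<^sub>0 'k"
    by (rule order_trans[OF keys_scale that])
  have scaleW: "Poly_Mapping.keys (scale c p) \<subseteq> btrees (carrier ?W) 3"
    if "Poly_Mapping.keys p \<subseteq> btrees (carrier ?W) 3" for c and p :: "('v \<Rightarrow> 'k) btree \<Rightarrow>\<^sub>0 'k"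
    by (rule order_trans[OF keys_scale that])
  have "is_standard_pairing V B"
    unfolding is_standard_pairing_def
  proof (intro conjI ballI allI impI)
    fix x assume "x \<in> carrier (ops (free_operad ?W) 3)"
    then obtain p where p: "Poly_Mapping.keys p \<subseteq> btrees (carrier ?W) 3" "x = tree_class ?W 3 p"
      unfolding dual.carrier_free by blast
    have "pairing p (q + q') = pairing p q + pairing p q'" "pairing p (scale c q) = c * pairing p q" for q q' c
      by (simp_all add: pairing_def lin_form_add lin_form_scale lin_form_add_fun lin_form_mult_left)
    then show "B x \<in> linear_forms (ops (free_operad V) 3)"
      using p addV scaleV
      by (auto simp: linear_forms_def carrier_free B simp flip: class_add class_scale)
  next
    fix y assume "y \<in> carrier (ops (free_operad V) 3)"
    then obtain q where q: "Poly_Mapping.keys q \<subseteq> btrees (carrier V) 3" "y = tree_class V 3 q"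
      unfolding carrier_free by blast
    have "pairing (p + p') q = pairing p q + pairing p' q" "pairing (scale c p) q = c * pairing p q" for p p' c
      by (simp_all add: pairing_def lin_form_add lin_form_scale)
    then show "(\<lambda>x. B x y) \<in> linear_forms (ops (free_operad ?W) 3)"
      using q addW scaleW
      by (auto simp: linear_forms_def dual.carrier_free B simp flip: dual.class_add dual.class_scale)
  next
    fix \<alpha> \<beta> \<mu> \<nu> and u w :: nat
    assume "\<alpha> \<in> carrier ?W" "\<beta> \<in> carrier ?W" "\<mu> \<in> carrier V" "\<nu> \<in> carrier V" "u < 3" "w < 3"
    then show "B (ternary ?W u \<alpha> \<beta>) (ternary V w \<mu> \<nu>) = (if u = w then \<alpha> \<mu> * \<beta> \<nu> else 0)"
      unfolding class_ternary(1)[OF \<open>\<mu> \<in> carrier V\<close> \<open>\<nu> \<in> carrier V\<close> refl refl refl, symmetric]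
        dual.class_ternary(1)[OF \<open>\<alpha> \<in> carrier ?W\<close> \<open>\<beta> \<in> carrier ?W\<close> refl refl refl, symmetric]
      by (subst B) (auto simp: ternary_tree_closed dual.ternary_tree_closed pairing_def pair_def
          ternary_form_def normal_form_ternary_tree dual.normal_form_ternary_tree
          simp del: normal_form.simps One_nat_def)
  qed
  then show ?thesis
    unfolding standard_pairing_def by (rule someI[of "is_standard_pairing V" B])
qed

end

section \<open>Functoriality in the generators\<close>

lemma leaves_map_btree [simp]: "leaves (map_btree h t) = leaves t"
  by (induction t) auto

lemma relabel_map_btree: "relabel \<sigma> (map_btree h t) = map_btree h (relabel \<sigma> t)"
  by (induction t) auto

lemma graft_map_btree: "graft i n (map_btree h t) (map_btree h s) = map_btree h (graft i n t s)"
  by (induction t) (auto simp: relabel_map_btree)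

lemma map_btree_btrees: "\<lbrakk>h ` C \<subseteq> D; t \<in> btrees C n\<rbrakk> \<Longrightarrow> map_btree h t \<in> btrees D n"
  by (auto simp: btrees_def btree.set_map)

definition tree_map :: "('v \<Rightarrow> 'w) \<Rightarrow> ('v btree \<Rightarrow>\<^sub>0 'k::field) \<Rightarrow> ('w btree \<Rightarrow>\<^sub>0 'k)" where
  "tree_map h = lin_extend (\<lambda>t. monomial (map_btree h t))"

lemma tree_map_simps [simp]:
  "tree_map h (p + q) = tree_map h p + tree_map h q"
  "tree_map h (p - q) = tree_map h p - tree_map h q"
  "tree_map h (scale c p) = scale c (tree_map h p)"
  "tree_map h (monomial t) = monomial (map_btree h t)"
  "tree_map h (corolla_tree v) = corolla_tree (h v)"
  by (simp_all add: tree_map_def lin_extend_add lin_extend_diff lin_extend_scale corolla_tree_def)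

lemma tree_map_closed:
  assumes "h ` C \<subseteq> D" "Poly_Mapping.keys p \<subseteq> btrees C n"
  shows "Poly_Mapping.keys (tree_map h p) \<subseteq> btrees D n"
  unfolding tree_map_def using assms(2) map_btree_btrees[OF assms(1)]
  by (intro keys_lin_extend) auto

lemma tree_map_inverse:
  assumes "\<And>v. v \<in> C \<Longrightarrow> g (h v) = v" "Poly_Mapping.keys p \<subseteq> btrees C n"
  shows "tree_map g (tree_map h p) = p"
proof -
  have "map_btree g (map_btree h t) = t" if "t \<in> btrees C n" for t
  proof -
    have "map_btree (g \<circ> h) t = map_btree id t"
      using that assms(1) by (intro btree.map_cong0) (auto simp: btrees_def)
    then show ?thesis
      by (simp add: btree.map_comp btree.map_id)
  qed
  then have "tree_map g (tree_map h p) = lin_extend monomial p"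
    using assms(2) unfolding tree_map_def lin_extend_lin_extend
    by (intro lin_extend_cong) auto
  then show ?thesis
    by simp
qed

lemma tree_map_hom:
  assumes "h ` C \<subseteq> D"
  shows "operad_hom (tree_operad C) (tree_operad D) (\<lambda>n. tree_map h)"
  using tree_map_closed[OF assms]
  by (auto simp: operad_hom_def linear_maps_def bilin_extend_def lin_extend_lin_extend
      relabel_map_btree graft_map_btree tree_map_def[of h] lin_extend_add lin_extend_scale)

lemma tree_map_iso:
  assumes "bij_betw h C D"
  shows "operad_iso (tree_operad C) (tree_operad D) (\<lambda>n. tree_map h)"
proof -
  let ?g = "inv_into C h"
  have h: "h ` C \<subseteq> D" and g: "?g ` D \<subseteq> C"
    using assms bij_betw_inv_into[OF assms] by (auto simp: bij_betw_def)
  have "bij_betw (tree_map h) {p :: _ \<Rightarrow>\<^sub>0 'c. Poly_Mapping.keys p \<subseteq> btrees C n}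
      {p. Poly_Mapping.keys p \<subseteq> btrees D n}" for n
    using bij_betw_inv_into_left[OF assms] bij_betw_inv_into_right[OF assms]
    by (intro bij_betw_byWitness[where f' = "tree_map ?g"])
      (simp_all add: tree_map_inverse[of C _ _ _ n] tree_map_inverse[of D _ _ _ n] image_subset_iff
        tree_map_closed[OF h] tree_map_closed[OF g])
  then show ?thesis
    using tree_map_hom[OF h] by (simp add: operad_iso_iff)
qed

section \<open>Isomorphic presentations give isomorphic operads\<close>

definition s2_iso :: "('k::field, 'v) s2_module \<Rightarrow> ('k, 'w) s2_module \<Rightarrow> ('v \<Rightarrow> 'w) \<Rightarrow> bool" where
  "s2_iso V W h \<longleftrightarrow> bij_betw h (carrier V) (carrier W) \<and>
    (\<forall>v\<in>carrier V. \<forall>w\<in>carrier V. h (v \<oplus>\<^bsub>V\<^esub> w) = h v \<oplus>\<^bsub>W\<^esub> h w) \<and>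
    (\<forall>c. \<forall>v\<in>carrier V. h (c \<odot>\<^bsub>V\<^esub> v) = c \<odot>\<^bsub>W\<^esub> h v) \<and>
    (\<forall>v\<in>carrier V. h (swap V v) = swap W (h v))"

lemma s2_iso_inv:
  assumes "s2_rep V" "s2_iso V W h"
  shows "s2_iso W V (inv_into (carrier V) h)"
proof -
  interpret s2_rep V by fact
  let ?g = "inv_into (carrier V) h"
  have bij: "bij_betw h (carrier V) (carrier W)"
    using assms(2) by (simp add: s2_iso_def)
  have ex: "\<exists>v\<in>carrier V. w = h v" if "w \<in> carrier W" for w
    using that bij by (auto simp: bij_betw_def)
  have hom: "h v \<oplus>\<^bsub>W\<^esub> h w = h (v \<oplus>\<^bsub>V\<^esub> w)" "c \<odot>\<^bsub>W\<^esub> h v = h (c \<odot>\<^bsub>V\<^esub> v)" "swap W (h v) = h (swap V v)"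
    if "v \<in> carrier V" "w \<in> carrier V" for v w c
    using assms(2) that by (auto simp: s2_iso_def)
  have g: "?g (h v) = v" if "v \<in> carrier V" for v
    using bij that by (rule bij_betw_inv_into_left)
  show ?thesis
    unfolding s2_iso_def
    using bij_betw_inv_into[OF bij]
    by (auto dest!: ex simp: hom g add_closed smult_closed swap_closed)
qed

lemma vertex_relationsI:
  "\<lbrakk>v \<in> carrier V; w \<in> carrier V\<rbrakk>
    \<Longrightarrow> corolla_tree (v \<oplus>\<^bsub>V\<^esub> w) - corolla_tree v - corolla_tree w \<in> vertex_relations V 2"
  "v \<in> carrier V \<Longrightarrow> corolla_tree (c \<odot>\<^bsub>V\<^esub> v) - scale c (corolla_tree v) \<in> vertex_relations V 2"
  "v \<in> carrier V \<Longrightarrow> corolla_tree (swap V v) - monomial (Node v (Leaf 2) (Leaf 1)) \<in> vertex_relations V 2"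
  unfolding vertex_relations_def by (simp_all only: if_True refl) blast+

lemma vertex_relations_image_subset:
  assumes "s2_iso V W h"
  shows "tree_map h ` vertex_relations V n \<subseteq> vertex_relations W n"
proof
  have closed: "h v \<in> carrier W" if "v \<in> carrier V" for v
    using assms that by (auto simp: s2_iso_def bij_betw_def)
  fix q assume "q \<in> tree_map h ` vertex_relations V n"
  then obtain p where p: "p \<in> vertex_relations V n" "q = tree_map h p"
    by blast
  then have n: "n = 2"
    by (simp add: vertex_relations_def split: if_splits)
  from p(1) consider
    v w where "v \<in> carrier V" "w \<in> carrier V" "p = corolla_tree (v \<oplus>\<^bsub>V\<^esub> w) - corolla_tree v - corolla_tree w"
    | c v where "v \<in> carrier V" "p = corolla_tree (c \<odot>\<^bsub>V\<^esub> v) - scale c (corolla_tree v)"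
    | v where "v \<in> carrier V" "p = corolla_tree (swap V v) - monomial (Node v (Leaf 2) (Leaf 1))"
    unfolding n vertex_relations_def by auto
  then show "q \<in> vertex_relations W n"
  proof cases
    case 1
    then have "q = corolla_tree (h v \<oplus>\<^bsub>W\<^esub> h w) - corolla_tree (h v) - corolla_tree (h w)"
      using assms by (simp add: p s2_iso_def)
    then show ?thesis
      using closed 1 by (simp add: n vertex_relationsI del: One_nat_def)
  next
    case 2
    then have "q = corolla_tree (c \<odot>\<^bsub>W\<^esub> h v) - scale c (corolla_tree (h v))"
      using assms by (simp add: p s2_iso_def)
    then show ?thesis
      using closed 2 by (simp add: n vertex_relationsI del: One_nat_def)
  next
    case 3
    then have "q = corolla_tree (swap W (h v)) - monomial (Node (h v) (Leaf 2) (Leaf 1))"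
      using assms by (simp add: p s2_iso_def)
    then show ?thesis
      using closed 3 by (simp add: n vertex_relationsI del: One_nat_def)
  qed
qed

text \<open>The inverse isomorphism gives the second inclusion. Since \<open>tree_map\<close>
  inverts only on trees decorated by carrier elements, the closedness of the relations
  enters.\<close>

lemma vertex_relations_image:
  assumes "s2_rep V" "s2_rep W" "s2_iso V W h"
  shows "tree_map h ` vertex_relations V n = vertex_relations W n"
proof
  let ?g = "inv_into (carrier V) h"
  have bij: "bij_betw h (carrier V) (carrier W)"
    using assms(3) by (simp add: s2_iso_def)
  show "vertex_relations W n \<subseteq> tree_map h ` vertex_relations V n"
  proof
    fix p assume p: "p \<in> vertex_relations W n"
    have "Poly_Mapping.keys p \<subseteq> btrees (carrier W) n"
      using subsetD[OF vertex_relations_closed[OF assms(2)] p] by simp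
    then have "p = tree_map h (tree_map ?g p)"
      using bij_betw_inv_into_right[OF bij] by (simp add: tree_map_inverse[of "carrier W"])
    moreover have "tree_map ?g p \<in> vertex_relations V n"
      using vertex_relations_image_subset[OF s2_iso_inv[OF assms(1,3)]] p by blast
    ultimately show "p \<in> tree_map h ` vertex_relations V n"
      by blast
  qed
qed (rule vertex_relations_image_subset[OF assms(3)])

lemma free_operad_iso:
  fixes V :: "('k::field, 'v) s2_module" and W :: "('k, 'w) s2_module"
  assumes V: "s2_rep V" and W: "s2_rep W" and iso: "s2_iso V W h"
  shows "operad_iso (free_operad V) (free_operad W) (\<lambda>n. image (tree_map h))"
    and "Poly_Mapping.keys p \<subseteq> btrees (carrier V) n
      \<Longrightarrow> tree_map h ` tree_class V n p = tree_class W n (tree_map h p)"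
proof -
  have "bij_betw h (carrier V) (carrier W)"
    using iso by (simp add: s2_iso_def)
  then have tree_iso: "operad_iso (tree_operad (carrier V)) (tree_operad (carrier W))
      (\<lambda>n. tree_map h :: _ \<Rightarrow> 'w btree \<Rightarrow>\<^sub>0 'k)"
    by (rule tree_map_iso)
  have J: "operadic_ideal (tree_operad (carrier W)) (\<lambda>n. tree_map h ` vertex_relations V n) = vertex_ideal W"
    by (simp add: vertex_relations_image[OF assms] vertex_ideal_def)
  note q = operad_iso_quotient[OF tree_operad tree_operad tree_iso vertex_relations_closed[OF V],
      unfolded J, folded vertex_ideal_def]
  show "operad_iso (free_operad V) (free_operad W) (\<lambda>n. image (tree_map h))"
    unfolding free_operad_def by (rule q(1))
  show "tree_map h ` tree_class V n p = tree_class W n (tree_map h p)"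
    if "Poly_Mapping.keys p \<subseteq> btrees (carrier V) n"
    unfolding tree_class_def using that by (intro q(2)) simp
qed

lemma quadratic_operad_operad:
  assumes "s2_rep V" "R \<subseteq> carrier (ops (free_operad V) 3)"
  shows "operad (quadratic_operad (V, R))"
proof -
  interpret s2_rep V by fact
  interpret operad_ideal "free_operad V" "operadic_ideal (free_operad V) (\<lambda>n. if n = 3 then R else {})"
    using assms(2) by (intro free.operad_ideal_operadic_ideal) simp
  show ?thesis
    unfolding quadratic_operad_def by (simp add: quotient_operad)
qed

text \<open>The quotient result is applied a second time, now to the free operads. The direct image
  is therefore iterated: once for classes of trees and once for classes modulo the
  relations.\<close>

lemma quadratic_operads_isomorphic:
  assumes V: "s2_rep V" and W: "s2_rep W" and iso: "s2_iso V W h"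
    and R: "R \<subseteq> carrier (ops (free_operad V) 3)" and R': "image (tree_map h) ` R = R'"
  shows "quadratic_operad (V, R) \<cong>\<^sub>o\<^sub>p quadratic_operad (W, R')"
proof -
  interpret V: s2_rep V by fact
  interpret W: s2_rep W by fact
  note free_iso = free_operad_iso(1)[OF V W iso]
  have G: "(if n = 3 then R else {}) \<subseteq> carrier (ops (free_operad V) n)" for n
    using R by simp
  have img: "(\<lambda>n. image (tree_map h) ` (if n = 3 then R else {})) = (\<lambda>n. if n = 3 then R' else {})"
    using R' by (simp add: fun_eq_iff)
  have "operad_iso (quadratic_operad (V, R)) (quadratic_operad (W, R')) (\<lambda>n. image (image (tree_map h)))"
    using operad_iso_quotient(1)[OF V.free.operad_axioms W.free.operad_axioms free_iso G]
    unfolding quadratic_operad_def img by simp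
  moreover have "R' \<subseteq> carrier (ops (free_operad W) 3)"
  proof -
    have "bij_betw (image (tree_map h)) (carrier (ops (free_operad V) 3)) (carrier (ops (free_operad W) 3))"
      using free_iso unfolding operad_iso_iff by blast
    then show ?thesis
      using R unfolding R'[symmetric] bij_betw_def by blast
  qed
  ultimately show ?thesis
    unfolding operads_isomorphic_def
    using quadratic_operad_operad[OF V R] quadratic_operad_operad[OF W] by blast
qed

lemma keys_addI: "\<lbrakk>Poly_Mapping.keys p \<subseteq> A; Poly_Mapping.keys q \<subseteq> A\<rbrakk> \<Longrightarrow> Poly_Mapping.keys (p + q) \<subseteq> A"
  using Poly_Mapping.keys_add[of p q] by blast

lemma keys_diffI:
  fixes p q :: "'a \<Rightarrow>\<^sub>0 'b::ab_group_add"
  shows "\<lbrakk>Poly_Mapping.keys p \<subseteq> A; Poly_Mapping.keys q \<subseteq> A\<rbrakk> \<Longrightarrow> Poly_Mapping.keys (p - q) \<subseteq> A"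
  using Poly_Mapping.keys_diff[of p q] by blast

lemma keys_scaleI: "Poly_Mapping.keys p \<subseteq> A \<Longrightarrow> Poly_Mapping.keys (scale c p) \<subseteq> A"
  by (rule order_trans[OF keys_scale])

section \<open>Evaluation of the pairing on classes, and equivariant spans\<close>

context s2_rep
begin

lemma class_normal_form:
  assumes "t \<in> btrees (carrier V) 3" "normal_form V t = (u, v, w)"
  shows "tree_class V 3 (monomial t) = ternary V u v w"
  using assms(1)
proof (cases rule: btrees_3_cases)
  case (1 r v' w' a b c)
  have "c mod 3 = r" "b mod 3 = Suc a mod 3" "a mod 3 \<noteq> Suc b mod 3"
    using 1(1)[unfolded less_3_cases] unfolding 1(4-6) by (elim disjE; simp)+
  then show ?thesis
    using 1(7) assms(2) class_ternary[OF 1(2-6)] by auto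
qed

lemma linear_form_class:
  assumes L: "L \<in> linear_forms (ops (free_operad V) n)" and p: "Poly_Mapping.keys p \<subseteq> btrees (carrier V) n"
  shows "L (tree_class V n p) = lin_form (\<lambda>t. L (tree_class V n (monomial t))) p"
proof -
  define S where "S = Poly_Mapping.keys p"
  define h where "h = Poly_Mapping.lookup p"
  have "L (tree_class V n (scale 0 0)) = 0"
    using linear_formsD(2)[OF L] by (simp add: class_scale class_closed del: scale_simps)
  then have zero: "L (tree_class V n 0) = 0"
    by simp
  have "finite S" "S \<subseteq> btrees (carrier V) n"
    using p by (auto simp: S_def)
  then have "Poly_Mapping.keys (\<Sum>t\<in>S. scale (h t) (monomial t)) \<subseteq> btrees (carrier V) n \<and>
    L (tree_class V n (\<Sum>t\<in>S. scale (h t) (monomial t))) = (\<Sum>t\<in>S. h t * L (tree_class V n (monomial t)))"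
  proof (induction S)
    case empty
    then show ?case using zero by simp
  next
    case (insert t S)
    let ?r = "\<Sum>t\<in>S. scale (h t) (monomial t)"
    have t: "Poly_Mapping.keys (scale (h t) (monomial t)) \<subseteq> btrees (carrier V) n"
      using insert.prems by (intro order_trans[OF keys_scale]) simp
    moreover have "Poly_Mapping.keys (scale (h t) (monomial t) + ?r) \<subseteq> btrees (carrier V) n"
      using insert t by (intro order_trans[OF Poly_Mapping.keys_add]) simp
    ultimately show ?case
      using insert linear_formsD[OF L] by (simp add: class_add class_scale class_closed)
  qed
  moreover have "(\<Sum>t\<in>S. scale (h t) (monomial t)) = p"
    using lin_extend_monomial_id[of p] by (simp add: lin_extend_def S_def h_def)
  ultimately show ?thesis
    by (simp add: lin_form_def S_def h_def)
qed

lemma standard_pairing_right: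
  "x \<in> carrier (ops (free_operad (sign_dual V)) 3)
    \<Longrightarrow> standard_pairing V x \<in> linear_forms (ops (free_operad V) 3)"
  using standard_pairing unfolding is_standard_pairing_def by blast

lemma standard_pairing_left:
  "y \<in> carrier (ops (free_operad V) 3)
    \<Longrightarrow> (\<lambda>x. standard_pairing V x y) \<in> linear_forms (ops (free_operad (sign_dual V)) 3)"
  using standard_pairing unfolding is_standard_pairing_def by blast

lemma standard_pairing_ternary:
  "\<lbrakk>\<alpha> \<in> carrier (sign_dual V); \<beta> \<in> carrier (sign_dual V); \<mu> \<in> carrier V; \<nu> \<in> carrier V; u < 3; w < 3\<rbrakk>
    \<Longrightarrow> standard_pairing V (ternary (sign_dual V) u \<alpha> \<beta>) (ternary V w \<mu> \<nu>) = (if u = w then \<alpha> \<mu> * \<beta> \<nu> else 0)"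
  using standard_pairing unfolding is_standard_pairing_def by blast

text \<open>Turns orthogonality to an identity written with trees into a linear equation between
  pairing values on \<open>ternary\<close> elements.\<close>

lemma standard_pairing_class:
  assumes "x \<in> carrier (ops (free_operad (sign_dual V)) 3)" "Poly_Mapping.keys q \<subseteq> btrees (carrier V) 3"
  shows "standard_pairing V x (tree_class V 3 q) =
    lin_form (\<lambda>t. case normal_form V t of (u, v, w) \<Rightarrow> standard_pairing V x (ternary V u v w)) q"
  unfolding linear_form_class[OF standard_pairing_right[OF assms(1)] assms(2)]
  using assms(2) class_normal_form by (intro lin_form_cong) (auto split: prod.splits)

text \<open>Pairing with a single operation of the dual is its coordinate functional, so
  orthogonality to it can be computed on any representative.\<close>

lemma standard_pairing_ternary_class:
  assumes "\<alpha> \<in> carrier (sign_dual V)" "\<beta> \<in> carrier (sign_dual V)" "u < 3"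
    and q: "Poly_Mapping.keys q \<subseteq> btrees (carrier V) 3"
  shows "standard_pairing V (ternary (sign_dual V) u \<alpha> \<beta>) (tree_class V 3 q) =
    lin_form (ternary_form V u \<alpha> \<beta>) q"
proof -
  interpret dual: s2_rep "sign_dual V"
    by (rule s2_rep_sign_dual)
  have "(case normal_form V t of (w, \<mu>, \<nu>) \<Rightarrow> standard_pairing V (ternary (sign_dual V) u \<alpha> \<beta>) (ternary V w \<mu> \<nu>)) =
    ternary_form V u \<alpha> \<beta> t" if t: "t \<in> btrees (carrier V) 3" for t
  proof -
    obtain w \<mu> \<nu> where "normal_form V t = (w, \<mu>, \<nu>)" "w < 3" "\<mu> \<in> carrier V" "\<nu> \<in> carrier V"
      using normal_form_closed[OF t] .
    then show ?thesis
      using assms by (simp add: standard_pairing_ternary ternary_form_def)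
  qed
  then show ?thesis
    using assms dual.ternary_closed by (subst standard_pairing_class) (auto intro!: lin_form_cong)
qed

text \<open>Allows a linear condition \<open>D\<close> on polynomials to be used for classes, where
  it means that some representative satisfies \<open>D\<close>.\<close>

lemma submodule_class_image:
  assumes "D 0" "\<And>p q. \<lbrakk>D p; D q\<rbrakk> \<Longrightarrow> D (p + q)" "\<And>c p. D p \<Longrightarrow> D (scale c p)"
  shows "submodule (tree_class V n ` {p. Poly_Mapping.keys p \<subseteq> btrees (carrier V) n \<and> D p})
    (ring_of_type_algebra :: 'k ring) (ops (free_operad V) n)"
proof -
  interpret M: module "ring_of_type_algebra :: 'k ring" "ops (free_operad V) n"
    by (rule free.ops_vector_space)
  let ?H = "tree_class V n ` {p. Poly_Mapping.keys p \<subseteq> btrees (carrier V) n \<and> D p}"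
  have closed: "?H \<subseteq> carrier (ops (free_operad V) n)"
    by (auto simp: class_closed)
  have smult: "c \<odot>\<^bsub>ops (free_operad V) n\<^esub> x \<in> ?H" if x: "x \<in> ?H" for c x
  proof -
    obtain p where "Poly_Mapping.keys p \<subseteq> btrees (carrier V) n" "D p" "x = tree_class V n p"
      using x by blast
    then show ?thesis
      using assms(3) by (intro image_eqI[of _ _ "scale c p"]) (simp_all add: class_scale keys_scaleI)
  qed
  show ?thesis
  proof (rule M.submoduleI)
    show "\<zero>\<^bsub>ops (free_operad V) n\<^esub> \<in> ?H"
      using assms(1) by (auto simp flip: class_zero)
    show "\<ominus>\<^bsub>ops (free_operad V) n\<^esub> x \<in> ?H" if "x \<in> ?H" for x
      using that closed smult by (subst free.minus_conv) blast+
    show "x \<oplus>\<^bsub>ops (free_operad V) n\<^esub> y \<in> ?H" if xy: "x \<in> ?H" "y \<in> ?H" for x y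
    proof -
      obtain p q where "Poly_Mapping.keys p \<subseteq> btrees (carrier V) n" "D p" "x = tree_class V n p"
        "Poly_Mapping.keys q \<subseteq> btrees (carrier V) n" "D q" "y = tree_class V n q"
        using xy by blast
      then show ?thesis
        using assms(2) by (intro image_eqI[of _ _ "p + q"]) (simp_all add: class_add keys_addI)
    qed
  qed (use closed smult in auto)
qed

end

lemma equivariant_span_least:
  fixes P :: "('k::field, 'a) operad"
  assumes "submodule H (ring_of_type_algebra :: 'k ring) (ops P n)"
    and "\<And>\<sigma> x. \<lbrakk>\<sigma> permutes {1..n}; x \<in> H\<rbrakk> \<Longrightarrow> act P n \<sigma> x \<in> H" and "A \<subseteq> H"
  shows "equivariant_span P n A \<subseteq> H"
  unfolding equivariant_span_def using assms by (intro Inter_lower) auto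

lemma equivariant_span_closed:
  fixes P :: "('k::field, 'a) operad"
  shows "x \<in> A \<Longrightarrow> x \<in> equivariant_span P n A"
    and "\<lbrakk>x \<in> equivariant_span P n A; y \<in> equivariant_span P n A\<rbrakk>
      \<Longrightarrow> x \<oplus>\<^bsub>ops P n\<^esub> y \<in> equivariant_span P n A"
    and "x \<in> equivariant_span P n A \<Longrightarrow> c \<odot>\<^bsub>ops P n\<^esub> x \<in> equivariant_span P n A"
    and "\<lbrakk>\<sigma> permutes {1..n}; x \<in> equivariant_span P n A\<rbrakk> \<Longrightarrow> act P n \<sigma> x \<in> equivariant_span P n A"
proof -
  show "x \<in> A \<Longrightarrow> x \<in> equivariant_span P n A"
    by (auto simp: equivariant_span_def)
  show "x \<oplus>\<^bsub>ops P n\<^esub> y \<in> equivariant_span P n A"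
    if "x \<in> equivariant_span P n A" "y \<in> equivariant_span P n A"
    unfolding equivariant_span_def
  proof (intro InterI)
    fix H assume H: "H \<in> {H. submodule H (ring_of_type_algebra :: 'k ring) (ops P n) \<and>
      (\<forall>\<sigma>. \<sigma> permutes {1..n} \<longrightarrow> act P n \<sigma> ` H \<subseteq> H) \<and> A \<subseteq> H}"
    then have "x \<in> H" "y \<in> H"
      using that unfolding equivariant_span_def by blast+
    then show "x \<oplus>\<^bsub>ops P n\<^esub> y \<in> H"
      using H subgroup.m_closed[OF submodule.axioms(1), of H _ "ops P n" x y] by auto
  qed
  show "c \<odot>\<^bsub>ops P n\<^esub> x \<in> equivariant_span P n A" if "x \<in> equivariant_span P n A"
    using that submodule.smult_closed[of _ "ring_of_type_algebra :: 'k ring" "ops P n" c x]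
    unfolding equivariant_span_def by auto
  show "act P n \<sigma> x \<in> equivariant_span P n A"
    if "\<sigma> permutes {1..n}" "x \<in> equivariant_span P n A"
    using that unfolding equivariant_span_def by blast
qed


section \<open>Symmetric Leibniz and com.-admissible relations\<close>

lemma regular_rep_simps [simp]:
  "carrier regular_rep = UNIV"
  "(a, b) \<oplus>\<^bsub>regular_rep\<^esub> (c, d) = (a + c, b + d)"
  "c \<odot>\<^bsub>regular_rep\<^esub> (a, b) = (c * a, c * b)"
  "swap regular_rep (a, b) = (b, a)"
  by (simp_all add: regular_rep_def)

interpretation reg: s2_rep "regular_rep :: ('k::field, 'k \<times> 'k) s2_module"
  by unfold_locales (auto simp: split_paired_all)

interpretation dual: s2_rep "sign_dual (regular_rep :: ('k::field, 'k \<times> 'k) s2_module)"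
  by (rule reg.s2_rep_sign_dual)

text \<open>With coefficients (1, 0) and (0, 1) these are the basis dual to the multiplication and
  its opposite. They are extensional as they stand, since the carrier is the whole type.\<close>

definition coordinate_form :: "'k::field \<Rightarrow> 'k \<Rightarrow> 'k \<times> 'k \<Rightarrow> 'k" where
  "coordinate_form a b = (\<lambda>(x, y). a * x + b * y)"

lemma coordinate_form_simps [simp]:
  "coordinate_form a b (x, y) = a * x + b * y"
  "coordinate_form a b \<oplus>\<^bsub>sign_dual regular_rep\<^esub> coordinate_form c d = coordinate_form (a + c) (b + d)"
  "c \<odot>\<^bsub>sign_dual regular_rep\<^esub> coordinate_form a b = coordinate_form (c * a) (c * b)"
  "swap (sign_dual regular_rep) (coordinate_form a b) = coordinate_form (- b) (- a)"
  by (auto simp: coordinate_form_def sign_dual_def fun_eq_iff algebra_simps)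

lemma coordinate_form_closed [simp]:
  "coordinate_form a b \<in> carrier (sign_dual (regular_rep :: ('k::field, 'k \<times> 'k) s2_module))"
  by (auto simp: sign_dual_def linear_forms_def algebra_simps)

lemma sign_dual_regular_cases:
  assumes "\<phi> \<in> carrier (sign_dual (regular_rep :: ('k::field, 'k \<times> 'k) s2_module))"
  shows "\<phi> = coordinate_form (\<phi> (1, 0)) (\<phi> (0, 1))"
proof
  fix x :: "'k \<times> 'k"
  obtain a b where x: "x = (a, b)"
    by fastforce
  have "\<phi> x = \<phi> (a \<odot>\<^bsub>regular_rep\<^esub> (1, 0) \<oplus>\<^bsub>regular_rep\<^esub> b \<odot>\<^bsub>regular_rep\<^esub> (0, 1))"
    by (simp add: x)
  also have "\<dots> = a * \<phi> (1, 0) + b * \<phi> (0, 1)"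
    by (simp only: linear_formsD[OF reg.sign_dual_simps(1)[OF assms]] regular_rep_simps(1) UNIV_I)
  finally show "\<phi> x = coordinate_form (\<phi> (1, 0)) (\<phi> (0, 1)) x"
    by (simp add: x)
qed

text \<open>
  The sign in the second coordinate turns the action on the sign dual into the exchange of
  coordinates.
\<close>

definition dual_iso :: "('k::field \<times> 'k \<Rightarrow> 'k) \<Rightarrow> 'k \<times> 'k" where
  "dual_iso \<phi> = (\<phi> (1, 0), - \<phi> (0, 1))"

lemma dual_iso_coordinate_form [simp]: "dual_iso (coordinate_form a b) = (a, - b)"
  by (simp add: dual_iso_def)

lemma s2_iso_dual_iso:
  "s2_iso (sign_dual regular_rep) (regular_rep :: ('k::field, 'k \<times> 'k) s2_module) dual_iso"
proof -
  have "bij_betw dual_iso (carrier (sign_dual regular_rep)) (carrier regular_rep)"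
    by (rule bij_betw_byWitness[where f' = "\<lambda>(a, b). coordinate_form a (- b)"])
      (auto simp: dual_iso_def simp flip: sign_dual_regular_cases)
  moreover have ex: "\<exists>a b. \<phi> = coordinate_form a b" if "\<phi> \<in> carrier (sign_dual regular_rep)" for \<phi> :: "'k \<times> 'k \<Rightarrow> 'k"
    using sign_dual_regular_cases[OF that] by blast
  ultimately show ?thesis
    unfolding s2_iso_def by (auto dest!: ex)
qed

section \<open>Combinations of the three bracketings\<close>

definition cyclic_tree :: "'v \<Rightarrow> 'v \<Rightarrow> nat \<Rightarrow> 'v btree" where
  "cyclic_tree v w u = Node v (Node w (Leaf ((rotation ^^ u) 1)) (Leaf ((rotation ^^ u) 2))) (Leaf ((rotation ^^ u) 3))"

definition cyclic_sum :: "'v \<Rightarrow> 'k::field \<Rightarrow> 'k \<Rightarrow> 'k \<Rightarrow> 'v btree \<Rightarrow>\<^sub>0 'k" where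
  "cyclic_sum v a b c = scale a (monomial (cyclic_tree v v 0)) + scale b (monomial (cyclic_tree v v 1)) +
     scale c (monomial (cyclic_tree v v 2))"

context s2_rep
begin

lemma cyclic_tree_closed [simp]:
  "\<lbrakk>v \<in> carrier V; w \<in> carrier V\<rbrakk> \<Longrightarrow> cyclic_tree v w u \<in> btrees (carrier V) 3"
  unfolding cyclic_tree_def by (rule ternary_tree_closed)

lemma class_cyclic_tree:
  "\<lbrakk>v \<in> carrier V; w \<in> carrier V\<rbrakk> \<Longrightarrow> tree_class V 3 (monomial (cyclic_tree v w u)) = ternary V u v w"
  unfolding cyclic_tree_def by (rule class_ternary(1)) simp_all

lemma cyclic_sum_closed [simp]:
  "v \<in> carrier V \<Longrightarrow> Poly_Mapping.keys (cyclic_sum v a b c) \<subseteq> btrees (carrier V) 3"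
  unfolding cyclic_sum_def by (intro keys_addI keys_scaleI) simp_all

lemma class_cyclic_sum:
  assumes "v \<in> carrier V"
  shows "tree_class V 3 (cyclic_sum v a b c) =
    a \<odot>\<^bsub>ops (free_operad V) 3\<^esub> ternary V 0 v v \<oplus>\<^bsub>ops (free_operad V) 3\<^esub>
    b \<odot>\<^bsub>ops (free_operad V) 3\<^esub> ternary V 1 v v \<oplus>\<^bsub>ops (free_operad V) 3\<^esub>
    c \<odot>\<^bsub>ops (free_operad V) 3\<^esub> ternary V 2 v v"
  unfolding cyclic_sum_def using assms
  by (simp add: class_add class_scale class_cyclic_tree keys_addI keys_scaleI del: One_nat_def)

text \<open>The bracketings of a symmetric operation form a permutation representation, so the
  coefficients are permuted and their sum is invariant.\<close>

lemma act_cyclic_sum: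
  assumes "\<sigma> permutes {1..3}" "v \<in> carrier V" "swap V v = v"
  obtains a' b' c' where "a' + b' + c' = a + b + c"
    "act (free_operad V) 3 \<sigma> (tree_class V 3 (cyclic_sum v a b c)) = tree_class V 3 (cyclic_sum v a' b' c')"
proof -
  obtain q where q: "(q 0, q 1, q 2) \<in> {(0, 1, 2), (1, 2, 0), (2, 0, 1), (0, 2, 1), (1, 0, 2), (2, 1, 0)}"
    "\<And>u. u < 3 \<Longrightarrow> act (free_operad V) 3 \<sigma> (ternary V u v v) = ternary V (q u) v v"
    using act_ternary[OF assms(1,2,2,3)] by blast
  define r where "r = scale a (monomial (cyclic_tree v v (q 0))) + scale b (monomial (cyclic_tree v v (q 1))) +
     scale c (monomial (cyclic_tree v v (q 2)))"
  have "act (free_operad V) 3 \<sigma> (tree_class V 3 (cyclic_sum v a b c)) = tree_class V 3 r"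
    unfolding class_cyclic_sum[OF assms(2)] r_def
    using assms(2) linear_mapsD(2,3)[OF free.act_linear[OF assms(1)]] q(2)
    by (simp add: class_add class_scale class_cyclic_tree keys_addI keys_scaleI ternary_closed del: One_nat_def)
  moreover have "r \<in> {cyclic_sum v a b c, cyclic_sum v c a b, cyclic_sum v b c a,
      cyclic_sum v a c b, cyclic_sum v b a c, cyclic_sum v c b a}"
    using q(1) unfolding r_def cyclic_sum_def by (auto simp: ac_simps simp del: One_nat_def)
  ultimately show ?thesis
    using that[of a b c] that[of c a b] that[of b c a] that[of a c b] that[of b a c] that[of c b a]
    by (auto simp: ac_simps)
qed

lemma class_diff_cong:
  assumes "tree_class V n p = tree_class V n p'" "tree_class V n q = tree_class V n q'"
    "Poly_Mapping.keys p \<subseteq> btrees (carrier V) n" "Poly_Mapping.keys p' \<subseteq> btrees (carrier V) n"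
    "Poly_Mapping.keys q \<subseteq> btrees (carrier V) n" "Poly_Mapping.keys q' \<subseteq> btrees (carrier V) n"
  shows "tree_class V n (p - q) = tree_class V n (p' - q')"
proof -
  have "tree_class V n (p + scale (- 1) q) = tree_class V n (p' + scale (- 1) q')"
    using assms by (simp add: class_add class_scale keys_scaleI)
  then show ?thesis
    by (simp add: scale_minus_one)
qed

end

section \<open>Associativity of the symmetric product\<close>

definition label_triple :: "nat \<Rightarrow> nat \<Rightarrow> nat \<Rightarrow> bool" where
  "label_triple a b c \<longleftrightarrow> distinct [a, b, c] \<and> {a, b, c} = {1..3}"

lemma label_triple_perm:
  "label_triple a b c \<Longrightarrow> label_triple b a c" "label_triple a b c \<Longrightarrow> label_triple b c a"
  by (auto simp: label_triple_def insert_commute)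

lemma label_triple_permutes:
  assumes "\<sigma> permutes {1..3}"
  shows "label_triple (\<sigma> 1) (\<sigma> 2) (\<sigma> 3)"
proof -
  have "{1..3} = {1, 2, 3::nat}"
    by auto
  then show ?thesis
    by (cases rule: permutes_3_cases[OF assms]) (auto simp: label_triple_def)
qed

lemma label_triple_btrees:
  assumes "label_triple a b c"
  shows "Node v (Node w (Leaf a) (Leaf b)) (Leaf c) \<in> btrees UNIV 3"
    and "Node v (Leaf a) (Node w (Leaf b) (Leaf c)) \<in> btrees UNIV 3"
  using assms by (auto simp: btrees_def label_triple_def)

text \<open>The expansion of \<open>(a \<diamondop> b) \<diamondop> c\<close> in the generating
  multiplication.\<close>

definition four_products :: "nat \<Rightarrow> nat \<Rightarrow> nat \<Rightarrow> ('k::field \<times> 'k) btree \<Rightarrow>\<^sub>0 'k" where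
  "four_products a b c =
    monomial (Node (1, 0) (Node (1, 0) (Leaf a) (Leaf b)) (Leaf c)) +
    monomial (Node (1, 0) (Node (1, 0) (Leaf b) (Leaf a)) (Leaf c)) +
    (monomial (Node (1, 0) (Leaf c) (Node (1, 0) (Leaf a) (Leaf b))) +
     monomial (Node (1, 0) (Leaf c) (Node (1, 0) (Leaf b) (Leaf a))))"

lemma four_products_closed:
  assumes "label_triple a b c"
  shows "Poly_Mapping.keys (four_products a b c :: ('k::field \<times> 'k) btree \<Rightarrow>\<^sub>0 'k) \<subseteq> btrees UNIV 3"
proof -
  have "label_triple b a c" "label_triple c a b" "label_triple c b a"
    using assms label_triple_perm by metis+
  then show ?thesis
    unfolding four_products_def using assms by (intro keys_addI) (simp_all add: label_triple_btrees)
qed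

text \<open>The four products are the operations with decorations (1, 0) or (0, 1) at either vertex.
  Bilinearity collects them into one operation with (1, 0) + (0, 1) = (1, 1) at both vertices, which
  is the symmetric product composed with itself.\<close>

lemma class_four_products:
  assumes "a = (rotation ^^ u) 1" "b = (rotation ^^ u) 2" "c = (rotation ^^ u) 3"
  shows "tree_class regular_rep 3 (four_products a b c :: ('k::field \<times> 'k) btree \<Rightarrow>\<^sub>0 'k) =
    tree_class regular_rep 3 (monomial (cyclic_tree (1, 1) (1, 1) u))"
proof -
  let ?V = "regular_rep :: ('k, 'k \<times> 'k) s2_module"
  let ?e = "(1, 0) :: 'k \<times> 'k"
  let ?f = "(0, 1) :: 'k \<times> 'k"
  have abc: "label_triple a b c"
    unfolding assms by (rule label_triple_permutes[OF rotation_pow_permutes])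
  have mem: "Node ?e (Node ?e (Leaf a) (Leaf b)) (Leaf c) \<in> btrees UNIV 3"
    "Node ?e (Node ?e (Leaf b) (Leaf a)) (Leaf c) \<in> btrees UNIV 3"
    "Node ?e (Leaf c) (Node ?e (Leaf a) (Leaf b)) \<in> btrees UNIV 3"
    "Node ?e (Leaf c) (Node ?e (Leaf b) (Leaf a)) \<in> btrees UNIV 3"
    using abc label_triple_perm[of a b c] label_triple_perm[of b a c] label_triple_perm[of b c a]
    by (simp_all add: label_triple_btrees)
  have "tree_class ?V 3 (four_products a b c) =
    (ternary ?V u ?e ?e \<oplus>\<^bsub>ops (free_operad ?V) 3\<^esub> ternary ?V u ?e ?f) \<oplus>\<^bsub>ops (free_operad ?V) 3\<^esub>
    (ternary ?V u ?f ?e \<oplus>\<^bsub>ops (free_operad ?V) 3\<^esub> ternary ?V u ?f ?f)"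
    using reg.class_ternary[OF _ _ assms, of ?e ?e] mem
    by (simp add: four_products_def reg.class_add keys_addI)
  also have "\<dots> = ternary ?V u ?e (?e \<oplus>\<^bsub>?V\<^esub> ?f) \<oplus>\<^bsub>ops (free_operad ?V) 3\<^esub> ternary ?V u ?f (?e \<oplus>\<^bsub>?V\<^esub> ?f)"
    by (simp only: reg.ternary_linear_right regular_rep_simps(1) UNIV_I)
  also have "\<dots> = ternary ?V u (?e \<oplus>\<^bsub>?V\<^esub> ?f) (?e \<oplus>\<^bsub>?V\<^esub> ?f)"
    by (simp only: reg.ternary_linear_left regular_rep_simps(1) UNIV_I)
  also have "\<dots> = tree_class ?V 3 (monomial (cyclic_tree (1, 1) (1, 1) u))"
    by (simp add: reg.class_cyclic_tree)
  finally show ?thesis .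
qed

text \<open>By commutativity \<open>a \<diamondop> (b \<diamondop> c)\<close> is
  \<open>(b \<diamondop> c) \<diamondop> a\<close>, so both terms of the associator have the same
  shape up to a rotation of the labels.\<close>

lemma associator_four_products:
  "(monomial (Leaf a) \<diamondop> monomial (Leaf b)) \<diamondop> monomial (Leaf c) -
    monomial (Leaf a) \<diamondop> (monomial (Leaf b) \<diamondop> monomial (Leaf c)) =
   four_products a b c - four_products b c a"
  by (simp add: sym_poly_def mul_poly_def bilin_extend_add_left bilin_extend_add_right four_products_def
      algebra_simps)

lemma class_associator:
  "tree_class regular_rep 3 (four_products 1 2 3 - four_products 2 3 1) =
   tree_class regular_rep 3 (cyclic_sum (1, 1) 1 (- 1) 0)"
proof -
  have "tree_class regular_rep 3 (four_products 1 2 3 - four_products 2 3 1) =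
    tree_class regular_rep 3 (monomial (cyclic_tree (1, 1) (1, 1) 0) - monomial (cyclic_tree (1, 1) (1, 1) 1))"
    using class_four_products[of 1 0 2 3] class_four_products[of 2 1 3 1]
      four_products_closed[OF label_triple_permutes[OF rotation_pow_permutes[of 0]]]
      four_products_closed[OF label_triple_permutes[OF rotation_pow_permutes[of 1]]]
    by (intro reg.class_diff_cong) (simp_all add: reg.cyclic_tree_closed[simplified])
  then show ?thesis
    by (simp add: cyclic_sum_def scale_minus_one)
qed

lemma cyclic_sum_add: "cyclic_sum v a b c + cyclic_sum v a' b' c' = cyclic_sum v (a + a') (b + b') (c + c')"
  by (simp add: cyclic_sum_def scale_add_left)

lemma cyclic_sum_scale: "scale d (cyclic_sum v a b c) = cyclic_sum v (d * a) (d * b) (d * c)"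
  by (simp add: cyclic_sum_def scale_add_right)

text \<open>The span of the differences of the three bracketings, written by its equation on the
  coefficients, which makes stability under sums, scalars and permutations immediate.\<close>

definition cyclic_relations :: "(('k::field \<times> 'k) btree \<Rightarrow>\<^sub>0 'k) set set" where
  "cyclic_relations = {tree_class regular_rep 3 (cyclic_sum (1, 1) a b c) | a b c. a + b + c = 0}"

lemma submodule_cyclic_relations:
  "submodule cyclic_relations (ring_of_type_algebra :: 'k::field ring) (ops (free_operad regular_rep) 3)"
proof -
  define D :: "(('k \<times> 'k) btree \<Rightarrow>\<^sub>0 'k) \<Rightarrow> bool" where
    "D p \<longleftrightarrow> (\<exists>a b c. a + b + c = 0 \<and> p = cyclic_sum (1, 1) a b c)" for p
  have "Poly_Mapping.keys (cyclic_sum (1, 1) a b c :: ('k \<times> 'k) btree \<Rightarrow>\<^sub>0 'k) \<subseteq> btrees (carrier regular_rep) 3" for a b c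
    by (rule reg.cyclic_sum_closed) simp
  then have "cyclic_relations = tree_class regular_rep 3 ` {p. Poly_Mapping.keys p \<subseteq> btrees (carrier regular_rep) 3 \<and> D p}"
    unfolding cyclic_relations_def D_def by blast
  moreover have "submodule (tree_class regular_rep 3 ` {p. Poly_Mapping.keys p \<subseteq> btrees (carrier regular_rep) 3 \<and> D p})
    (ring_of_type_algebra :: 'k ring) (ops (free_operad regular_rep) 3)"
  proof (rule reg.submodule_class_image)
    show "D 0"
      unfolding D_def by (intro exI[of _ 0]) (simp add: cyclic_sum_def)
    show "D (p + q)" if D: "D p" "D q" for p q
    proof -
      obtain a b c a' b' c' where *: "a + b + c = 0" "p = cyclic_sum (1, 1) a b c"
        "a' + b' + c' = 0" "q = cyclic_sum (1, 1) a' b' c'"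
        using D unfolding D_def by blast
      have "a + a' + (b + b') + (c + c') = (a + b + c) + (a' + b' + c')"
        by simp
      then show ?thesis
        unfolding D_def * cyclic_sum_add using *(1,3) by (metis add_0_left)
    qed
    show "D (scale d p)" if D: "D p" for d p
    proof -
      obtain a b c where *: "a + b + c = 0" "p = cyclic_sum (1, 1) a b c"
        using D unfolding D_def by blast
      have "d * a + d * b + d * c = d * (a + b + c)"
        by (simp add: algebra_simps)
      then show ?thesis
        unfolding D_def * cyclic_sum_scale using *(1) by (metis mult_zero_right)
    qed
  qed
  ultimately show ?thesis
    by simp
qed

lemma ComAdm_eq: "ComAdm = (regular_rep, cyclic_relations :: (('k::field \<times> 'k) btree \<Rightarrow>\<^sub>0 'k) set set)"
proof -
  let ?F = "free_operad (regular_rep :: ('k, 'k \<times> 'k) s2_module)"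
  let ?E = "equivariant_span ?F 3 {tree_class regular_rep 3 (cyclic_sum (1, 1) 1 (- 1) 0)}"
  have "?E \<subseteq> cyclic_relations"
  proof (rule equivariant_span_least[OF submodule_cyclic_relations])
    fix \<sigma> :: "nat \<Rightarrow> nat" and x :: "(('k \<times> 'k) btree \<Rightarrow>\<^sub>0 'k) set"
    assume \<sigma>: "\<sigma> permutes {1..3}" and "x \<in> cyclic_relations"
    then obtain a b c where x: "x = tree_class regular_rep 3 (cyclic_sum (1, 1) a b c)" "a + b + c = 0"
      by (auto simp: cyclic_relations_def)
    obtain a' b' c' where "a' + b' + c' = a + b + c"
      "act ?F 3 \<sigma> (tree_class regular_rep 3 (cyclic_sum (1, 1) a b c)) = tree_class regular_rep 3 (cyclic_sum (1, 1) a' b' c')"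
      using reg.act_cyclic_sum[OF \<sigma>, of "(1, 1)" a b c] by auto
    then show "act ?F 3 \<sigma> x \<in> cyclic_relations"
      using x by (auto simp: cyclic_relations_def)
  next
    show "{tree_class regular_rep 3 (cyclic_sum (1, 1) 1 (- 1) 0)} \<subseteq> cyclic_relations"
      unfolding cyclic_relations_def insert_subset mem_Collect_eq
      by (intro conjI empty_subsetI exI[of _ 1] exI[of _ "- 1"] exI[of _ 0] refl) simp
  qed
  moreover have "cyclic_relations \<subseteq> ?E"
  proof
    fix x :: "(('k \<times> 'k) btree \<Rightarrow>\<^sub>0 'k) set"
    assume "x \<in> cyclic_relations"
    then obtain a b c where x: "x = tree_class regular_rep 3 (cyclic_sum (1, 1) a b c)" "a + b + c = 0"
      by (auto simp: cyclic_relations_def)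
    let ?c = "\<lambda>a b c :: 'k. tree_class regular_rep 3 (cyclic_sum (1, 1) a b c)"
    have 0: "?c 1 (- 1) 0 \<in> ?E"
      by (rule equivariant_span_closed) simp
    have "lin_extend (\<lambda>t. monomial (relabel rotation t)) (cyclic_sum (1, 1) 1 (- 1) 0) = (cyclic_sum (1, 1) 0 1 (- 1) :: ('k \<times> 'k) btree \<Rightarrow>\<^sub>0 'k)"
      by (simp add: cyclic_sum_def cyclic_tree_def lin_extend_add lin_extend_scale)
    then have "act ?F 3 rotation (?c 1 (- 1) 0) = ?c 0 1 (- 1)"
      by (subst reg.class_act[OF rotation_permutes]) (simp_all add: reg.cyclic_sum_closed[simplified])
    with equivariant_span_closed(4)[OF rotation_permutes 0] have 1: "?c 0 1 (- 1) \<in> ?E"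
      by simp
    \<comment> \<open>The associator and its rotation have the coefficients (1, -1, 0) and (0, 1,
      -1). A triple with sum zero is \<open>a\<close> times the first plus \<open>a + b\<close>
      times the second.\<close>
    have "a \<odot>\<^bsub>ops ?F 3\<^esub> ?c 1 (- 1) 0 \<oplus>\<^bsub>ops ?F 3\<^esub> (a + b) \<odot>\<^bsub>ops ?F 3\<^esub> ?c 0 1 (- 1) \<in> ?E"
      by (intro equivariant_span_closed(2,3) 0 1)
    moreover have "a \<odot>\<^bsub>ops ?F 3\<^esub> ?c 1 (- 1) 0 \<oplus>\<^bsub>ops ?F 3\<^esub> (a + b) \<odot>\<^bsub>ops ?F 3\<^esub> ?c 0 1 (- 1) = ?c a b (- (a + b))"
      by (simp add: reg.cyclic_sum_closed[simplified] cyclic_sum_scale cyclic_sum_add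
          flip: reg.class_scale reg.class_add)
    moreover have "c = - (a + b)"
      using minus_unique[OF x(2)] ..
    ultimately show "x \<in> ?E"
      using x by simp
  qed
  ultimately show ?thesis
    unfolding ComAdm_def identities_def Let_def
    by (simp add: associator_four_products class_associator del: One_nat_def)
qed

section \<open>The Leibniz identities and their values on brackets\<close>

definition left_leibniz :: "nat \<Rightarrow> nat \<Rightarrow> nat \<Rightarrow> ('k::field \<times> 'k) btree \<Rightarrow>\<^sub>0 'k" where
  "left_leibniz a b c =
    monomial (Node (1, 0) (Leaf a) (Node (1, 0) (Leaf b) (Leaf c))) -
    (monomial (Node (1, 0) (Node (1, 0) (Leaf a) (Leaf b)) (Leaf c)) +
     monomial (Node (1, 0) (Leaf b) (Node (1, 0) (Leaf a) (Leaf c))))"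

definition right_leibniz :: "nat \<Rightarrow> nat \<Rightarrow> nat \<Rightarrow> ('k::field \<times> 'k) btree \<Rightarrow>\<^sub>0 'k" where
  "right_leibniz a b c =
    monomial (Node (1, 0) (Node (1, 0) (Leaf a) (Leaf b)) (Leaf c)) -
    (monomial (Node (1, 0) (Leaf a) (Node (1, 0) (Leaf b) (Leaf c))) +
     monomial (Node (1, 0) (Node (1, 0) (Leaf a) (Leaf c)) (Leaf b)))"

lemma leibniz_closed:
  assumes "label_triple a b c"
  shows "Poly_Mapping.keys (left_leibniz a b c :: ('k::field \<times> 'k) btree \<Rightarrow>\<^sub>0 'k) \<subseteq> btrees UNIV 3"
    "Poly_Mapping.keys (right_leibniz a b c :: ('k::field \<times> 'k) btree \<Rightarrow>\<^sub>0 'k) \<subseteq> btrees UNIV 3"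
proof -
  have "label_triple b a c" "label_triple a c b"
    using assms label_triple_perm by metis+
  then show "Poly_Mapping.keys (left_leibniz a b c :: ('k \<times> 'k) btree \<Rightarrow>\<^sub>0 'k) \<subseteq> btrees UNIV 3"
    "Poly_Mapping.keys (right_leibniz a b c :: ('k \<times> 'k) btree \<Rightarrow>\<^sub>0 'k) \<subseteq> btrees UNIV 3"
    unfolding left_leibniz_def right_leibniz_def using assms
    by (intro keys_addI keys_diffI; simp add: label_triple_btrees)+
qed

lemma sLeib_eq:
  "sLeib = (regular_rep, equivariant_span (free_operad regular_rep) 3
     {tree_class regular_rep 3 (left_leibniz 1 2 3), tree_class regular_rep 3 (right_leibniz 1 2 3)})"
  by (simp add: sLeib_def identities_def Let_def mul_poly_def left_leibniz_def right_leibniz_def)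

text \<open>
  The form called \<open>\<psi>\<close> above. The balanced elements are those that are orthogonal to all
  differences of the three trees with both vertices decorated by \<open>\<psi>\<close>.
\<close>

abbreviation bracket_form :: "'k::field \<times> 'k \<Rightarrow> 'k" where
  "bracket_form \<equiv> coordinate_form 1 (- 1)"

definition bracket_balanced :: "(('k::field \<times> 'k) btree \<Rightarrow>\<^sub>0 'k) \<Rightarrow> bool" where
  "bracket_balanced p \<longleftrightarrow> (\<forall>u<3. \<forall>w<3. lin_form (ternary_form regular_rep u bracket_form bracket_form) p =
     lin_form (ternary_form regular_rep w bracket_form bracket_form) p)"

text \<open>The coordinates belonging to \<open>bracket_form\<close> read a polynomial with an
  antisymmetric product: they are the coefficients of the three iterated brackets. Balanced then
  means a multiple of the Jacobi expression, and this is what both Leibniz rules become for a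
  bracket.\<close>

lemma sLeib_bracket_balanced:
  assumes "x \<in> snd (sLeib :: ('k::field, 'k \<times> 'k) quadratic_data)"
  obtains p where "Poly_Mapping.keys p \<subseteq> btrees UNIV 3" "bracket_balanced p" "x = tree_class regular_rep 3 p"
proof -
  let ?V = "regular_rep :: ('k, 'k \<times> 'k) s2_module"
  let ?N = "tree_class ?V 3 ` {p. Poly_Mapping.keys p \<subseteq> btrees (carrier ?V) 3 \<and> bracket_balanced p}"
  have "snd (sLeib :: ('k, 'k \<times> 'k) quadratic_data) \<subseteq> ?N"
    unfolding sLeib_eq snd_conv
  proof (rule equivariant_span_least[OF reg.submodule_class_image])
    show "bracket_balanced (0 :: ('k \<times> 'k) btree \<Rightarrow>\<^sub>0 'k)"
      by (simp add: bracket_balanced_def)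
    show "bracket_balanced (p + q)" if "bracket_balanced p" "bracket_balanced q" for p q :: "('k \<times> 'k) btree \<Rightarrow>\<^sub>0 'k"
      using that unfolding bracket_balanced_def lin_form_add by metis
    show "bracket_balanced (scale c p)" if "bracket_balanced p" for c and p :: "('k \<times> 'k) btree \<Rightarrow>\<^sub>0 'k"
      using that unfolding bracket_balanced_def lin_form_scale by metis
  next
    fix \<sigma> :: "nat \<Rightarrow> nat" and x assume \<sigma>: "\<sigma> permutes {1..3}" and "x \<in> ?N"
    then obtain p where p: "Poly_Mapping.keys p \<subseteq> btrees (carrier ?V) 3" "bracket_balanced p" "x = tree_class ?V 3 p"
      by blast
    \<comment> \<open>The signature of \<sigma>. Composition with \<open>swap\<close> negates
      \<open>bracket_form\<close>, so an odd permutation changes the sign of all three coordinates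
      at once, and equality among them survives.\<close>
    define \<epsilon> :: 'k where "\<epsilon> = (if \<sigma> 2 mod 3 = Suc (\<sigma> 1) mod 3 then 1 else - 1)"
    have "\<exists>u'<3. lin_form (ternary_form ?V u bracket_form bracket_form) (lin_extend (\<lambda>t. monomial (relabel \<sigma> t)) p) =
      \<epsilon> * lin_form (ternary_form ?V u' bracket_form bracket_form) p" if "u < 3" for u
    proof -
      have sw: "(\<lambda>v. bracket_form (swap ?V v)) = (\<lambda>v. - bracket_form v)"
        by auto
      obtain u' where u': "\<forall>t\<in>btrees (carrier ?V) 3. ternary_form ?V u bracket_form bracket_form (relabel \<sigma> t) =
          ternary_form ?V u' bracket_form (if \<sigma> 2 mod 3 = Suc (\<sigma> 1) mod 3 then bracket_form
            else (\<lambda>v. bracket_form (swap ?V v))) t" "u' < 3 \<or> 3 \<le> u"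
        using reg.ternary_form_relabel[OF \<sigma>] .
      have "\<forall>t\<in>btrees (carrier ?V) 3. ternary_form ?V u bracket_form bracket_form (relabel \<sigma> t) =
          \<epsilon> * ternary_form ?V u' bracket_form bracket_form t"
        using u'(1) unfolding sw by (auto simp: \<epsilon>_def ternary_form_def algebra_simps split: prod.splits)
      then have "lin_form (ternary_form ?V u bracket_form bracket_form) (lin_extend (\<lambda>t. monomial (relabel \<sigma> t)) p) =
        lin_form (\<lambda>t. \<epsilon> * ternary_form ?V u' bracket_form bracket_form t) p"
        unfolding lin_form_lin_extend using p(1) by (intro lin_form_cong) auto
      then show ?thesis
        using u'(2) that by (auto simp: lin_form_mult_left)
    qed
    then have "bracket_balanced (lin_extend (\<lambda>t. monomial (relabel \<sigma> t)) p)"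
      using p(2) unfolding bracket_balanced_def by metis
    then show "act (free_operad ?V) 3 \<sigma> x \<in> ?N"
      using p \<sigma> relabel_closed[OF \<sigma> p(1)] by (auto simp: reg.class_act simp del: regular_rep_simps(1))
  next
    have id: "label_triple 1 2 3"
      using label_triple_permutes[OF permutes_id] by simp
    \<comment> \<open>The three coordinates are all -1 for the left identity and all 1 for the right
      one.\<close>
    have "bracket_balanced (left_leibniz 1 2 3 :: ('k \<times> 'k) btree \<Rightarrow>\<^sub>0 'k)"
      "bracket_balanced (right_leibniz 1 2 3 :: ('k \<times> 'k) btree \<Rightarrow>\<^sub>0 'k)"
      unfolding bracket_balanced_def less_3_cases
      by (auto simp: left_leibniz_def right_leibniz_def lin_form_diff lin_form_add ternary_form_def)
    then show "{tree_class ?V 3 (left_leibniz 1 2 3), tree_class ?V 3 (right_leibniz 1 2 3)} \<subseteq> ?N"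
      using leibniz_closed[OF id] by auto
  qed
  then show ?thesis
    using assms that by auto
qed

section \<open>Reconstruction of an element from its pairing values\<close>

text \<open>The dual basis expansion: for basis vectors \<open>v\<close> and \<open>w\<close>, the
  value \<open>k u v w\<close> multiplies the operation built from the forms dual to
  \<open>v\<close> and \<open>w\<close> in the summand \<open>u\<close>.\<close>

definition expansion :: "(nat \<Rightarrow> 'k \<times> 'k \<Rightarrow> 'k \<times> 'k \<Rightarrow> 'k) \<Rightarrow> ('k::field \<times> 'k \<Rightarrow> 'k) btree \<Rightarrow>\<^sub>0 'k" where
  "expansion k =
    (\<Sum>u\<in>{0, 1, 2}. scale (k u (1, 0) (1, 0)) (monomial (cyclic_tree (coordinate_form 1 0) (coordinate_form 1 0) u)) +
      scale (k u (1, 0) (0, 1)) (monomial (cyclic_tree (coordinate_form 1 0) (coordinate_form 0 1) u)) +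
      (scale (k u (0, 1) (1, 0)) (monomial (cyclic_tree (coordinate_form 0 1) (coordinate_form 1 0) u)) +
      scale (k u (0, 1) (0, 1)) (monomial (cyclic_tree (coordinate_form 0 1) (coordinate_form 0 1) u))))"

lemma expansion_add: "expansion (\<lambda>u v w. k u v w + l u v w) = expansion k + expansion l"
  by (simp add: expansion_def scale_add_left algebra_simps)

lemma expansion_scale: "expansion (\<lambda>u v w. c * k u v w) = scale c (expansion k)"
  by (simp add: expansion_def scale_add_right)

lemma expansion_closed:
  "Poly_Mapping.keys (expansion k :: ('k::field \<times> 'k \<Rightarrow> 'k) btree \<Rightarrow>\<^sub>0 'k)
    \<subseteq> btrees (carrier (sign_dual regular_rep)) 3"
proof -
  have "cyclic_tree (coordinate_form a b) (coordinate_form c d) u \<in>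
    btrees (carrier (sign_dual (regular_rep :: ('k, 'k \<times> 'k) s2_module))) 3" for a b c d :: 'k and u
    by (rule dual.cyclic_tree_closed) simp_all
  then show ?thesis
    unfolding expansion_def by (simp, intro keys_addI keys_scaleI) simp_all
qed

lemma expansion_of_ternary:
  fixes \<alpha> \<beta> :: "'k::field \<times> 'k \<Rightarrow> 'k"
  assumes \<alpha>: "\<alpha> \<in> carrier (sign_dual regular_rep)" and \<beta>: "\<beta> \<in> carrier (sign_dual regular_rep)" and u: "u < 3"
  shows "tree_class (sign_dual regular_rep) 3 (expansion (\<lambda>u' v w. if u = u' then \<alpha> v * \<beta> w else 0)) =
    ternary (sign_dual regular_rep) u \<alpha> \<beta>"
proof -
  let ?W = "sign_dual (regular_rep :: ('k, 'k \<times> 'k) s2_module)"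
  let ?F = "ops (free_operad ?W) 3"
  let ?e = "coordinate_form 1 0 :: 'k \<times> 'k \<Rightarrow> 'k"
  let ?f = "coordinate_form 0 1 :: 'k \<times> 'k \<Rightarrow> 'k"
  let ?m = "\<lambda>v w. monomial (cyclic_tree v w u) :: _ \<Rightarrow>\<^sub>0 'k"
  obtain a b c d where ab: "\<alpha> = coordinate_form a b" "\<beta> = coordinate_form c d"
    using sign_dual_regular_cases[OF \<alpha>] sign_dual_regular_cases[OF \<beta>] by blast
  have exp: "expansion (\<lambda>u' v w. if u = u' then \<alpha> v * \<beta> w else 0) =
    scale a (scale c (?m ?e ?e) + scale d (?m ?e ?f)) + scale b (scale c (?m ?f ?e) + scale d (?m ?f ?f))"
    using u[unfolded less_3_cases] by (elim disjE) (simp_all add: expansion_def ab scale_add_right)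
  have split: "coordinate_form x y = x \<odot>\<^bsub>?W\<^esub> ?e \<oplus>\<^bsub>?W\<^esub> y \<odot>\<^bsub>?W\<^esub> ?f" for x y
    by simp
  have mem: "x \<odot>\<^bsub>?W\<^esub> coordinate_form y z \<in> carrier ?W"
    "x \<odot>\<^bsub>?W\<^esub> coordinate_form y z \<oplus>\<^bsub>?W\<^esub> x' \<odot>\<^bsub>?W\<^esub> coordinate_form y' z' \<in> carrier ?W" for x y z x' y' z'
    by simp_all
  have "ternary ?W u \<alpha> \<beta> =
    a \<odot>\<^bsub>?F\<^esub> (c \<odot>\<^bsub>?F\<^esub> ternary ?W u ?e ?e \<oplus>\<^bsub>?F\<^esub> d \<odot>\<^bsub>?F\<^esub> ternary ?W u ?e ?f) \<oplus>\<^bsub>?F\<^esub>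
    b \<odot>\<^bsub>?F\<^esub> (c \<odot>\<^bsub>?F\<^esub> ternary ?W u ?f ?e \<oplus>\<^bsub>?F\<^esub> d \<odot>\<^bsub>?F\<^esub> ternary ?W u ?f ?f)"
    unfolding ab
    by (subst split[of a b], subst split[of c d])
      (simp only: dual.ternary_linear_left coordinate_form_closed mem,
       simp only: dual.ternary_linear_right coordinate_form_closed mem)
  also have "\<dots> = tree_class ?W 3 (scale a (scale c (?m ?e ?e) + scale d (?m ?e ?f)) +
      scale b (scale c (?m ?f ?e) + scale d (?m ?f ?f)))"
    by (simp add: dual.class_add dual.class_scale keys_addI keys_scaleI dual.class_cyclic_tree del: scale_simps)
  finally show ?thesis
    unfolding exp by simp
qed

text \<open>Both sides are linear in \<open>x\<close>, so the formula is only computed for the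
  spanning elements, where the pairing values are products. This takes the place of a dimension
  count.\<close>

lemma expansion_of_element:
  assumes "x \<in> carrier (ops (free_operad (sign_dual (regular_rep :: ('k::field, 'k \<times> 'k) s2_module))) 3)"
  shows "x = tree_class (sign_dual regular_rep) 3
    (expansion (\<lambda>u v w. standard_pairing regular_rep x (ternary regular_rep u v w)))"
proof -
  let ?V = "regular_rep :: ('k, 'k \<times> 'k) s2_module"
  let ?W = "sign_dual ?V"
  let ?F = "ops (free_operad ?W) 3"
  let ?B = "standard_pairing ?V"
  have mem: "ternary ?V u v w \<in> carrier (ops (free_operad ?V) 3)" for u v w
    by (rule reg.ternary_closed) simp_all
  note left = linear_formsD[OF reg.standard_pairing_left[OF mem]]
  show ?thesis
    using assms
  proof (rule dual.ternary_spanning)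
    \<comment> \<open>Linear forms are only known to respect sums and scalars here, so zero is
      written as the multiple of itself by the scalar 0.\<close>
    have "?B (0 \<odot>\<^bsub>?F\<^esub> \<zero>\<^bsub>?F\<^esub>) (ternary ?V u v w) = 0" for u v w
      using left(2)[of "\<zero>\<^bsub>?F\<^esub>" 0] dual.free.vs_closed(1) by simp
    moreover have "0 \<odot>\<^bsub>?F\<^esub> \<zero>\<^bsub>?F\<^esub> = \<zero>\<^bsub>?F\<^esub>"
      using dual.class_scale[of "0 :: ('k \<times> 'k \<Rightarrow> 'k) btree \<Rightarrow>\<^sub>0 'k" 3 0] by (simp add: dual.class_zero)
    ultimately show "\<zero>\<^bsub>?F\<^esub> = tree_class ?W 3 (expansion (\<lambda>u v w. ?B \<zero>\<^bsub>?F\<^esub> (ternary ?V u v w)))"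
      by (simp add: expansion_def dual.class_zero)
  next
    fix x y assume xy: "x \<in> carrier ?F" "y \<in> carrier ?F"
      "x = tree_class ?W 3 (expansion (\<lambda>u v w. ?B x (ternary ?V u v w)))"
      "y = tree_class ?W 3 (expansion (\<lambda>u v w. ?B y (ternary ?V u v w)))"
    have "expansion (\<lambda>u v w. ?B (x \<oplus>\<^bsub>?F\<^esub> y) (ternary ?V u v w)) =
      expansion (\<lambda>u v w. ?B x (ternary ?V u v w)) + expansion (\<lambda>u v w. ?B y (ternary ?V u v w))"
      using xy(1,2) by (simp add: left(1) expansion_add)
    then show "x \<oplus>\<^bsub>?F\<^esub> y = tree_class ?W 3 (expansion (\<lambda>u v w. ?B (x \<oplus>\<^bsub>?F\<^esub> y) (ternary ?V u v w)))"
      using dual.class_add[OF expansion_closed expansion_closed] xy(3,4) by metis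
  next
    fix c x assume x: "x \<in> carrier ?F" "x = tree_class ?W 3 (expansion (\<lambda>u v w. ?B x (ternary ?V u v w)))"
    have "expansion (\<lambda>u v w. ?B (c \<odot>\<^bsub>?F\<^esub> x) (ternary ?V u v w)) =
      scale c (expansion (\<lambda>u v w. ?B x (ternary ?V u v w)))"
      using x(1) by (simp add: left(2) expansion_scale)
    then show "c \<odot>\<^bsub>?F\<^esub> x = tree_class ?W 3 (expansion (\<lambda>u v w. ?B (c \<odot>\<^bsub>?F\<^esub> x) (ternary ?V u v w)))"
      using dual.class_scale[OF expansion_closed] x(2) by metis
  next
    fix u :: nat and \<alpha> \<beta> assume a: "u < 3" "\<alpha> \<in> carrier ?W" "\<beta> \<in> carrier ?W"
    have "expansion (\<lambda>u' v w. ?B (ternary ?W u \<alpha> \<beta>) (ternary ?V u' v w)) =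
      expansion (\<lambda>u' v w. if u = u' then \<alpha> v * \<beta> w else 0)"
      using a by (simp add: expansion_def reg.standard_pairing_ternary)
    then show "ternary ?W u \<alpha> \<beta> = tree_class ?W 3 (expansion (\<lambda>u' v w. ?B (ternary ?W u \<alpha> \<beta>) (ternary ?V u' v w)))"
      using expansion_of_ternary[OF a(2,3,1)] by simp
  qed
qed

lemma standard_pairing_nondegenerate:
  assumes "x \<in> carrier (ops (free_operad (sign_dual (regular_rep :: ('k::field, 'k \<times> 'k) s2_module))) 3)"
    and "y \<in> carrier (ops (free_operad (sign_dual regular_rep)) 3)"
    and "\<And>u v w. \<lbrakk>u < 3; v \<in> {(1, 0), (0, 1)}; w \<in> {(1, 0), (0, 1)}\<rbrakk> \<Longrightarrow>
      standard_pairing regular_rep x (ternary regular_rep u v w) =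
      standard_pairing regular_rep y (ternary regular_rep u v w)"
  shows "x = y"
proof -
  have "expansion (\<lambda>u v w. standard_pairing regular_rep x (ternary regular_rep u v w)) =
    expansion (\<lambda>u v w. standard_pairing regular_rep y (ternary regular_rep u v w))"
    unfolding expansion_def using assms(3) by (intro sum.cong refl) auto
  then show ?thesis
    using expansion_of_element[OF assms(1)] expansion_of_element[OF assms(2)] by simp
qed

lemma standard_pairing_cyclic_sum:
  fixes y :: "(('k::field \<times> 'k) btree \<Rightarrow>\<^sub>0 'k) set"
  assumes "y \<in> carrier (ops (free_operad regular_rep) 3)" "\<alpha> \<in> carrier (sign_dual regular_rep)"
  shows "standard_pairing regular_rep (tree_class (sign_dual regular_rep) 3 (cyclic_sum \<alpha> a b c)) y =
    a * standard_pairing regular_rep (ternary (sign_dual regular_rep) 0 \<alpha> \<alpha>) y +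
    b * standard_pairing regular_rep (ternary (sign_dual regular_rep) 1 \<alpha> \<alpha>) y +
    c * standard_pairing regular_rep (ternary (sign_dual regular_rep) 2 \<alpha> \<alpha>) y"
  unfolding dual.class_cyclic_sum[OF assms(2)]
  using assms(2) linear_formsD[OF reg.standard_pairing_left[OF assms(1)]]
  by (simp add: dual.ternary_closed del: One_nat_def)

section \<open>The annihilator of the symmetric Leibniz relations\<close>

lemma exists_permutation_3:
  assumes "(a, b, c) \<in> {(1, 2, 3), (2, 3, 1), (3, 1, 2), (2, 1, 3), (1, 3, 2), (3, 2, 1)}"
  shows "\<exists>\<sigma>. \<sigma> permutes {1..3::nat} \<and> \<sigma> 1 = a \<and> \<sigma> 2 = b \<and> \<sigma> 3 = c"
proof -
  have t: "transpose x y permutes {1..3::nat}" if "x \<in> {1..3}" "y \<in> {1..3}" for x y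
    using that by (rule permutes_swap_id)
  consider "(a, b, c) = (1, 2, 3)" | "(a, b, c) = (2, 3, 1)" | "(a, b, c) = (3, 1, 2)" | "(a, b, c) = (2, 1, 3)"
    | "(a, b, c) = (1, 3, 2)" | "(a, b, c) = (3, 2, 1)"
    using assms by blast
  then show ?thesis
  proof cases
    case 1
    then show ?thesis by (intro exI[of _ id]) (simp add: permutes_id)
  next
    case 2
    then show ?thesis using rotation_permutes by (intro exI[of _ rotation]) simp
  next
    case 3
    then show ?thesis using rotation_pow_permutes[of 2] by (intro exI[of _ "rotation ^^ 2"]) simp
  next
    case 4
    then show ?thesis using t[of 1 2] by (intro exI[of _ "transpose 1 2"]) (simp add: transpose_def)
  next
    case 5
    then show ?thesis using t[of 2 3] by (intro exI[of _ "transpose 2 3"]) (simp add: transpose_def)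
  next
    case 6
    then show ?thesis using t[of 1 3] by (intro exI[of _ "transpose 1 3"]) (simp add: transpose_def)
  qed
qed

text \<open>For a functional that kills all Leibniz identities, \<open>x\<close>, \<open>y\<close>,
  \<open>z\<close>, \<open>w\<close> with index u are its values on \<open>ternary u\<close> with
  the decorations (e, e), (e, f), (f, e), (f, f), where e is the multiplication and f its opposite.
  The equations come in pairs, left rule before right rule, for the label orders 123, 231, 312, 213,
  132, 321.\<close>

lemma leibniz_linear_system:
  fixes x\<^sub>0 x\<^sub>1 x\<^sub>2 :: "'k::field"
  assumes "z\<^sub>1 = x\<^sub>0 + w\<^sub>2" "x\<^sub>0 = z\<^sub>1 + y\<^sub>2" "z\<^sub>2 = x\<^sub>1 + w\<^sub>0" "x\<^sub>1 = z\<^sub>2 + y\<^sub>0"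
    "z\<^sub>0 = x\<^sub>2 + w\<^sub>1" "x\<^sub>2 = z\<^sub>0 + y\<^sub>1" "w\<^sub>2 = y\<^sub>0 + z\<^sub>1" "y\<^sub>0 = w\<^sub>2 + x\<^sub>1"
    "w\<^sub>1 = y\<^sub>2 + z\<^sub>0" "y\<^sub>2 = w\<^sub>1 + x\<^sub>0" "w\<^sub>0 = y\<^sub>1 + z\<^sub>2" "y\<^sub>1 = w\<^sub>0 + x\<^sub>2"
  shows "z\<^sub>0 = - x\<^sub>0" "z\<^sub>1 = - x\<^sub>1" "z\<^sub>2 = - x\<^sub>2" "w\<^sub>0 = - y\<^sub>0" "w\<^sub>1 = - y\<^sub>1" "w\<^sub>2 = - y\<^sub>2"
    "y\<^sub>0 = - x\<^sub>0" "y\<^sub>1 = - x\<^sub>1" "y\<^sub>2 = - x\<^sub>2" "x\<^sub>0 + x\<^sub>1 + x\<^sub>2 = 0"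
proof -
  \<comment> \<open>A left and a right rule with the same labels share two products; in their sum
    these cancel and the remaining two values are opposite.\<close>
  have cancel: "r = - s" if "p = q + r" "q = p + s" for p q r s :: 'k
    using that by (metis add.assoc add_cancel_left_right eq_neg_iff_add_eq_0)
  show z: "z\<^sub>0 = - x\<^sub>0" "z\<^sub>1 = - x\<^sub>1" "z\<^sub>2 = - x\<^sub>2"
    by (rule cancel[OF assms(9,10)] cancel[OF assms(7,8)] cancel[OF assms(11,12)])+
  show w: "w\<^sub>0 = - y\<^sub>0" "w\<^sub>1 = - y\<^sub>1" "w\<^sub>2 = - y\<^sub>2"
    by (rule cancel[OF assms(3,4)] cancel[OF assms(5,6)] cancel[OF assms(1,2)])+
  \<comment> \<open>With the root signs known, each left rule for a cyclic order of the labels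
    becomes a Jacobi-like equation. One further right rule then fixes the inner sign, and the
    remaining conclusions follow.\<close>
  have y: "y\<^sub>2 = x\<^sub>0 + x\<^sub>1" "y\<^sub>0 = x\<^sub>1 + x\<^sub>2" "y\<^sub>1 = x\<^sub>2 + x\<^sub>0"
    using assms(1,3,5) unfolding z w by (simp_all add: algebra_simps)
  have "x\<^sub>0 + x\<^sub>1 = x\<^sub>0 - y\<^sub>1"
    using assms(10) unfolding w y(1) by (simp add: algebra_simps)
  then have "x\<^sub>1 + y\<^sub>1 = 0"
    by (simp add: algebra_simps)
  then show y1: "y\<^sub>1 = - x\<^sub>1"
    by (simp only: add_eq_0_iff)
  then show sum: "x\<^sub>0 + x\<^sub>1 + x\<^sub>2 = 0"
    using y(3) by (simp add: eq_neg_iff_add_eq_0 ac_simps)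
  show "y\<^sub>0 = - x\<^sub>0" "y\<^sub>2 = - x\<^sub>2"
    using sum y(1,2) by (simp_all add: eq_neg_iff_add_eq_0 ac_simps)
qed

lemma orthogonal_relations_sLeib:
  "image (tree_map dual_iso) ` orthogonal_relations regular_rep (snd sLeib) =
   (cyclic_relations :: (('k::field \<times> 'k) btree \<Rightarrow>\<^sub>0 'k) set set)"
proof -
  let ?V = "regular_rep :: ('k, 'k \<times> 'k) s2_module"
  let ?W = "sign_dual ?V"
  let ?B = "standard_pairing ?V"
  let ?R = "snd (sLeib :: ('k, 'k \<times> 'k) quadratic_data)"
  let ?\<psi> = "bracket_form :: 'k \<times> 'k \<Rightarrow> 'k"
  have image: "tree_map dual_iso ` tree_class ?W 3 (cyclic_sum ?\<psi> a b c) = tree_class ?V 3 (cyclic_sum (1, 1) a b c)"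
    for a b c
  proof -
    have "tree_map dual_iso (cyclic_sum ?\<psi> a b c) = cyclic_sum (1, 1) a b c"
      by (simp add: cyclic_sum_def cyclic_tree_def)
    then show ?thesis
      using free_operad_iso(2)[OF dual.s2_rep_axioms reg.s2_rep_axioms s2_iso_dual_iso
          dual.cyclic_sum_closed[OF coordinate_form_closed], of 1 "- 1" a b c] by simp
  qed
  \<comment> \<open>A balanced relation pairs equally with all three bracketings of \<psi>, so a
    combination with coefficient sum zero annihilates it.\<close>
  have "tree_class ?W 3 (cyclic_sum ?\<psi> a b c) \<in> orthogonal_relations ?V ?R" if abc: "a + b + c = 0" for a b c
    unfolding orthogonal_relations_def
  proof (intro CollectI conjI ballI)
    show "tree_class ?W 3 (cyclic_sum ?\<psi> a b c) \<in> carrier (ops (free_operad ?W) 3)"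
      by (intro dual.class_closed dual.cyclic_sum_closed coordinate_form_closed)
    fix r assume "r \<in> ?R"
    then obtain q where q: "Poly_Mapping.keys q \<subseteq> btrees UNIV 3" "bracket_balanced q" "r = tree_class ?V 3 q"
      by (rule sLeib_bracket_balanced)
    let ?l = "\<lambda>u. lin_form (ternary_form ?V u ?\<psi> ?\<psi>) q"
    have l: "?B (ternary ?W u ?\<psi> ?\<psi>) r = ?l 0" if u: "u < 3" for u
    proof -
      have "?l u = ?l 0"
        using q(2) u zero_less_numeral unfolding bracket_balanced_def by blast
      then show ?thesis
        using reg.standard_pairing_ternary_class[OF coordinate_form_closed coordinate_form_closed u, of q] q(1,3)
        by simp
    qed
    have "r \<in> carrier (ops (free_operad ?V) 3)"
      using q(1) unfolding q(3) by (intro reg.class_closed) simp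
    from standard_pairing_cyclic_sum[OF this coordinate_form_closed]
    have "?B (tree_class ?W 3 (cyclic_sum ?\<psi> a b c)) r = a * ?l 0 + b * ?l 0 + c * ?l 0"
      by (simp only: l zero_less_numeral less_3_cases simp_thms)
    then have "?B (tree_class ?W 3 (cyclic_sum ?\<psi> a b c)) r = (a + b + c) * ?l 0"
      by (simp only: distrib_right)
    then show "?B (tree_class ?W 3 (cyclic_sum ?\<psi> a b c)) r = 0"
      using abc by simp
  qed
  then have "cyclic_relations \<subseteq> image (tree_map dual_iso) ` orthogonal_relations ?V ?R"
    unfolding cyclic_relations_def using image by blast
  moreover have "tree_map dual_iso ` x \<in> cyclic_relations" if x: "x \<in> orthogonal_relations ?V ?R" for x
  proof -
    have xF: "x \<in> carrier (ops (free_operad ?W) 3)"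
      using x by (simp add: orthogonal_relations_def)
    define k where "k u v w = ?B x (ternary ?V u v w)" for u v w
    let ?e = "(1, 0) :: 'k \<times> 'k"
    let ?f = "(0, 1) :: 'k \<times> 'k"
    \<comment> \<open>The relation space is stable under permutations, so \<open>x\<close> is
      orthogonal to both identities with their variables in any order.\<close>
    have eq: "lin_form (\<lambda>t. case normal_form ?V t of (u, v, w) \<Rightarrow> k u v w) (left_leibniz a b c) = 0"
      "lin_form (\<lambda>t. case normal_form ?V t of (u, v, w) \<Rightarrow> k u v w) (right_leibniz a b c) = 0"
      if abc: "(a, b, c) \<in> {(1, 2, 3), (2, 3, 1), (3, 1, 2), (2, 1, 3), (1, 3, 2), (3, 2, 1)}" for a b c
    proof -
      obtain \<sigma> where \<sigma>: "\<sigma> permutes {1..3::nat}" "\<sigma> 1 = a" "\<sigma> 2 = b" "\<sigma> 3 = c"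
        using exists_permutation_3[OF abc] by blast
      have l: "label_triple 1 2 3" "label_triple a b c"
        using label_triple_permutes[OF permutes_id] label_triple_permutes[OF \<sigma>(1)] \<sigma>(2-4) by simp_all
      have "tree_class ?V 3 (left_leibniz 1 2 3) \<in> ?R" "tree_class ?V 3 (right_leibniz 1 2 3) \<in> ?R"
        unfolding sLeib_eq snd_conv by (intro equivariant_span_closed(1); simp)+
      then have "act (free_operad ?V) 3 \<sigma> (tree_class ?V 3 (left_leibniz 1 2 3)) \<in> ?R"
        "act (free_operad ?V) 3 \<sigma> (tree_class ?V 3 (right_leibniz 1 2 3)) \<in> ?R"
        unfolding sLeib_eq snd_conv by (intro equivariant_span_closed(4) \<sigma>(1); simp)+
      moreover have "lin_extend (\<lambda>t. monomial (relabel \<sigma> t)) (left_leibniz 1 2 3) = (left_leibniz a b c :: ('k \<times> 'k) btree \<Rightarrow>\<^sub>0 'k)"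
        "lin_extend (\<lambda>t. monomial (relabel \<sigma> t)) (right_leibniz 1 2 3) = (right_leibniz a b c :: ('k \<times> 'k) btree \<Rightarrow>\<^sub>0 'k)"
        using \<sigma>(2-4) by (simp_all add: left_leibniz_def right_leibniz_def lin_extend_add lin_extend_diff)
      ultimately have "tree_class ?V 3 (left_leibniz a b c) \<in> ?R" "tree_class ?V 3 (right_leibniz a b c) \<in> ?R"
        by (simp_all add: reg.class_act[OF \<sigma>(1)] leibniz_closed[OF l(1)] del: One_nat_def)
      then have "?B x (tree_class ?V 3 (left_leibniz a b c)) = 0" "?B x (tree_class ?V 3 (right_leibniz a b c)) = 0"
        using x by (simp_all add: orthogonal_relations_def)
      then show "lin_form (\<lambda>t. case normal_form ?V t of (u, v, w) \<Rightarrow> k u v w) (left_leibniz a b c) = 0"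
        "lin_form (\<lambda>t. case normal_form ?V t of (u, v, w) \<Rightarrow> k u v w) (right_leibniz a b c) = 0"
        by (simp_all add: reg.standard_pairing_class[OF xF] k_def leibniz_closed[OF l(2)])
    qed
    \<comment> \<open>The order of these instances is the order of the assumptions of the linear
      system; normal forms turn each of them into an equation between values of
      \<open>k\<close>.\<close>
    note eqs = eq[of 1 2 3] eq[of 2 3 1] eq[of 3 1 2] eq[of 2 1 3] eq[of 1 3 2] eq[of 3 2 1]
    note eqs' = eqs[unfolded left_leibniz_def right_leibniz_def, simplified lin_form_diff lin_form_add, simplified]
    have swapped: "k u ?f w = - k u ?e w" if "u < 3" "w \<in> {?e, ?f}" for u w
      using that leibniz_linear_system(1-6)[OF eqs'] by (auto simp: less_3_cases)
    have bottom: "k u ?e ?f = - k u ?e ?e" if "u < 3" for u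
      using that leibniz_linear_system(7-9)[OF eqs'] by (auto simp: less_3_cases)
    have sum: "k 0 ?e ?e + k 1 ?e ?e + k 2 ?e ?e = 0"
      using leibniz_linear_system(10)[OF eqs'] by simp
    \<comment> \<open>The sign rules determine all pairing values from the three numbers
      \<open>k u ?e ?e\<close>. The cyclic sum with these coefficients is the candidate for
      \<open>x\<close>, and their sum is zero by the Jacobi-type equation.\<close>
    define y where "y = tree_class ?W 3 (cyclic_sum ?\<psi> (k 0 ?e ?e) (k 1 ?e ?e) (k 2 ?e ?e))"
    have "x = y"
    proof (rule standard_pairing_nondegenerate[OF xF])
      show "y \<in> carrier (ops (free_operad ?W) 3)"
        unfolding y_def by (intro dual.class_closed dual.cyclic_sum_closed coordinate_form_closed)
      fix u :: nat and v w assume u: "u < 3" and vw: "v \<in> {?e, ?f}" "w \<in> {?e, ?f}"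
      \<comment> \<open>The form \<psi> is 1 on the multiplication and -1 on its opposite, so the
        product of its values reproduces exactly the sign rules that were found for
        \<open>k\<close>.\<close>
      have "?B y (ternary ?V u v w) = k u ?e ?e * (?\<psi> v * ?\<psi> w)"
        unfolding y_def using u reg.ternary_closed[of v w u]
        by (subst standard_pairing_cyclic_sum) (auto simp: reg.standard_pairing_ternary less_3_cases)
      also have "\<dots> = k u v w"
        using vw bottom[OF u] swapped[OF u, of ?e] swapped[OF u, of ?f] by auto
      finally show "?B x (ternary ?V u v w) = ?B y (ternary ?V u v w)"
        by (simp add: k_def)
    qed
    then show ?thesis
      using sum image unfolding y_def cyclic_relations_def by blast
  qed
  ultimately show ?thesis
    by blast
qed

theorem mainTheorem5:
  shows "koszul_dual_operad (sLeib :: ('k::field_char_0, 'k \<times> 'k) quadratic_data) \<cong>\<^sub>o\<^sub>p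
         quadratic_operad (ComAdm :: ('k, 'k \<times> 'k) quadratic_data)"
proof -
  have "quadratic_operad (sign_dual regular_rep, orthogonal_relations regular_rep (snd (sLeib :: ('k, 'k \<times> 'k) quadratic_data)))
    \<cong>\<^sub>o\<^sub>p quadratic_operad (regular_rep, cyclic_relations)"
    by (rule quadratic_operads_isomorphic[OF dual.s2_rep_axioms reg.s2_rep_axioms s2_iso_dual_iso _
          orthogonal_relations_sLeib]) (auto simp: orthogonal_relations_def)
  then show ?thesis
    unfolding ComAdm_eq koszul_dual_operad_def by (simp add: sLeib_eq)
qed

end
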